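(* Let $\Gamma$ be an ordinary subgraph of $\mathcal R$ such that for some $i\ge a_\Gamma$ the number of vertices of $\Gamma$ in row $i+1$ is greater than the number in row $i$. Then $\psi_\Gamma(b_1,\ldots,b_{l_\Gamma})=0$ for all integers $b_1\ge\cdots\ge b_{l_\Gamma}$.
   Context: $\mathcal R$: graph with vertex set $\mathbb Z^2$, row $i=\{(i,j)\}$, edges joining $(i,j)$ to its upper neighbours $(i-1,j)$ and $(i-1,j+1)$. Ordinary subgraph $\Gamma$: finite connected full subgraph such that $(i,j),(i,j+1)\in\Gamma\Rightarrow(i+1,j)\in\Gamma$, and, with $a_\Gamma$ the top row of $\Gamma$, for $i>a_\Gamma$: $(i,j),(i,j+1)\in\Gamma\Rightarrow(i-1,j+1)\in\Gamma$. $l_\Gamma$ = number of vertices of $\Gamma$ in row $a_\Gamma$. $D_\Gamma(b_1,\ldots,b_{l_\Gamma})$: real arrays $(s_{i,j})$ vanishing off $\Gamma$, with row $a_\Gamma$ entries $b_1,\ldots,b_{l_\Gamma}$ left to right, and $s_{i-1,j}\ge s_{i,j}\ge s_{i-1,j+1}$ whenever the relevant vertices are in $\Gamma$ (a finite-dimensional rational polyhedron). For a face $f$, $\Delta_f$ is the subgraph of $\Gamma$ with all vertices of $\Gamma$ and those edges whose two coordinates are equal at a point whose minimal face is $f$. $\varphi_\Gamma(b_1,\ldots,b_{l_\Gamma})(f)=\prod_{l\ge1}(1-t^l)^{d_l}$, where $d_l$ is the number of pairs $(E,i)$ with $E$ a connected component of $\Delta_f$ and $i>a_\Gamma$ such that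 $E$ has exactly $l-1$ vertices in row $i-1$ and $l$ vertices in row $i$. For a face-weight $\varphi$ on a rational polyhedron $P$, with $g(x)=\varphi(\text{minimal face containing }x)$, $S_\varphi(P)=\sum_{a\in P\cap\mathbb Z^{(\mathbb Z^2)}}g(a)e^a$ where $e^a=\prod t_{i,j}^{a_{i,j}}$, and $\sigma_\varphi(P)=QS_\varphi(P)/Q$ is the weighted integer point transform (rational function in the $t_{i,j}$ over $\mathbb Z[t]$; $Q$ any nonzero Laurent polynomial making $QS_\varphi(P)$ a Laurent polynomial). $F$ is the specialization $t_{i,j}\mapsto x_i^{-1}x_{i+1}$, and $\psi_\Gamma(b_1,\ldots,b_{l_\Gamma})=F\big(\sigma_{\varphi_\Gamma(b_1,\ldots,b_{l_\Gamma})}(D_\Gamma(b_1,\ldots,b_{l_\Gamma}))\big)$, a well-defined rational function in the $x_i$. *)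

theory Defs
  imports
    "HOL-Analysis.Polytope"
    "HOL-Analysis.Finite_Function_Topology"
    "HOL-Library.Product_Lexorder"
    "HOL-Computational_Algebra.Polynomial"
    "HOL-Computational_Algebra.Fraction_Field"
begin

text \<open>
  \<^theory>\<open>HOL-Library.Product_Lexorder\<close> serves only to make the rings of Laurent polynomials below
  instances of \<^class>\<open>idom\<close>. It is incompatible with the componentwise order on pairs that
  the theory \<open>HOL-Analysis.Analysis\<close> loads.
\<close>

section \<open>Ordinary subgraphs\<close>

type_synonym vertex = "int \<times> int"

definition R_edges :: "(vertex \<times> vertex) set" where
  "R_edges = (let U = {((i, j), (i', j')). i' = i - 1 \<and> (j' = j \<or> j' = j + 1)} in U \<union> U\<inverse>)"

text \<open>
  A full subgraph is given by its vertex set; a general subgraph by its vertex set and its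
  symmetric set of edges.
\<close>

definition full_edges :: "vertex set \<Rightarrow> (vertex \<times> vertex) set" where
  "full_edges \<Gamma> = R_edges \<inter> \<Gamma> \<times> \<Gamma>"

definition components :: "vertex set \<Rightarrow> (vertex \<times> vertex) set \<Rightarrow> vertex set set" where
  "components V E = V // (E\<^sup>* \<inter> V \<times> V)"

definition row :: "vertex set \<Rightarrow> int \<Rightarrow> vertex set" where
  "row \<Gamma> i = {v \<in> \<Gamma>. fst v = i}"

text \<open>Upper neighbours have the smaller row index, so the top row is the minimal one.\<close>

definition top_row :: "vertex set \<Rightarrow> int" where
  "top_row \<Gamma> = Min (fst ` \<Gamma>)"

definition top_length :: "vertex set \<Rightarrow> nat" where
  "top_length \<Gamma> = card (row \<Gamma> (top_row \<Gamma>))"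

definition ordinary :: "vertex set \<Rightarrow> bool" where
  "ordinary \<Gamma> \<longleftrightarrow>
     finite \<Gamma> \<and> \<Gamma> \<noteq> {} \<and>
     (\<forall>u\<in>\<Gamma>. \<forall>v\<in>\<Gamma>. (u, v) \<in> (full_edges \<Gamma>)\<^sup>*) \<and>
     (\<forall>i j. (i, j) \<in> \<Gamma> \<and> (i, j + 1) \<in> \<Gamma> \<longrightarrow> (i + 1, j) \<in> \<Gamma>) \<and>
     (\<forall>i j. i > top_row \<Gamma> \<and> (i, j) \<in> \<Gamma> \<and> (i, j + 1) \<in> \<Gamma> \<longrightarrow> (i - 1, j + 1) \<in> \<Gamma>)"

section \<open>The polyhedron and its face weight\<close>

type_synonym array = "vertex \<Rightarrow>\<^sub>0 real"

definition D_poly :: "vertex set \<Rightarrow> real list \<Rightarrow> array set" where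
  "D_poly \<Gamma> bs = {s.
     (\<forall>v. v \<notin> \<Gamma> \<longrightarrow> Poly_Mapping.lookup s v = 0) \<and>
     map (\<lambda>j. Poly_Mapping.lookup s (top_row \<Gamma>, j)) (sorted_list_of_set {j. (top_row \<Gamma>, j) \<in> \<Gamma>}) = bs \<and>
     (\<forall>i j. (i - 1, j) \<in> \<Gamma> \<and> (i, j) \<in> \<Gamma> \<longrightarrow> Poly_Mapping.lookup s (i - 1, j) \<ge> Poly_Mapping.lookup s (i, j)) \<and>
     (\<forall>i j. (i, j) \<in> \<Gamma> \<and> (i - 1, j + 1) \<in> \<Gamma> \<longrightarrow> Poly_Mapping.lookup s (i, j) \<ge> Poly_Mapping.lookup s (i - 1, j + 1))}"

definition minimal_face :: "'a::real_vector set \<Rightarrow> 'a \<Rightarrow> 'a set" where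
  "minimal_face P x = \<Inter>{f. f face_of P \<and> x \<in> f}"

definition Delta_edges :: "vertex set \<Rightarrow> real list \<Rightarrow> array set \<Rightarrow> (vertex \<times> vertex) set" where
  "Delta_edges \<Gamma> bs f = {(u, v) \<in> full_edges \<Gamma>.
     \<exists>s \<in> D_poly \<Gamma> bs. minimal_face (D_poly \<Gamma> bs) s = f \<and> Poly_Mapping.lookup s u = Poly_Mapping.lookup s v}"

definition d_count :: "vertex set \<Rightarrow> real list \<Rightarrow> array set \<Rightarrow> nat \<Rightarrow> nat" where
  "d_count \<Gamma> bs f l = card {(E, i).
     E \<in> components \<Gamma> (Delta_edges \<Gamma> bs f) \<and> i > top_row \<Gamma> \<and>
     card (row E (i - 1)) = l - 1 \<and> card (row E i) = l}"

text \<open>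
  The weight lies in \<open>\<int>[t]\<close>, with \<open>t\<close> the variable of \<^typ>\<open>int poly\<close>. The product over all
  \<open>l \<ge> 1\<close> stops at \<open>card \<Gamma>\<close>, beyond which the exponents vanish.
\<close>

definition face_weight :: "vertex set \<Rightarrow> real list \<Rightarrow> array set \<Rightarrow> int poly" where
  "face_weight \<Gamma> bs f = (\<Prod>l = 1..card \<Gamma>. (1 - monom 1 l) ^ d_count \<Gamma> bs f l)"

section \<open>Weighted integer point transforms\<close>

text \<open>
  \<open>'v laurent\<close> is the ring of Laurent polynomials over \<open>\<int>[t]\<close> in variables indexed by \<open>'v\<close>:
  finitely supported functions on the group of exponents, with convolution as product.
  Formal Laurent series, infinite in all directions, are arbitrary functions on the exponents;
  they form a module over the Laurent polynomials.
\<close>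

type_synonym 'v laurent = "('v \<Rightarrow>\<^sub>0 int) \<Rightarrow>\<^sub>0 int poly"
type_synonym 'v series = "('v \<Rightarrow>\<^sub>0 int) \<Rightarrow> int poly"

definition laurent_times_series :: "'v laurent \<Rightarrow> 'v series \<Rightarrow> 'v series" where
  "laurent_times_series Q S = (\<lambda>a. \<Sum>m\<in>Poly_Mapping.keys Q. Poly_Mapping.lookup Q m * S (a - m))"

definition weighted_series :: "(array set \<Rightarrow> int poly) \<Rightarrow> array set \<Rightarrow> vertex series" where
  "weighted_series \<phi> P = (\<lambda>a.
     let x = Poly_Mapping.map real_of_int a in if x \<in> P then \<phi> (minimal_face P x) else 0)"

definition weighted_ipt :: "(array set \<Rightarrow> int poly) \<Rightarrow> array set \<Rightarrow> vertex laurent fract" where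
  "weighted_ipt \<phi> P = (THE r. \<exists>Q p. Q \<noteq> 0 \<and>
     laurent_times_series Q (weighted_series \<phi> P) = Poly_Mapping.lookup p \<and> r = Fract p Q)"

section \<open>The specialization\<close>

definition F_exponent :: "(vertex \<Rightarrow>\<^sub>0 int) \<Rightarrow> (int \<Rightarrow>\<^sub>0 int)" where
  "F_exponent a = (\<Sum>(i, j)\<in>Poly_Mapping.keys a.
     Poly_Mapping.single (i + 1) (Poly_Mapping.lookup a (i, j)) - Poly_Mapping.single i (Poly_Mapping.lookup a (i, j)))"

definition F_laurent :: "vertex laurent \<Rightarrow> int laurent" where
  "F_laurent p = (\<Sum>a\<in>Poly_Mapping.keys p. Poly_Mapping.single (F_exponent a) (Poly_Mapping.lookup p a))"

text \<open>
  The substitution \<open>t\<^sub>i\<^sub>,\<^sub>j \<mapsto> x\<^sub>i\<^sup>-\<^sup>1 x\<^sub>i\<^sub>+\<^sub>1\<close> is not injective on Laurent polynomials, so it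
  applies to those rational functions that have a denominator it does not annihilate; the value
  does not depend on the fraction chosen.
\<close>

definition F_spec :: "vertex laurent fract \<Rightarrow> int laurent fract" where
  "F_spec r = (THE y. \<exists>p q. F_laurent q \<noteq> 0 \<and> r = Fract p q \<and>
     y = Fract (F_laurent p) (F_laurent q))"

definition psi :: "vertex set \<Rightarrow> int list \<Rightarrow> int laurent fract" where
  "psi \<Gamma> bs = (let b = map real_of_int bs in
     F_spec (weighted_ipt (face_weight \<Gamma> b) (D_poly \<Gamma> b)))"

end

theory Submission
  imports
    Defs
    "HOL-Computational_Algebra.Polynomial_Factorial"
begin

text \<open>
  Along the specialization an array contributes a monomial that depends only on its row sums, and
  its weight is a product over pairs of consecutive rows: the factor \<open>1 - t ^ m\<close> occurs for every
  value taken \<open>m\<close> times in the lower and \<open>m - 1\<close> times in the upper row. Summing over one row with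
  its two neighbours fixed is therefore a transfer matrix computation along the values, and a
  Yang--Baxter relation shows that this sum does not change, up to a constant factor, when the two
  steps above and below the row are exchanged along with the corresponding variables \<open>x\<^sub>r\<close>,
  \<open>x\<^sub>r\<^sub>+\<^sub>1\<close>. In this way a step that enlarges the row is moved downwards. It finally sits between two
  empty rows, where the sum over the single entry is a two-sided geometric series, whose value as a
  rational function is \<open>0\<close>.
\<close>

abbreviation (input) lookup :: "('a \<Rightarrow>\<^sub>0 'b::zero) \<Rightarrow> 'a \<Rightarrow> 'b" where "lookup \<equiv> Poly_Mapping.lookup"
abbreviation (input) keys :: "('a \<Rightarrow>\<^sub>0 'b::zero) \<Rightarrow> 'a set" where "keys \<equiv> Poly_Mapping.keys"
abbreviation (input) single :: "'a \<Rightarrow> 'b::zero \<Rightarrow> 'a \<Rightarrow>\<^sub>0 'b" where "single \<equiv> Poly_Mapping.single"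

section \<open>Regularized summation\<close>

lemma poly_mapping_additive_induct [case_names zero single add]:
  assumes "P 0" "\<And>m k. P (single m k)" "\<And>f g. P f \<Longrightarrow> P g \<Longrightarrow> P (f + g)"
  shows "P (f :: 'a \<Rightarrow>\<^sub>0 'b::comm_monoid_add)"
proof (induction f rule: update_induct)
  case const
  show ?case by (rule assms(1))
next
  case (update f a b)
  have "Poly_Mapping.update a b f = f + single a b"
    using update by (intro poly_mapping_eqI)
      (auto simp: lookup_update lookup_add lookup_single when_def in_keys_iff)
  then show ?case using update assms by simp
qed

definition conv :: "('g::ab_group_add \<Rightarrow>\<^sub>0 'k::comm_ring_1) \<Rightarrow> ('g \<Rightarrow> 'k) \<Rightarrow> 'g \<Rightarrow> 'k" where
  "conv Q g x = (\<Sum>m\<in>keys Q. lookup Q m * g (x - m))"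

lemma conv_0 [simp]: "conv 0 g = (\<lambda>x. 0)"
  by (simp add: conv_def fun_eq_iff)

lemma conv_single [simp]: "conv (single m k) g = (\<lambda>x. k * g (x - m))"
  by (simp add: conv_def fun_eq_iff)

lemma conv_1 [simp]: "conv 1 g = g"
  by (simp flip: single_one)

lemma conv_add: "conv (P + Q) g = (\<lambda>x. conv P g x + conv Q g x)"
  unfolding conv_def by (rule ext, rule setsum_keys_plus_distrib) (simp_all add: distrib_right)

lemma conv_diff: "conv (P - Q) g = (\<lambda>x. conv P g x - conv Q g x)"
  using conv_add[of "P - Q" Q g] by (simp add: fun_eq_iff)

lemma conv_fun_add: "conv Q (\<lambda>x. f x + g x) = (\<lambda>x. conv Q f x + conv Q g x)"
  by (simp add: conv_def fun_eq_iff distrib_left sum.distrib)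

lemma conv_fun_scale: "conv Q (\<lambda>x. k * f x) = (\<lambda>x. k * conv Q f x)"
  by (simp add: conv_def fun_eq_iff sum_distrib_left mult.left_commute)

lemma conv_fun_shift: "conv Q (\<lambda>x. f (x - m)) = (\<lambda>x. conv Q f (x - m))"
  by (simp add: conv_def fun_eq_iff algebra_simps)

lemma conv_mult: "conv (P * Q) g = conv P (conv Q g)"
proof (induction P rule: poly_mapping_additive_induct)
  case (single m k)
  show ?case
  proof (induction Q rule: poly_mapping_additive_induct)
    case (single m' k')
    show ?case by (simp add: mult_single algebra_simps)
  qed (simp_all add: conv_add distrib_left)
qed (simp_all add: conv_add distrib_right)

lemma conv_commute: "conv P (conv Q g) = conv Q (conv P g)"
  by (simp add: mult.commute flip: conv_mult)

definition mass :: "('g::ab_group_add \<Rightarrow>\<^sub>0 'k::comm_ring_1) \<Rightarrow> 'k" where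
  "mass Q = (\<Sum>m\<in>keys Q. lookup Q m)"

lemma conv_const: "conv Q (\<lambda>x. k) = (\<lambda>x. mass Q * k)"
  by (simp add: conv_def mass_def fun_eq_iff sum_distrib_right)

lemma mass_eq_conv: "mass Q = conv Q (\<lambda>x. 1) 0"
  by (simp add: conv_const)

lemma mass_0 [simp]: "mass 0 = 0"
  by (simp add: mass_def)

lemma mass_1 [simp]: "mass 1 = 1"
  by (simp add: mass_def)

lemma mass_single [simp]: "mass (single m k) = k"
  by (simp add: mass_def)

lemma mass_add: "mass (P + Q) = mass P + mass Q"
  unfolding mass_eq_conv conv_add ..

lemma mass_diff: "mass (P - Q) = mass P - mass Q"
  using mass_add[of "P - Q" Q] by simp

lemma mass_mult: "mass (P * Q) = mass P * mass Q"
proof -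
  have "mass (P * Q) = conv P (conv Q (\<lambda>x. 1)) 0" unfolding mass_eq_conv conv_mult ..
  also have "\<dots> = mass P * mass Q" unfolding conv_const mult_1_right ..
  finally show ?thesis .
qed

lemma mass_prod: "mass (\<Prod>i\<in>A. f i) = (\<Prod>i\<in>A. mass (f i))"
  by (induction A rule: infinite_finite_induct) (auto simp: mass_mult)

definition finite_support :: "('g \<Rightarrow> 'k::zero) \<Rightarrow> bool" where
  "finite_support h \<longleftrightarrow> finite {x. h x \<noteq> 0}"

lemma finite_supportI: "finite A \<Longrightarrow> (\<And>x. h x \<noteq> 0 \<Longrightarrow> x \<in> A) \<Longrightarrow> finite_support h"
  unfolding finite_support_def by (rule finite_subset) auto

lemma finite_support_0 [simp]: "finite_support (\<lambda>x. 0)"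
  by (simp add: finite_support_def)

lemma finite_support_add:
  "finite_support f \<Longrightarrow> finite_support g \<Longrightarrow> finite_support (\<lambda>x. f x + g x :: 'k::comm_monoid_add)"
  unfolding finite_support_def by (rule finite_subset[of _ "{x. f x \<noteq> 0} \<union> {x. g x \<noteq> 0}"]) auto

lemma finite_support_scale: "finite_support f \<Longrightarrow> finite_support (\<lambda>x. k * f x :: 'k::comm_ring_1)"
  unfolding finite_support_def by (rule finite_mult_not_eq_zero_leftI)

lemma finite_support_shift: "finite_support f \<Longrightarrow> finite_support (\<lambda>x. f (x - m :: 'g::ab_group_add))"
  unfolding finite_support_def
  by (rule finite_subset[of _ "(\<lambda>x. x + m) ` {x. f x \<noteq> 0}"]) (auto simp: image_iff intro!: exI[of _ "_ - m"])

lemma Sum_any_add: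
  "finite_support f \<Longrightarrow> finite_support g \<Longrightarrow> Sum_any (\<lambda>x. f x + g x) = Sum_any f + (Sum_any g :: 'k::comm_monoid_add)"
  unfolding finite_support_def by (rule Sum_any.distrib)

lemma Sum_any_scale: "finite_support f \<Longrightarrow> Sum_any (\<lambda>x. k * f x) = k * (Sum_any f :: 'k::comm_ring_1)"
  unfolding finite_support_def by (rule Sum_any_right_distrib[symmetric])

lemma Sum_any_shift: "Sum_any (\<lambda>x. f (x - m :: 'g::ab_group_add)) = Sum_any f"
proof (rule Sum_any.reindex_cong[symmetric])
  show "bij (\<lambda>x. x - m)" by (rule bij_betw_byWitness[where f' = "\<lambda>x. x + m"]) auto
qed (simp add: o_def)

lemma finite_support_conv_and_Sum_any_conv:
  assumes "finite_support h"
  shows "finite_support (conv Q h) \<and> Sum_any (conv Q h) = mass Q * Sum_any h"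
proof (induction Q rule: poly_mapping_additive_induct)
  case (single m k)
  show ?case using assms
    by (simp add: finite_support_scale finite_support_shift Sum_any_scale Sum_any_shift)
next
  case (add f g)
  then show ?case by (simp add: conv_add finite_support_add Sum_any_add mass_add distrib_right)
qed simp

lemmas finite_support_conv = finite_support_conv_and_Sum_any_conv[THEN conjunct1]
  and Sum_any_conv = finite_support_conv_and_Sum_any_conv[THEN conjunct2]

text \<open>
  The value of a two-sided series as a rational function, made into a summation functional. Thus
  \<open>\<Sum>n\<in>\<int>. r ^ n\<close> has the value \<open>0\<close> for \<open>r \<noteq> 1\<close>.
\<close>

definition has_reg_sum :: "('g::ab_group_add \<Rightarrow> 'k::idom) \<Rightarrow> 'k \<Rightarrow> bool" where
  "has_reg_sum g s \<longleftrightarrow> (\<exists>Q. mass Q \<noteq> 0 \<and> finite_support (conv Q g) \<and> Sum_any (conv Q g) = s * mass Q)"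

lemma has_reg_sumE:
  assumes "has_reg_sum g s"
  obtains Q where "mass Q \<noteq> 0" "finite_support (conv Q g)" "Sum_any (conv Q g) = s * mass Q"
  using assms by (auto simp: has_reg_sum_def)

lemma has_reg_sum_kernel:
  assumes "has_reg_sum g s" "finite_support (conv Q g)"
  shows "Sum_any (conv Q g) = s * mass Q"
proof -
  obtain P where P: "mass P \<noteq> 0" "finite_support (conv P g)" "Sum_any (conv P g) = s * mass P"
    using assms(1) by (rule has_reg_sumE)
  have "mass P * Sum_any (conv Q g) = Sum_any (conv P (conv Q g))"
    using Sum_any_conv[OF assms(2)] by simp
  also have "conv P (conv Q g) = conv Q (conv P g)" by (rule conv_commute)
  also have "Sum_any \<dots> = mass Q * Sum_any (conv P g)" using Sum_any_conv[OF P(2)] by simp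
  finally have "mass P * Sum_any (conv Q g) = mass P * (s * mass Q)"
    using P(3) by (simp add: algebra_simps)
  then show ?thesis using P(1) by simp
qed

lemma has_reg_sum_exists:
  assumes "mass Q \<noteq> 0" "finite_support (conv Q g)"
  shows "\<exists>s. has_reg_sum (g :: 'g::ab_group_add \<Rightarrow> 'k::field) s"
  by (rule exI[of _ "Sum_any (conv Q g) / mass Q"]) (use assms in \<open>auto simp: has_reg_sum_def\<close>)

lemma has_reg_sum_finite: "finite_support g \<Longrightarrow> has_reg_sum g (Sum_any g)"
  unfolding has_reg_sum_def by (intro exI[of _ 1]) simp

lemma has_reg_sum_scale: "has_reg_sum g s \<Longrightarrow> has_reg_sum (\<lambda>x. k * g x) (k * s)"
  unfolding has_reg_sum_def by (auto simp: conv_fun_scale finite_support_scale Sum_any_scale mult.assoc)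

lemma has_reg_sum_shift:
  assumes "has_reg_sum g s" shows "has_reg_sum (\<lambda>x. g (x - m)) s"
  using assms unfolding has_reg_sum_def by (auto simp: conv_fun_shift finite_support_shift Sum_any_shift)

lemma has_reg_sum_conv_cancel:
  assumes "has_reg_sum (conv Q g) (s * mass Q)" "mass Q \<noteq> 0"
  shows "has_reg_sum g s"
proof -
  obtain P where P: "mass P \<noteq> 0" "finite_support (conv P (conv Q g))" "Sum_any (conv P (conv Q g)) = s * mass Q * mass P"
    using assms(1) by (rule has_reg_sumE)
  show ?thesis unfolding has_reg_sum_def
    by (rule exI[of _ "P * Q"]) (use P assms(2) in \<open>auto simp: conv_mult mass_mult algebra_simps\<close>)
qed

lemma has_reg_sum_add:
  assumes "has_reg_sum g s" "has_reg_sum h s'"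
  shows "has_reg_sum (\<lambda>x. g x + h x) (s + s')"
proof -
  obtain P where P: "mass P \<noteq> 0" "finite_support (conv P g)" "Sum_any (conv P g) = s * mass P"
    using assms(1) by (rule has_reg_sumE)
  obtain Q where Q: "mass Q \<noteq> 0" "finite_support (conv Q h)" "Sum_any (conv Q h) = s' * mass Q"
    using assms(2) by (rule has_reg_sumE)
  have "finite_support (conv (P * Q) g)" "Sum_any (conv (P * Q) g) = s * mass (P * Q)"
    using finite_support_conv_and_Sum_any_conv[OF P(2), of Q] P(3)
    by (simp_all add: mass_mult mult.commute[of P] flip: conv_mult)
  moreover have "finite_support (conv (P * Q) h)" "Sum_any (conv (P * Q) h) = s' * mass (P * Q)"
    using finite_support_conv_and_Sum_any_conv[OF Q(2), of P] Q(3)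
    by (simp_all add: mass_mult algebra_simps flip: conv_mult)
  ultimately show ?thesis unfolding has_reg_sum_def
    by (intro exI[of _ "P * Q"])
      (use P(1) Q(1) in \<open>simp add: conv_fun_add finite_support_add Sum_any_add mass_mult distrib_right\<close>)
qed

lemma has_reg_sum_periodic:
  fixes g :: "'g::ab_group_add \<Rightarrow> 'k::idom"
  assumes "\<And>x. g (x + v) = r * g x" "r \<noteq> 1"
  shows "has_reg_sum g 0"
proof -
  have "g x - r * g (x - v) = 0" for x using assms(1)[of "x - v"] by simp
  then have "conv (1 - single v r) g = (\<lambda>x. 0)" unfolding conv_diff conv_single conv_1 by (rule ext)
  then show ?thesis
    unfolding has_reg_sum_def using assms(2) by (intro exI[of _ "1 - single v r"]) (simp add: mass_diff)
qed

definition tail_wt :: "'k::field \<Rightarrow> int \<Rightarrow> 'k" where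
  "tail_wt r k = (if k < 0 then 1 else if k = 0 then 1 / (1 - r) else 0)"

text \<open>
  Where a series is geometric in direction \<open>v\<close> beyond the hyperplane \<open>h = H\<close>, the values on this
  hyperplane are multiplied by \<open>\<Sum>n\<ge>0. r ^ n\<close> to account for everything beyond.
\<close>

lemma has_reg_sum_geometric_tail:
  fixes w :: "'g::ab_group_add \<Rightarrow> 'k::field" and h :: "'g \<Rightarrow> int"
  assumes h: "\<And>x. h (x + v) = h x + 1" and r: "r \<noteq> 1"
    and w: "\<And>x. h x \<ge> H \<Longrightarrow> w (x + v) = r * w x"
    and truncated: "has_reg_sum (\<lambda>x. tail_wt r (h x - H) * w x) s"
    and boundary: "has_reg_sum (\<lambda>x. w x when h x = H) s'"
  shows "has_reg_sum w s"
proof -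
  define E where "E = (\<lambda>x. w x when h x = H)"
  define d where "d x = w x - tail_wt r (h x - H) * w x" for x
  define K where "K = 1 - single v r"
  have h': "h (x - v) = h x - 1" for x using h[of "x - v"] by simp
  have w': "w x = r * w (x - v)" if "h x > H" for x using w[of "x - v"] that by (simp add: h')
  have conv_d: "conv K d = (\<lambda>x. r / (1 - r) * (E (x - v) + (- 1) * E x))"
  proof
    fix x
    consider (below) "h x < H" | (boundary) "h x = H" | (above) "h x > H" by linarith
    then show "conv K d x = r / (1 - r) * (E (x - v) + (- 1) * E x)"
    proof cases
      case above
      then show ?thesis
        using w'[OF above] r by (cases "h x = H + 1") (simp_all add: K_def conv_diff d_def E_def tail_wt_def h' field_simps)
    qed (use r in \<open>simp_all add: K_def conv_diff d_def E_def tail_wt_def h' field_simps\<close>)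
  qed
  have "has_reg_sum E s'" unfolding E_def by (rule boundary)
  then have "has_reg_sum (\<lambda>x. r / (1 - r) * (E (x - v) + (- 1) * E x)) (r / (1 - r) * (s' + (- 1) * s'))"
    by (intro has_reg_sum_scale[OF has_reg_sum_add[OF has_reg_sum_shift has_reg_sum_scale]])
  then have "has_reg_sum (conv K d) (0 * mass K)" unfolding conv_d by simp
  then have "has_reg_sum d 0" by (rule has_reg_sum_conv_cancel) (use r in \<open>simp add: K_def mass_diff\<close>)
  from has_reg_sum_add[OF truncated this] show ?thesis by (simp add: d_def)
qed

lemma has_reg_sum_two_geometric_tails:
  fixes w :: "'g::ab_group_add \<Rightarrow> 'k::field" and h\<^sub>1 h\<^sub>2 :: "'g \<Rightarrow> int"
  assumes h\<^sub>1: "\<And>x. h\<^sub>1 (x + v\<^sub>1) = h\<^sub>1 x + 1" and h\<^sub>2: "\<And>x. h\<^sub>2 (x + v\<^sub>2) = h\<^sub>2 x + 1"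
    and r: "r\<^sub>1 \<noteq> 1" "r\<^sub>2 \<noteq> 1"
    and w\<^sub>1: "\<And>x. h\<^sub>1 x \<ge> H\<^sub>1 \<Longrightarrow> w (x + v\<^sub>1) = r\<^sub>1 * w x"
    and w\<^sub>2: "\<And>x. h\<^sub>2 x \<ge> H\<^sub>2 \<Longrightarrow> w (x + v\<^sub>2) = r\<^sub>2 * w x"
    and h\<^sub>1\<^sub>2: "\<And>x. h\<^sub>2 x \<ge> H\<^sub>2 \<Longrightarrow> h\<^sub>1 (x + v\<^sub>2) = h\<^sub>1 x \<or> h\<^sub>1 (x + v\<^sub>2) < H\<^sub>1 \<and> h\<^sub>1 x < H\<^sub>1"
    and fin: "finite {x. w x \<noteq> 0 \<and> h\<^sub>1 x \<le> H\<^sub>1 \<and> h\<^sub>2 x \<le> H\<^sub>2}"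
  shows "has_reg_sum w (Sum_any (\<lambda>x. tail_wt r\<^sub>2 (h\<^sub>2 x - H\<^sub>2) * (tail_wt r\<^sub>1 (h\<^sub>1 x - H\<^sub>1) * w x)))"
proof -
  have one_tail: "has_reg_sum f (Sum_any (\<lambda>x. tail_wt r\<^sub>2 (h\<^sub>2 x - H\<^sub>2) * f x))"
    if supp: "\<And>x. f x \<noteq> 0 \<Longrightarrow> w x \<noteq> 0 \<and> h\<^sub>1 x \<le> H\<^sub>1"
      and f: "\<And>x. h\<^sub>2 x \<ge> H\<^sub>2 \<Longrightarrow> f (x + v\<^sub>2) = r\<^sub>2 * f x" for f
  proof (rule has_reg_sum_geometric_tail[where h = h\<^sub>2 and w = f, OF h\<^sub>2 r(2) f])
    have "finite_support (\<lambda>x. tail_wt r\<^sub>2 (h\<^sub>2 x - H\<^sub>2) * f x)"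
      by (rule finite_supportI[OF fin]) (use supp in \<open>auto simp: tail_wt_def split: if_splits\<close>)
    then show "has_reg_sum (\<lambda>x. tail_wt r\<^sub>2 (h\<^sub>2 x - H\<^sub>2) * f x) (Sum_any (\<lambda>x. tail_wt r\<^sub>2 (h\<^sub>2 x - H\<^sub>2) * f x))"
      by (rule has_reg_sum_finite)
    have "finite_support (\<lambda>x. f x when h\<^sub>2 x = H\<^sub>2)"
      by (rule finite_supportI[OF fin]) (use supp in auto)
    then show "has_reg_sum (\<lambda>x. f x when h\<^sub>2 x = H\<^sub>2) (Sum_any (\<lambda>x. f x when h\<^sub>2 x = H\<^sub>2))"
      by (rule has_reg_sum_finite)
  qed
  show ?thesis
  proof (rule has_reg_sum_geometric_tail[where h = h\<^sub>1 and w = w, OF h\<^sub>1 r(1) w\<^sub>1])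
    show "has_reg_sum (\<lambda>x. tail_wt r\<^sub>1 (h\<^sub>1 x - H\<^sub>1) * w x)
      (Sum_any (\<lambda>x. tail_wt r\<^sub>2 (h\<^sub>2 x - H\<^sub>2) * (tail_wt r\<^sub>1 (h\<^sub>1 x - H\<^sub>1) * w x)))"
      by (rule one_tail) (use h\<^sub>1\<^sub>2 w\<^sub>2 in \<open>force simp: tail_wt_def split: if_splits\<close>)+
    show "has_reg_sum (\<lambda>x. w x when h\<^sub>1 x = H\<^sub>1) (Sum_any (\<lambda>x. tail_wt r\<^sub>2 (h\<^sub>2 x - H\<^sub>2) * (w x when h\<^sub>1 x = H\<^sub>1)))"
      by (rule one_tail) (use h\<^sub>1\<^sub>2 w\<^sub>2 in \<open>force simp: when_def split: if_splits\<close>)+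
  qed
qed

definition fibre :: "('g \<Rightarrow> 'h) \<Rightarrow> 'h \<Rightarrow> ('g \<Rightarrow> 'k::zero) \<Rightarrow> 'g \<Rightarrow> 'k" where
  "fibre \<pi> b g x = (g x when \<pi> x = b)"

lemma conv_fibre:
  assumes "\<And>x y. \<pi> (x - y) = \<pi> x - (\<pi> y :: 'h::ab_group_add)" "\<And>m. m \<in> keys Q \<Longrightarrow> \<pi> m = 0"
  shows "conv Q (fibre \<pi> b g) = fibre \<pi> b (conv Q g)"
  by (auto simp: conv_def fibre_def fun_eq_iff when_def assms)

lemma fibre_conv:
  assumes "\<And>x y. \<pi> (x - y) = \<pi> x - (\<pi> y :: 'h::ab_group_add)"
  shows "fibre \<pi> b (conv Q g) = (\<lambda>x. \<Sum>m\<in>keys Q. lookup Q m * fibre \<pi> (b - \<pi> m) g (x - m))"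
  by (auto simp: conv_def fibre_def fun_eq_iff when_def assms)

lemma Sum_any_eq_0_fibrewise:
  assumes fin: "finite_support g" and null: "\<And>y. Sum_any (fibre \<pi> (\<pi> y) g) = 0"
  shows "Sum_any g = (0 :: 'k::comm_monoid_add)"
proof -
  let ?S = "{x. g x \<noteq> 0}"
  have fibre_sum: "sum g {x \<in> ?S. \<pi> x = \<pi> y} = 0" for y
  proof -
    have "Sum_any (fibre \<pi> (\<pi> y) g) = sum (fibre \<pi> (\<pi> y) g) {x \<in> ?S. \<pi> x = \<pi> y}"
      using fin by (intro Sum_any.expand_superset) (auto simp: finite_support_def fibre_def)
    also have "\<dots> = sum g {x \<in> ?S. \<pi> x = \<pi> y}" by (rule sum.cong) (auto simp: fibre_def)
    finally show ?thesis using null[of y] by simp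
  qed
  have "Sum_any g = (\<Sum>b\<in>\<pi> ` ?S. sum g {x \<in> ?S. \<pi> x = b})"
    unfolding Sum_any.expand_set using fin by (intro sum.image_gen) (simp add: finite_support_def)
  also have "\<dots> = 0" using fibre_sum by (intro sum.neutral) auto
  finally show ?thesis .
qed

lemma finite_support_sum_and_Sum_any_sum:
  assumes "finite A" "\<And>m. m \<in> A \<Longrightarrow> finite_support (f m)"
  shows "finite_support (\<lambda>x. \<Sum>m\<in>A. f m x) \<and> Sum_any (\<lambda>x. \<Sum>m\<in>A. f m x) = (\<Sum>m\<in>A. Sum_any (f m) :: 'k::comm_monoid_add)"
  using assms by (induction A) (auto simp: finite_support_add Sum_any_add)

lemma has_reg_sum_null_fibrewise:
  fixes \<pi> :: "'g::ab_group_add \<Rightarrow> 'h::ab_group_add"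
  assumes \<pi>: "\<And>x y. \<pi> (x - y) = \<pi> x - \<pi> y"
    and g: "has_reg_sum g s"
    and Q: "mass Q \<noteq> 0" "\<And>m. m \<in> keys Q \<Longrightarrow> \<pi> m = 0"
    and fin: "\<And>y. finite_support (conv Q (fibre \<pi> (\<pi> y) g))"
    and null: "\<And>y. has_reg_sum (fibre \<pi> (\<pi> y) g) 0"
  shows "s = 0"
proof -
  define h where "h = conv Q g"
  have h: "finite_support (fibre \<pi> (\<pi> y) h)" "Sum_any (fibre \<pi> (\<pi> y) h) = 0" for y
    using fin[of y] has_reg_sum_kernel[OF null fin, of y] by (simp_all add: h_def conv_fibre[OF \<pi> Q(2)])
  obtain P where P: "mass P \<noteq> 0" "finite_support (conv P g)" "Sum_any (conv P g) = s * mass P"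
    using g by (rule has_reg_sumE)
  have conv_h: "conv P h = conv Q (conv P g)" unfolding h_def by (rule conv_commute)
  have "Sum_any (conv P h) = 0"
  proof (rule Sum_any_eq_0_fibrewise)
    show "finite_support (conv P h)" unfolding conv_h by (rule finite_support_conv[OF P(2)])
    show "Sum_any (fibre \<pi> (\<pi> y) (conv P h)) = 0" for y
    proof -
      let ?f = "\<lambda>m x. lookup P m * fibre \<pi> (\<pi> (y - m)) h (x - m)"
      have "finite_support (?f m) \<and> Sum_any (?f m) = 0" for m
        using finite_support_shift[OF h(1), of "y - m" m] Sum_any_shift[of "fibre \<pi> (\<pi> (y - m)) h" m] h(2)[of "y - m"]
        by (simp add: finite_support_scale Sum_any_scale)
      then show ?thesis
        unfolding fibre_conv[OF \<pi>] \<pi>[symmetric] by (simp add: finite_support_sum_and_Sum_any_sum)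
    qed
  qed
  moreover have "Sum_any (conv P h) = mass Q * (s * mass P)"
    unfolding conv_h by (simp add: Sum_any_conv[OF P(2)] P(3))
  ultimately show ?thesis using P(1) Q(1) by simp
qed

lemma has_reg_sum_eq_fibrewise:
  fixes \<pi> :: "'g::ab_group_add \<Rightarrow> 'h::ab_group_add"
  assumes \<pi>: "\<And>x y. \<pi> (x - y) = \<pi> x - \<pi> y"
    and reg: "has_reg_sum g s" "has_reg_sum g' s'"
    and Q: "mass Q \<noteq> 0" "\<And>m. m \<in> keys Q \<Longrightarrow> \<pi> m = 0"
    and fin: "\<And>y. finite_support (conv Q (fibre \<pi> (\<pi> y) g))" "\<And>y. finite_support (fibre \<pi> (\<pi> y) g')"
    and eq: "\<And>y. has_reg_sum (fibre \<pi> (\<pi> y) g) (Sum_any (fibre \<pi> (\<pi> y) g'))"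
  shows "s = s'"
proof -
  have fibre_diff: "fibre \<pi> b (\<lambda>x. g x + (- 1) * g' x) = (\<lambda>x. fibre \<pi> b g x + (- 1) * fibre \<pi> b g' x)" for b
    by (rule ext) (simp add: fibre_def when_def)
  have "s + (- 1) * s' = 0"
  proof (rule has_reg_sum_null_fibrewise[OF \<pi> has_reg_sum_add[OF reg(1) has_reg_sum_scale[OF reg(2)]] Q])
    fix y
    show "finite_support (conv Q (fibre \<pi> (\<pi> y) (\<lambda>x. g x + (- 1) * g' x)))"
      unfolding fibre_diff conv_fun_add conv_fun_scale
      by (intro finite_support_add finite_support_scale finite_support_conv fin)
    have "has_reg_sum (\<lambda>x. fibre \<pi> (\<pi> y) g x + (- 1) * fibre \<pi> (\<pi> y) g' x)
        (Sum_any (fibre \<pi> (\<pi> y) g') + (- 1) * Sum_any (fibre \<pi> (\<pi> y) g'))"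
      by (intro has_reg_sum_add has_reg_sum_scale eq has_reg_sum_finite fin(2))
    then show "has_reg_sum (fibre \<pi> (\<pi> y) (\<lambda>x. g x + (- 1) * g' x)) 0"
      unfolding fibre_diff by simp
  qed
  then show ?thesis by simp
qed

section \<open>Kernels for piecewise periodic functions\<close>

definition char_vec :: "'v set \<Rightarrow> ('v \<Rightarrow>\<^sub>0 int)" where
  "char_vec U = (\<Sum>v\<in>U. single v 1)"

lemma lookup_char_vec: "finite U \<Longrightarrow> lookup (char_vec U) v = of_bool (v \<in> U)"
  by (simp add: char_vec_def lookup_sum lookup_single when_def)

definition subset_kernel :: "'v set set \<Rightarrow> ('v set \<Rightarrow> 'k) \<Rightarrow> (('v \<Rightarrow>\<^sub>0 int) \<Rightarrow>\<^sub>0 'k::comm_ring_1)" where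
  "subset_kernel A \<omega> = (\<Prod>U\<in>A. (1 - single (char_vec U) (\<omega> U)))"

lemma mass_subset_kernel: "mass (subset_kernel A \<omega>) = (\<Prod>U\<in>A. (1 - \<omega> U))"
  by (simp add: subset_kernel_def mass_prod mass_diff)

lemma keys_subset_kernel:
  assumes "finite A" "\<And>U. U \<in> A \<Longrightarrow> finite U" "m \<in> keys (subset_kernel A \<omega>)"
  shows "0 \<le> lookup m v \<and> lookup m v \<le> int (card {U \<in> A. v \<in> U})"
  using assms
proof (induction A arbitrary: m)
  case empty
  then show ?case by (simp add: subset_kernel_def)
next
  case (insert U A)
  let ?f = "1 - single (char_vec U) (\<omega> U)"
  have "m \<in> keys (?f * subset_kernel A \<omega>)"
    using insert by (simp add: subset_kernel_def)
  then obtain a b where m: "m = a + b" and a: "a \<in> keys ?f" and b: "b \<in> keys (subset_kernel A \<omega>)"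
    using keys_mult by blast
  have "a = 0 \<or> a = char_vec U"
    using keys_diff[THEN subsetD, OF a] by (auto split: if_splits)
  then have "0 \<le> lookup a v \<and> lookup a v \<le> of_bool (v \<in> U)"
    using lookup_char_vec[OF insert.prems(1)[of U], of v] by auto
  moreover have "0 \<le> lookup b v \<and> lookup b v \<le> int (card {U \<in> A. v \<in> U})"
    by (rule insert.IH[OF insert.prems(1) b]) simp
  moreover have "{U' \<in> insert U A. v \<in> U'} = (if v \<in> U then insert U {U' \<in> A. v \<in> U'} else {U' \<in> A. v \<in> U'})"
    by auto
  then have "int (card {U' \<in> insert U A. v \<in> U'}) = of_bool (v \<in> U) + int (card {U' \<in> A. v \<in> U'})"
    using insert.hyps by simp
  ultimately show ?case by (simp add: m lookup_add)
qed

lemma keys_subset_kernel_outside: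
  assumes I: "finite I" and m: "m \<in> keys (subset_kernel (Pow I - {{}}) \<omega>)" and v: "v \<notin> I"
  shows "lookup m v = 0"
proof -
  have no_set: "{U \<in> Pow I - {{}}. v \<in> U} = {}" using v by auto
  have "0 \<le> lookup m v \<and> lookup m v \<le> int (card {U \<in> Pow I - {{}}. v \<in> U})"
    by (rule keys_subset_kernel[OF _ _ m]) (use I in \<open>auto intro: finite_subset\<close>)
  then show ?thesis unfolding no_set by simp
qed

lemma conv_subset_kernel_eq_0:
  assumes A: "finite A" "U \<in> A"
    and shift: "\<And>m. m \<in> keys (subset_kernel (A - {U}) \<omega>) \<Longrightarrow> g (x - m) = \<omega> U * g (x - m - char_vec U)"
  shows "conv (subset_kernel A \<omega>) g x = 0"
proof -
  let ?f = "1 - single (char_vec U) (\<omega> U)"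
  have "subset_kernel A \<omega> = subset_kernel (A - {U}) \<omega> * ?f"
    unfolding subset_kernel_def using A by (subst prod.remove[of _ U]) auto
  then have "conv (subset_kernel A \<omega>) g x = conv (subset_kernel (A - {U}) \<omega>) (conv ?f g) x"
    by (simp add: conv_mult)
  also have "\<dots> = 0"
    unfolding conv_def[of "subset_kernel _ _"] by (rule sum.neutral) (simp add: conv_diff shift)
  finally show ?thesis .
qed

lemma exists_gap:
  fixes h :: "'v \<Rightarrow> int"
  assumes "finite I" "u \<in> I" "G > 0" "h u \<ge> b + int (card I) * G"
  obtains \<theta> U where "\<theta> \<ge> b" "U \<subseteq> I" "u \<in> U" "\<And>v. v \<in> U \<Longrightarrow> h v \<ge> \<theta> + G" "\<And>v. v \<in> I - U \<Longrightarrow> h v < \<theta>"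
proof -
  let ?slot = "\<lambda>v. (h v - b) div G"
  have "card (?slot ` (I - {u})) < card {0..<int (card I)}"
    using card_image_le[of "I - {u}" ?slot] assms card_Diff1_less[of I u] by simp
  then have "\<not> {0..<int (card I)} \<subseteq> ?slot ` (I - {u})"
    using assms(1) by (metis card_mono finite_Diff finite_imageI not_le)
  then obtain k where k: "0 \<le> k" "k < int (card I)" "k \<notin> ?slot ` (I - {u})"
    unfolding subset_iff atLeastLessThan_iff by blast
  let ?U = "{v\<in>I. h v \<ge> b + k * G + G}"
  have "(k + 1) * G \<le> int (card I) * G" using k assms(3) by (intro mult_right_mono) auto
  then have u: "u \<in> ?U" using assms by (auto simp: algebra_simps)
  have below: "h v < b + k * G" if "v \<in> I - ?U" for v
  proof (rule ccontr)
    assume "\<not> h v < b + k * G"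
    with that have "k * G \<le> h v - b" "h v - b < (k + 1) * G" by (auto simp: algebra_simps)
    then have "?slot v = k"
      using assms(3) by (intro int_div_pos_eq[where r = "h v - b - k * G"]) (auto simp: algebra_simps)
    then show False using k(3) that u by auto
  qed
  show thesis
    by (rule that[of "b + k * G" ?U]) (use u k(1) assms(3) below in auto)
qed

definition separated :: "'v set \<Rightarrow> 'v set \<Rightarrow> ('v \<Rightarrow> int) \<Rightarrow> int \<Rightarrow> bool" where
  "separated J U h G \<longleftrightarrow> (\<forall>u\<in>U. \<forall>v\<in>J - U. h v + G \<le> h u) \<or> (\<forall>u\<in>U. \<forall>v\<in>J - U. h u + G \<le> h v)"

lemma exists_separated_subset:
  fixes h :: "'v \<Rightarrow> int"
  assumes I: "finite I" "u \<in> I" and G: "G > 0" and B: "\<And>v. v \<in> J - I \<Longrightarrow> \<bar>h v\<bar> < B"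
    and large: "\<bar>h u\<bar> \<ge> B + int (card I) * G"
  obtains U where "U \<subseteq> I" "u \<in> U" "separated J U h G"
proof -
  have top: "\<exists>U\<subseteq>I. u \<in> U \<and> (\<forall>w\<in>U. \<forall>v\<in>J - U. h v + G \<le> h w)"
    if B: "\<And>v. v \<in> J - I \<Longrightarrow> \<bar>h v\<bar> < B" and large: "h u \<ge> B + int (card I) * G" for h :: "'v \<Rightarrow> int"
  proof -
    obtain \<theta> U where U: "\<theta> \<ge> B" "U \<subseteq> I" "u \<in> U" "\<And>v. v \<in> U \<Longrightarrow> h v \<ge> \<theta> + G" "\<And>v. v \<in> I - U \<Longrightarrow> h v < \<theta>"
      using exists_gap[of I u G B h] I G large by blast
    have "h v + G \<le> h w" if "w \<in> U" "v \<in> J - U" for v w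
      using U(1) U(4)[OF that(1)] U(5)[of v] B[of v] that(2) by (cases "v \<in> I") auto
    then show ?thesis using U(2,3) by blast
  qed
  show thesis
  proof (cases "h u \<ge> 0")
    case True
    then have "\<exists>U\<subseteq>I. u \<in> U \<and> (\<forall>w\<in>U. \<forall>v\<in>J - U. h v + G \<le> h w)"
      using B large by (intro top) auto
    then show thesis using that unfolding separated_def by blast
  next
    case False
    then have "\<exists>U\<subseteq>I. u \<in> U \<and> (\<forall>w\<in>U. \<forall>v\<in>J - U. - h v + G \<le> - h w)"
      using B large by (intro top) auto
    then obtain U where "U \<subseteq> I" "u \<in> U" "\<forall>w\<in>U. \<forall>v\<in>J - U. - h v + G \<le> - h w" by blast
    then show thesis by (intro that[of U]) (auto simp: separated_def algebra_simps)
  qed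
qed

lemma finite_poly_mapping_box:
  assumes "finite I"
  shows "finite {x :: 'v \<Rightarrow>\<^sub>0 int. (\<forall>v\<in>I. \<bar>lookup x v\<bar> < T) \<and> (\<forall>v. v \<notin> I \<longrightarrow> lookup x v = a v)}" (is "finite ?S")
proof (rule finite_imageD)
  let ?f = "\<lambda>x v. if v \<in> I then lookup x v else 0"
  show "finite (?f ` ?S)"
    by (rule finite_subset[OF _ finite_set_of_finite_funs[of I "{-T..T}" 0]]) (use assms in auto)
  show "inj_on ?f ?S"
  proof (rule inj_onI, rule poly_mapping_eqI)
    fix x y v assume "x \<in> ?S" "y \<in> ?S" and eq: "?f x = ?f y"
    then show "lookup x v = lookup y v" using fun_cong[OF eq, of v] by (cases "v \<in> I") auto
  qed
qed

text \<open>
  If a coordinate of \<open>x\<close> is very large, there is a wide gap among the coordinates, and the factor of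
  the kernel that belongs to the set \<open>U\<close> of coordinates on the far side of the gap kills \<open>g\<close> near \<open>x\<close>.
\<close>

lemma conv_subset_kernel_eq_0_at_gap:
  fixes g :: "('v \<Rightarrow>\<^sub>0 int) \<Rightarrow> 'k::comm_ring_1"
  assumes I: "finite I" and U: "U \<subseteq> I" "U \<noteq> {}"
    and shift: "\<And>s. separated J U (lookup s) 1 \<Longrightarrow> separated J U (lookup (s + char_vec U)) 1 \<Longrightarrow>
      g (s + char_vec U) = \<omega> U * g s"
    and gap: "separated J U (lookup x) (int (card (Pow I)) + 2)"
  shows "conv (subset_kernel (Pow I - {{}}) \<omega>) g x = 0"
proof (rule conv_subset_kernel_eq_0)
  let ?A = "Pow I - {{}}" and ?M = "int (card (Pow I))"
  show "finite ?A" "U \<in> ?A" using I U by auto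
  fix m assume m: "m \<in> keys (subset_kernel (?A - {U}) \<omega>)"
  have m_bounds: "0 \<le> lookup m v \<and> lookup m v \<le> ?M" for v
  proof -
    have "card {U' \<in> ?A - {U}. v \<in> U'} \<le> card (Pow I)" using I by (intro card_mono) auto
    moreover have "0 \<le> lookup m v \<and> lookup m v \<le> int (card {U' \<in> ?A - {U}. v \<in> U'})"
      by (rule keys_subset_kernel[OF _ _ m]) (use I in \<open>auto intro: finite_subset\<close>)
    ultimately show ?thesis by linarith
  qed
  define y where "y = x - m - char_vec U"
  have finU: "finite U" using U(1) I by (rule finite_subset)
  have near: "\<bar>(lookup x u - lookup x v) - (lookup z u - lookup z v)\<bar> \<le> ?M + 1" if "z = y \<or> z = y + char_vec U" for z u v
    using m_bounds[of u] m_bounds[of v] that finU by (auto simp: y_def lookup_minus lookup_char_vec)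
  have "separated J U (lookup z) 1" if z: "z = y \<or> z = y + char_vec U" for z
  proof -
    have "lookup z v + 1 \<le> lookup z u" if "lookup x v + (?M + 2) \<le> lookup x u" for u v
      using near[OF z, of u v] that by linarith
    then show ?thesis using gap unfolding separated_def by fast
  qed
  then have "g (y + char_vec U) = \<omega> U * g y" by (intro shift) auto
  then show "g (x - m) = \<omega> U * g (x - m - char_vec U)" by (simp add: y_def)
qed

lemma finite_support_conv_subset_kernel:
  fixes g :: "('v \<Rightarrow>\<^sub>0 int) \<Rightarrow> 'k::comm_ring_1"
  assumes IJ: "I \<subseteq> J" "finite J"
    and shift: "\<And>s U. U \<subseteq> I \<Longrightarrow> separated J U (lookup s) 1 \<Longrightarrow> separated J U (lookup (s + char_vec U)) 1 \<Longrightarrow>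
      g (s + char_vec U) = \<omega> U * g s"
    and supp: "\<And>s v. g s \<noteq> 0 \<Longrightarrow> v \<notin> I \<Longrightarrow> lookup s v = a v"
  shows "finite_support (conv (subset_kernel (Pow I - {{}}) \<omega>) g)"
proof -
  let ?K = "subset_kernel (Pow I - {{}}) \<omega>"
  define G where "G = int (card (Pow I)) + 2"
  define B where "B = 1 + (\<Sum>v\<in>J. \<bar>a v\<bar>)"
  have I: "finite I" using IJ by (rule finite_subset)
  have a: "\<bar>a v\<bar> < B" if "v \<in> J" for v
    using member_le_sum[OF that, of "\<lambda>v. \<bar>a v\<bar>"] IJ(2) by (simp add: B_def)
  have frozen: "lookup x v = a v" if x: "conv ?K g x \<noteq> 0" and v: "v \<notin> I" for x v
  proof -
    obtain m where m: "m \<in> keys ?K" "g (x - m) \<noteq> 0"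
      using x unfolding conv_def by (metis (no_types, lifting) mult_zero_right sum.neutral)
    show ?thesis using supp[OF m(2) v] keys_subset_kernel_outside[OF I m(1) v] by (simp add: lookup_minus)
  qed
  have bounded: "\<bar>lookup x u\<bar> < B + int (card I) * G" if x: "conv ?K g x \<noteq> 0" and u: "u \<in> I" for x u
  proof (rule ccontr)
    assume "\<not> \<bar>lookup x u\<bar> < B + int (card I) * G"
    moreover have "\<bar>lookup x v\<bar> < B" if "v \<in> J - I" for v using a[of v] frozen[OF x, of v] that by simp
    ultimately obtain U where U: "U \<subseteq> I" "u \<in> U" "separated J U (lookup x) G"
      using exists_separated_subset[OF I u, of G J "lookup x" B] by (auto simp: G_def)
    have "conv ?K g x = 0"
    proof (rule conv_subset_kernel_eq_0_at_gap[where J = J and U = U])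
      show "separated J U (lookup x) (int (card (Pow I)) + 2)" using U(3) by (simp add: G_def)
    qed (use I U(1,2) shift[OF U(1)] in auto)
    with x show False by simp
  qed
  show ?thesis
    by (rule finite_supportI[OF finite_poly_mapping_box[OF I]]) (use bounded frozen in auto)
qed

section \<open>Transfer matrices and the Yang--Baxter relation\<close>

definition chain_sum :: "(int \<Rightarrow> 'a set) \<Rightarrow> (int \<Rightarrow> 'a \<Rightarrow> 'a \<Rightarrow> 'k::comm_ring_1) \<Rightarrow> int \<Rightarrow> int \<Rightarrow> 'a \<Rightarrow> 'k" where
  "chain_sum S w H c v = (\<Sum>f\<in>Pi\<^sub>E {c..H} (S(c := {v})). \<Prod>d\<in>{c..<H}. w d (f (d + 1)) (f d))"

lemma chain_sum_top: "chain_sum S w H H v = 1"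
  by (simp add: chain_sum_def PiE_singleton[of _ "{H}", simplified] PiE_insert_eq)

lemma chain_sum_step:
  assumes "c < H" "\<And>c. finite (S c)"
  shows "chain_sum S w H c v = (\<Sum>u\<in>S (c + 1). chain_sum S w H (c + 1) u * w c u v)"
proof -
  let ?A = "Pi\<^sub>E {c + 1..H} S"
  have interval: "{c..H} = insert c {c + 1..H}" "{c..<H} = insert c {c + 1..<H}" using assms(1) by auto
  have "Pi\<^sub>E {c + 1..H} (S(c := {v})) = ?A" by (rule PiE_cong) auto
  then have "Pi\<^sub>E {c..H} (S(c := {v})) = (\<lambda>g. g(c := v)) ` ?A"
    unfolding interval(1) PiE_insert_eq by force
  moreover have "inj_on (\<lambda>g. g(c := v)) ?A"
    using inj_combinator[of c "{c + 1..H}" "S(c := {v})"] \<open>Pi\<^sub>E {c + 1..H} (S(c := {v})) = ?A\<close>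
    by (auto simp: inj_on_def)
  ultimately have "chain_sum S w H c v = (\<Sum>g\<in>?A. w c (g (c + 1)) v * (\<Prod>d\<in>{c + 1..<H}. w d (g (d + 1)) (g d)))"
    unfolding chain_sum_def interval(2) by (simp add: sum.reindex)
  also have "\<dots> = (\<Sum>u\<in>S (c + 1). \<Sum>g | g \<in> ?A \<and> g (c + 1) = u. w c (g (c + 1)) v * (\<Prod>d\<in>{c + 1..<H}. w d (g (d + 1)) (g d)))"
    using assms by (intro sum.group[symmetric] finite_PiE) auto
  also have "\<dots> = (\<Sum>u\<in>S (c + 1). chain_sum S w H (c + 1) u * w c u v)"
  proof (rule sum.cong[OF refl])
    fix u assume u: "u \<in> S (c + 1)"
    have "(\<forall>i\<in>{c + 1..H}. g i \<in> S i) \<and> g (c + 1) = u \<longleftrightarrow> (\<forall>i\<in>{c + 1..H}. g i \<in> (S(c + 1 := {u})) i)" for g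
      using u assms(1) by (auto split: if_splits)
    then have "{g. g \<in> ?A \<and> g (c + 1) = u} = Pi\<^sub>E {c + 1..H} (S(c + 1 := {u}))"
      unfolding set_eq_iff mem_Collect_eq PiE_iff by blast
    then show "(\<Sum>g | g \<in> ?A \<and> g (c + 1) = u. w c (g (c + 1)) v * (\<Prod>d\<in>{c + 1..<H}. w d (g (d + 1)) (g d))) =
      chain_sum S w H (c + 1) u * w c u v"
      unfolding chain_sum_def sum_distrib_right by (intro sum.cong) (auto simp: mult.commute)
  qed
  finally show ?thesis .
qed

text \<open>
  Rows will be encoded by paths such that one row interlaces with the next iff its path is \<open>0\<close> or
  \<open>1\<close> higher at every point. These are the possible values at a point of a path between two
  given ones.
\<close>

definition mids :: "int \<Rightarrow> int \<Rightarrow> int set" where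
  "mids a b = {a - 1, a} \<inter> {b, b + 1}"

lemma finite_mids [simp]: "finite (mids a b)"
  by (simp add: mids_def)

lemma mids_simps:
  "mids (b + 2) b = {b + 1}" "mids b b = {b}" "mids (b + 1) b = {b, b + 1}" "mids (1 + b) b = {b, b + 1}"
  by (auto simp: mids_def)

lemma mids_cases:
  assumes "v \<in> mids a b"
  obtains (equal) "a = b" "v = b" | (low) "a = b + 1" "v = b" | (high) "a = b + 1" "v = b + 1" | (apart) "a = b + 2" "v = b + 1"
  using assms by (auto simp: mids_def)

definition row_wt :: "'k::field \<Rightarrow> nat \<Rightarrow> nat \<Rightarrow> 'k" where
  "row_wt t k m = (if m = k + 1 then 1 - t ^ m else 1)"

definition col_wt :: "'k::field \<Rightarrow> nat \<Rightarrow> nat \<Rightarrow> int \<Rightarrow> int \<Rightarrow> 'k" where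
  "col_wt t k n u v = (if u \<le> v then row_wt t k (nat (v - u)) * row_wt t (nat (v - u)) n else 0)"

text \<open>The R-matrix of the exchange; it is a scalar unless there are two possible values.\<close>

definition exchange :: "'k::field \<Rightarrow> 'k \<Rightarrow> int \<Rightarrow> int \<Rightarrow> (int \<Rightarrow> 'k) \<Rightarrow> int \<Rightarrow> 'k" where
  "exchange t z a b V u = (if a \<noteq> b + 1 then (z - t) * V u
    else if u = b then (1 - t) * z * V b + (z - 1) * V (b + 1)
    else t * (z - 1) * V b + (1 - t) * V (b + 1))"

lemma yang_baxter:
  fixes t z :: "'k::field"
  assumes z: "z \<noteq> 0" and v: "v \<in> mids (a + int k) (b + int n)"
  shows "exchange t z (a + int k) (b + int n) (\<lambda>v. z powi v * (\<Sum>u\<in>mids a b. V u * col_wt t k n u v)) v =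
    z powi (a + int k + (b + int n) - v) * (\<Sum>u\<in>mids a b. exchange t z a b V u * col_wt t k n u v)"
proof -
  note entry_simps = mids_simps exchange_def col_wt_def row_wt_def power_int_add power2_eq_square nat_add_distrib algebra_simps
  consider (none) "mids a b = {}" | (equal) "a = b" | (adjacent) "a = b + 1" | (apart) "a = b + 2"
    by (cases "a \<in> {b, b + 1, b + 2}") (auto simp: mids_def)
  then show ?thesis
  proof cases
    case none
    then show ?thesis by (simp add: exchange_def)
  next
    case equal
    from v consider "k = n" "v = b + int n" | "k = n + 1" "v = b + int n" | "k = n + 1" "v = b + int n + 1"
      | "k = n + 2" "v = b + int n + 1" by (cases rule: mids_cases) (use equal in auto)
    then show ?thesis using equal z by cases (simp_all add: entry_simps)
  next
    case adjacent
    from v consider "n = k + 1" "v = b + int n" | "k = n" "v = b + int n" | "k = n" "v = b + int n + 1"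
      | "k = n + 1" "v = b + int n + 1" by (cases rule: mids_cases) (use adjacent in auto)
    then show ?thesis using adjacent z by cases (cases n; simp add: entry_simps)+
  next
    case apart
    from v consider "n = k + 2" "v = b + int n" | "n = k + 1" "v = b + int n" | "n = k + 1" "v = b + int n + 1"
      | "k = n" "v = b + int n + 1" by (cases rule: mids_cases) (use apart in auto)
    then show ?thesis using apart z by cases (simp_all add: entry_simps)
  qed
qed

text \<open>
  The top and the bottom value of the window stand for the geometric series of all entries beyond;
  an entry takes such a value iff the path jumps there.
\<close>

definition end_wt :: "'k::field \<Rightarrow> int \<Rightarrow> int \<Rightarrow> int \<Rightarrow> int \<Rightarrow> int \<Rightarrow> 'k" where
  "end_wt z L H c u v = (if c = H \<and> u \<noteq> v then 1 / (1 - z) else 1) * (if c = L \<and> u \<noteq> v then 1 / (1 - 1 / z) else 1)"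

definition top_factor :: "'k::field \<Rightarrow> 'k \<Rightarrow> int \<Rightarrow> int \<Rightarrow> 'k" where
  "top_factor t z p p\<^sub>2 = (if p\<^sub>2 = p - 1 then (z - t) * (1 - t * z) / (1 - z) else z - t)"

definition bottom_factor :: "'k::field \<Rightarrow> 'k \<Rightarrow> int \<Rightarrow> int \<Rightarrow> 'k" where
  "bottom_factor t z q q\<^sub>2 = (if q\<^sub>2 = q then z - t else z - 1)"

lemma exchange_top:
  fixes t z :: "'k::field"
  assumes z: "z \<noteq> 0" "z \<noteq> 1" and p\<^sub>2: "p\<^sub>2 = p - 1 \<or> p\<^sub>2 = p - 2" and v: "v \<in> mids p p\<^sub>2"
  shows "exchange t z p p\<^sub>2 (\<lambda>v. z powi v * (col_wt t 0 0 (p - 1) v * (if p - 1 \<noteq> v then 1 / (1 - z) else 1))) v =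
    top_factor t z p p\<^sub>2 * (z powi (p + p\<^sub>2 - v) * col_wt t 0 0 (p\<^sub>2 + 1) v)"
proof -
  note entry_simps = exchange_def top_factor_def col_wt_def row_wt_def power_int_add power_int_diff
  have z': "1 - z \<noteq> 0" using z(2) by simp
  from v show ?thesis
  proof (cases rule: mids_cases)
    case equal
    then show ?thesis using p\<^sub>2 by simp
  next
    case low
    then show ?thesis using z z' by (simp add: entry_simps field_simps)
  next
    case high
    then show ?thesis using z z' by (simp add: entry_simps field_simps)
  next
    case apart
    then show ?thesis by (simp add: entry_simps)
  qed
qed

lemma exchange_bottom:
  fixes t z :: "'k::field"
  assumes z: "z \<noteq> 0" "z \<noteq> 1" and q\<^sub>2: "q\<^sub>2 = q \<or> q\<^sub>2 = q - 1"
  shows "bottom_factor t z q q\<^sub>2 * (\<Sum>u\<in>mids (q + 1) (q\<^sub>2 + 1).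
      V u * (col_wt t 0 0 u (q + 1) * (if u \<noteq> q + 1 then 1 / (1 - 1 / z) else 1))) =
    (\<Sum>u\<in>mids (q + 1) (q\<^sub>2 + 1). exchange t z (q + 1) (q\<^sub>2 + 1) V u * col_wt t 0 0 u (q\<^sub>2 + 1))"
proof -
  note entry_simps = mids_simps exchange_def bottom_factor_def col_wt_def row_wt_def
  have "(z - 1) / (1 - 1 / z) = z" using z by (simp add: field_simps)
  then have jump: "(z - 1) * (x / (1 - 1 / z)) = z * x" for x by (metis times_divide_eq_left times_divide_eq_right)
  show ?thesis
  proof (cases "q\<^sub>2 = q")
    case True
    then show ?thesis by (simp add: entry_simps)
  next
    case False
    then have q: "q = q\<^sub>2 + 1" using q\<^sub>2 by simp
    then have "mids (q + 1) (q\<^sub>2 + 1) = {q, q + 1}" by (auto simp: mids_def)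
    then show ?thesis using q jump[of "V q * (1 - t)"]
      by (simp add: exchange_def bottom_factor_def col_wt_def row_wt_def distrib_left)
  qed
qed

definition heights_wt :: "'k::field \<Rightarrow> (int \<Rightarrow> int) \<Rightarrow> (int \<Rightarrow> int) \<Rightarrow> int \<Rightarrow> int \<Rightarrow> int \<Rightarrow> 'k" where
  "heights_wt t P N c = col_wt t (nat (P c - P (c + 1))) (nat (N c - N (c + 1)))"

locale step_exchange =
  fixes t z :: "'k::field" and P N :: "int \<Rightarrow> int" and L H p q p\<^sub>2 q\<^sub>2 :: int
  assumes z: "z \<noteq> 0" "z \<noteq> 1" and LH: "L < H" and antimono: "antimono P" "antimono N"
    and top: "\<And>c. c \<ge> H \<Longrightarrow> P c = p" "\<And>c. c \<ge> H \<Longrightarrow> N c = p\<^sub>2" "p\<^sub>2 = p - 1 \<or> p\<^sub>2 = p - 2"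
    and bottom: "\<And>c. c \<le> L + 1 \<Longrightarrow> P c = q + 1" "\<And>c. c \<le> L + 1 \<Longrightarrow> N c = q\<^sub>2 + 1" "q\<^sub>2 = q \<or> q\<^sub>2 = q - 1"
begin

abbreviation "S \<equiv> \<lambda>c. mids (P c) (N c)"

definition upper_sum :: "int \<Rightarrow> int \<Rightarrow> 'k" where
  "upper_sum = chain_sum (S(H + 1 := {p - 1})) (\<lambda>c u v. heights_wt t P N c u v * (z powi v * end_wt z L H c u v)) (H + 1)"

definition lower_sum :: "int \<Rightarrow> int \<Rightarrow> 'k" where
  "lower_sum = chain_sum (S(H + 1 := {p\<^sub>2 + 1})) (\<lambda>c u v. heights_wt t P N c u v * z powi (P c + N c - v)) (H + 1)"

lemma upper_sum_top:
  "upper_sum H v = z powi v * (col_wt t 0 0 (p - 1) v * (if p - 1 \<noteq> v then 1 / (1 - z) else 1))"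
  unfolding upper_sum_def using LH
  by (subst chain_sum_step) (simp_all add: chain_sum_top heights_wt_def end_wt_def top mult_ac)

lemma lower_sum_top: "lower_sum H v = z powi (p + p\<^sub>2 - v) * col_wt t 0 0 (p\<^sub>2 + 1) v"
  unfolding lower_sum_def by (subst chain_sum_step) (simp_all add: chain_sum_top heights_wt_def top mult_ac)

lemma upper_sum_step:
  assumes "L < c" "c < H"
  shows "upper_sum c v = z powi v * (\<Sum>u\<in>S (c + 1). upper_sum (c + 1) u * heights_wt t P N c u v)"
  unfolding upper_sum_def using assms
  by (subst chain_sum_step) (simp_all add: end_wt_def sum_distrib_left mult_ac)

lemma lower_sum_step:
  assumes "c < H"
  shows "lower_sum c v = z powi (P c + N c - v) * (\<Sum>u\<in>S (c + 1). lower_sum (c + 1) u * heights_wt t P N c u v)"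
  unfolding lower_sum_def using assms
  by (subst chain_sum_step) (simp_all add: sum_distrib_left mult_ac)

lemma upper_sum_bottom:
  "upper_sum L (q + 1) = z powi (q + 1) * (\<Sum>u\<in>mids (q + 1) (q\<^sub>2 + 1).
    upper_sum (L + 1) u * (col_wt t 0 0 u (q + 1) * (if u \<noteq> q + 1 then 1 / (1 - 1 / z) else 1)))"
  unfolding upper_sum_def using LH
  by (subst chain_sum_step) (simp_all add: heights_wt_def end_wt_def bottom sum_distrib_left mult_ac)

lemma lower_sum_bottom:
  "lower_sum L (q\<^sub>2 + 1) = z powi (q + 1) * (\<Sum>u\<in>mids (q + 1) (q\<^sub>2 + 1). lower_sum (L + 1) u * col_wt t 0 0 u (q\<^sub>2 + 1))"
  using lower_sum_step[OF LH, of "q\<^sub>2 + 1"] by (simp add: heights_wt_def bottom add.commute)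

lemma exchange_upper_sum:
  assumes "c \<le> H" "L < c" "v \<in> S c"
  shows "exchange t z (P c) (N c) (upper_sum c) v = top_factor t z p p\<^sub>2 * lower_sum c v"
  using assms
proof (induction c arbitrary: v rule: int_le_induct)
  case base
  then have "v \<in> mids p p\<^sub>2" by (simp add: top)
  then show ?case
    unfolding lower_sum_top upper_sum_top[abs_def] top(1,2)[OF order_refl] by (rule exchange_top[OF z top(3)])
next
  case (step c)
  define k n where "k = nat (P (c - 1) - P c)" and "n = nat (N (c - 1) - N c)"
  have heights: "P (c - 1) = P c + int k" "N (c - 1) = N c + int n"
    using antimonoD[OF antimono(1), of "c - 1" c] antimonoD[OF antimono(2), of "c - 1" c] by (auto simp: k_def n_def)
  have upper: "upper_sum (c - 1) v = z powi v * (\<Sum>u\<in>S c. upper_sum c u * col_wt t k n u v)" for v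
    using upper_sum_step[of "c - 1" v] step.hyps step.prems(1) by (simp add: heights_wt_def k_def n_def)
  have lower: "lower_sum (c - 1) v = z powi (P (c - 1) + N (c - 1) - v) * (\<Sum>u\<in>S c. lower_sum c u * col_wt t k n u v)" for v
    using lower_sum_step[of "c - 1" v] step.hyps by (simp add: heights_wt_def k_def n_def)
  have v: "v \<in> mids (P c + int k) (N c + int n)" using step.prems(2) unfolding heights .
  have "exchange t z (P (c - 1)) (N (c - 1)) (upper_sum (c - 1)) v =
    z powi (P (c - 1) + N (c - 1) - v) * (\<Sum>u\<in>S c. exchange t z (P c) (N c) (upper_sum c) u * col_wt t k n u v)"
    unfolding heights upper[abs_def] by (rule yang_baxter[OF z(1) v])
  also have "(\<Sum>u\<in>S c. exchange t z (P c) (N c) (upper_sum c) u * col_wt t k n u v) =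
    top_factor t z p p\<^sub>2 * (\<Sum>u\<in>S c. lower_sum c u * col_wt t k n u v)"
    unfolding sum_distrib_left
  proof (rule sum.cong[OF refl])
    fix u assume "u \<in> S c"
    then show "exchange t z (P c) (N c) (upper_sum c) u * col_wt t k n u v =
      top_factor t z p p\<^sub>2 * (lower_sum c u * col_wt t k n u v)"
      using step.IH[of u] step.prems(1) by simp
  qed
  finally show ?case unfolding lower by (simp add: mult.left_commute)
qed

lemma upper_sum_eq_lower_sum:
  "bottom_factor t z q q\<^sub>2 * upper_sum L (q + 1) = top_factor t z p p\<^sub>2 * lower_sum L (q\<^sub>2 + 1)"
proof -
  let ?M = "mids (q + 1) (q\<^sub>2 + 1)"
  have "exchange t z (q + 1) (q\<^sub>2 + 1) (upper_sum (L + 1)) u = top_factor t z p p\<^sub>2 * lower_sum (L + 1) u" if "u \<in> ?M" for u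
    using exchange_upper_sum[of "L + 1" u] LH that by (simp add: bottom)
  then have "(\<Sum>u\<in>?M. exchange t z (q + 1) (q\<^sub>2 + 1) (upper_sum (L + 1)) u * col_wt t 0 0 u (q\<^sub>2 + 1)) =
      top_factor t z p p\<^sub>2 * (\<Sum>u\<in>?M. lower_sum (L + 1) u * col_wt t 0 0 u (q\<^sub>2 + 1))"
    unfolding sum_distrib_left by (intro sum.cong) (simp_all add: mult.assoc)
  then show ?thesis
    unfolding upper_sum_bottom lower_sum_bottom exchange_bottom[OF z bottom(3), symmetric, of t "upper_sum (L + 1)"]
    by (simp add: mult.left_commute)
qed

end

section \<open>Interlacing rows\<close>

definition interlaced :: "int set \<Rightarrow> int set \<Rightarrow> (int \<Rightarrow> int) \<Rightarrow> (int \<Rightarrow> int) \<Rightarrow> bool" where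
  "interlaced A B l m \<longleftrightarrow> (\<forall>j\<in>A \<inter> B. m j \<le> l j) \<and> (\<forall>j\<in>B. j + 1 \<in> A \<longrightarrow> l (j + 1) \<le> m j)"

definition pair_wt :: "'k::field \<Rightarrow> int set \<Rightarrow> int set \<Rightarrow> (int \<Rightarrow> int) \<Rightarrow> (int \<Rightarrow> int) \<Rightarrow> 'k" where
  "pair_wt t A B l m = (if interlaced A B l m
    then \<Prod>c\<in>m ` B. row_wt t (card {j\<in>A. l j = c}) (card {j\<in>B. m j = c}) else 0)"

lemma interlaced_of_pair_wt: "pair_wt t A B l m \<noteq> 0 \<Longrightarrow> interlaced A B l m"
  by (auto simp: pair_wt_def split: if_splits)

definition steps :: "int \<Rightarrow> int \<Rightarrow> int \<Rightarrow> int \<Rightarrow> bool" where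
  "steps p q p' q' \<longleftrightarrow> (p' = p \<or> p' = p - 1) \<and> (q' = q \<or> q' = q - 1)"

lemma antimono_on_atLeastAtMost_intI:
  fixes l :: "int \<Rightarrow> 'a::order"
  assumes "\<And>j. p \<le> j \<Longrightarrow> j < q \<Longrightarrow> l (j + 1) \<le> l j"
  shows "antimono_on {p..q} l"
proof (rule monotone_onI)
  fix j k assume j: "j \<in> {p..q}" and k: "k \<in> {p..q}" and "j \<le> k"
  from \<open>j \<le> k\<close> have "k \<le> q \<longrightarrow> l k \<le> l j"
  proof (induction k rule: int_ge_induct)
    case (step i)
    then show ?case using assms[of i] j by (auto intro: order_trans)
  qed simp
  then show "l k \<le> l j" using k by simp
qed

lemma interlaced_antimono_on:
  assumes "steps p q p' q'" "interlaced {p..q} {p'..q'} l m"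
  shows "antimono_on {p..q} l" "antimono_on {p'..q'} m"
proof -
  show "antimono_on {p..q} l"
  proof (rule antimono_on_atLeastAtMost_intI)
    fix j assume "p \<le> j" "j < q"
    then have "m j \<le> l j" "l (j + 1) \<le> m j" using assms by (auto simp: interlaced_def steps_def)
    then show "l (j + 1) \<le> l j" by simp
  qed
  show "antimono_on {p'..q'} m"
  proof (rule antimono_on_atLeastAtMost_intI)
    fix j assume "p' \<le> j" "j < q'"
    then have "m (j + 1) \<le> l (j + 1)" "l (j + 1) \<le> m j" using assms by (auto simp: interlaced_def steps_def)
    then show "m (j + 1) \<le> m j" by simp
  qed
qed

text \<open>
  A weakly decreasing row on the columns \<open>p..q\<close> is encoded by the first column \<open>drop_col p q m c\<close>
  whose entry is less than \<open>c\<close>, for each \<open>c\<close>. Two rows interlace iff these columns differ by \<open>0\<close> or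
  \<open>1\<close> at every \<open>c\<close>, so that the row between two given ones is a path with at most two choices at
  each \<open>c\<close>.
\<close>

definition drop_col :: "int \<Rightarrow> int \<Rightarrow> (int \<Rightarrow> int) \<Rightarrow> int \<Rightarrow> int" where
  "drop_col p q m c = p + int (card {j\<in>{p..q}. c \<le> m j})"

lemma drop_col_eqI:
  assumes "\<And>j. p \<le> j \<Longrightarrow> j \<le> q \<Longrightarrow> c \<le> m j \<longleftrightarrow> j < k" "p \<le> k" "k \<le> q + 1"
  shows "drop_col p q m c = k"
proof -
  have "{j\<in>{p..q}. c \<le> m j} = {p..<k}" using assms by auto
  then show ?thesis using assms(2) by (simp add: drop_col_def)
qed

lemma drop_col_cong: "(\<And>j. p \<le> j \<Longrightarrow> j \<le> q \<Longrightarrow> m j = m' j) \<Longrightarrow> drop_col p q m = drop_col p q m'"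
  unfolding drop_col_def by (rule ext, rule arg_cong[where f = "\<lambda>A. p + int (card A)"]) auto

lemma drop_col_top: "(\<And>j. p \<le> j \<Longrightarrow> j \<le> q \<Longrightarrow> m j < c) \<Longrightarrow> p \<le> q + 1 \<Longrightarrow> drop_col p q m c = p"
  by (rule drop_col_eqI) (auto simp: not_le)

lemma drop_col_bottom: "(\<And>j. p \<le> j \<Longrightarrow> j \<le> q \<Longrightarrow> c \<le> m j) \<Longrightarrow> p \<le> q + 1 \<Longrightarrow> drop_col p q m c = q + 1"
  by (rule drop_col_eqI) auto

lemma drop_col_bounds:
  assumes "p \<le> q + 1" shows "p \<le> drop_col p q m c \<and> drop_col p q m c \<le> q + 1"
proof -
  have "card {j\<in>{p..q}. c \<le> m j} \<le> card {p..q}" by (rule card_mono) auto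
  then show ?thesis using assms by (simp add: drop_col_def)
qed

lemma antimono_drop_col: "antimono (drop_col p q m)"
proof (rule antimonoI)
  fix x y :: int assume "x \<le> y"
  then have "card {j\<in>{p..q}. y \<le> m j} \<le> card {j\<in>{p..q}. x \<le> m j}"
    by (intro card_mono finite_subset[of "{j\<in>{p..q}. x \<le> m j}" "{p..q}"]) auto
  then show "drop_col p q m y \<le> drop_col p q m x" by (simp add: drop_col_def)
qed

lemma initial_segment_int:
  fixes A :: "int set"
  assumes "A \<subseteq> {p..q}" "\<And>j k. k \<in> A \<Longrightarrow> p \<le> j \<Longrightarrow> j \<le> k \<Longrightarrow> j \<in> A"
  shows "A = {p..<p + int (card A)}"
proof (cases "A = {}")
  case False
  have fin: "finite A" using assms(1) finite_subset by blast
  have "A = {p..Max A}"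
  proof
    show "A \<subseteq> {p..Max A}" using fin assms(1) by auto
    show "{p..Max A} \<subseteq> A" using assms(2)[OF Max_in[OF fin False]] by auto
  qed
  moreover have "p \<le> Max A" using Max_in[OF fin False] assms(1) by auto
  then have "{p..Max A} = {p..<p + int (card {p..Max A})}" by auto
  ultimately show ?thesis by (simp only:)
qed simp

lemma less_drop_col_iff:
  assumes "antimono_on {p..q} m" "p \<le> j" "j \<le> q"
  shows "j < drop_col p q m c \<longleftrightarrow> c \<le> m j"
proof -
  let ?A = "{j\<in>{p..q}. c \<le> m j}"
  have "?A = {p..<drop_col p q m c}" unfolding drop_col_def
  proof (rule initial_segment_int)
    fix i k assume "k \<in> ?A" "p \<le> i" "i \<le> k"
    then show "i \<in> ?A" using monotone_onD[OF assms(1), of i k] by auto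
  qed auto
  then have "j \<in> ?A \<longleftrightarrow> j \<in> {p..<drop_col p q m c}" by simp
  then show ?thesis using assms by auto
qed

lemma card_level_eq_drop_col_diff:
  "card {j\<in>{p..q}. m j = c} = nat (drop_col p q m c - drop_col p q m (c + 1))"
proof -
  have "{j\<in>{p..q}. c \<le> m j} = {j\<in>{p..q}. m j = c} \<union> {j\<in>{p..q}. c + 1 \<le> m j}" by auto
  moreover have "finite {j\<in>{p..q}. P j}" for P by (rule finite_subset[of _ "{p..q}"]) auto
  ultimately have "card {j\<in>{p..q}. c \<le> m j} = card {j\<in>{p..q}. m j = c} + card {j\<in>{p..q}. c + 1 \<le> m j}"
    using card_Un_disjoint[of "{j\<in>{p..q}. m j = c}" "{j\<in>{p..q}. c + 1 \<le> m j}"] by (simp add: disjoint_iff)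
  then show ?thesis by (simp add: drop_col_def)
qed

lemma drop_col_of_interlaced:
  assumes l: "antimono_on {p..q} l" and m: "antimono_on {p'..q'} m"
    and steps: "steps p q p' q'" and pq: "p \<le> q + 1" "p' \<le> q' + 1"
    and interlaced: "interlaced {p..q} {p'..q'} l m"
  shows "drop_col p' q' m c = drop_col p q l c - 1 \<or> drop_col p' q' m c = drop_col p q l c"
proof -
  let ?a = "drop_col p q l c" and ?b = "drop_col p' q' m c"
  note bounds = drop_col_bounds[OF pq(1), of l c] drop_col_bounds[OF pq(2), of m c]
  have "?b \<le> ?a"
  proof (rule ccontr)
    assume "\<not> ?b \<le> ?a"
    then have a: "?a < ?b" "p' \<le> ?a" "?a \<le> q'" "?a \<le> q" "p \<le> ?a" using bounds steps by (auto simp: steps_def)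
    then have "c \<le> m ?a" using less_drop_col_iff[OF m, of ?a c] by simp
    also have "m ?a \<le> l ?a" using interlaced a by (simp add: interlaced_def)
    finally show False using less_drop_col_iff[OF l, of ?a c] a by simp
  qed
  moreover have "?a - 1 \<le> ?b"
  proof (rule ccontr)
    assume "\<not> ?a - 1 \<le> ?b"
    then have b: "?b + 1 < ?a" "p' \<le> ?b" "?b \<le> q'" "?b + 1 \<le> q" "p \<le> ?b + 1" using bounds steps by (auto simp: steps_def)
    then have "c \<le> l (?b + 1)" using less_drop_col_iff[OF l, of "?b + 1" c] by simp
    also have "l (?b + 1) \<le> m ?b" using interlaced b by (simp add: interlaced_def)
    finally show False using less_drop_col_iff[OF m, of ?b c] b by simp
  qed
  ultimately show ?thesis by linarith
qed

lemma interlaced_iff_drop_col: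
  assumes l: "antimono_on {p..q} l" and m: "antimono_on {p'..q'} m"
    and steps: "steps p q p' q'" and pq: "p \<le> q + 1" "p' \<le> q' + 1"
  shows "interlaced {p..q} {p'..q'} l m \<longleftrightarrow>
    (\<forall>c. drop_col p' q' m c = drop_col p q l c - 1 \<or> drop_col p' q' m c = drop_col p q l c)"
proof
  assume drops: "\<forall>c. drop_col p' q' m c = drop_col p q l c - 1 \<or> drop_col p' q' m c = drop_col p q l c"
  show "interlaced {p..q} {p'..q'} l m" unfolding interlaced_def
  proof (intro conjI ballI impI)
    fix j assume j: "j \<in> {p..q} \<inter> {p'..q'}"
    then have "j < drop_col p' q' m (m j)" using less_drop_col_iff[OF m] by simp
    then have "j < drop_col p q l (m j)" using drops[rule_format, of "m j"] by auto
    then show "m j \<le> l j" using less_drop_col_iff[OF l] j by simp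
  next
    fix j assume j: "j \<in> {p'..q'}" "j + 1 \<in> {p..q}"
    then have "j + 1 < drop_col p q l (l (j + 1))" using less_drop_col_iff[OF l] by simp
    then have "j < drop_col p' q' m (l (j + 1))" using drops[rule_format, of "l (j + 1)"] by auto
    then show "l (j + 1) \<le> m j" using less_drop_col_iff[OF m] j by simp
  qed
qed (use drop_col_of_interlaced[OF assms] in blast)

lemma pair_wt_eq_prod_drop_col:
  assumes "\<And>j. p' \<le> j \<Longrightarrow> j \<le> q' \<Longrightarrow> L \<le> m j \<and> m j \<le> H" "interlaced {p..q} {p'..q'} l m"
  shows "pair_wt t {p..q} {p'..q'} l m = (\<Prod>c\<in>{L..H}. row_wt t
    (nat (drop_col p q l c - drop_col p q l (c + 1))) (nat (drop_col p' q' m c - drop_col p' q' m (c + 1))))"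
proof -
  let ?w = "\<lambda>c. row_wt t (card {j\<in>{p..q}. l j = c}) (card {j\<in>{p'..q'}. m j = c})"
  have "pair_wt t {p..q} {p'..q'} l m = prod ?w (m ` {p'..q'})"
    using assms(2) by (simp add: pair_wt_def)
  also have "\<dots> = prod ?w {L..H}"
  proof (rule prod.mono_neutral_left)
    show "\<forall>c\<in>{L..H} - m ` {p'..q'}. ?w c = 1"
    proof
      fix c assume "c \<in> {L..H} - m ` {p'..q'}"
      then have no_entry: "{j \<in> {p'..q'}. m j = c} = {}" by auto
      show "?w c = 1" unfolding no_entry by (simp add: row_wt_def)
    qed
  qed (use assms(1) in auto)
  finally show ?thesis unfolding card_level_eq_drop_col_diff .
qed

definition bounded_rows :: "int \<Rightarrow> int \<Rightarrow> int \<Rightarrow> int \<Rightarrow> (int \<Rightarrow> int) set" where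
  "bounded_rows p q L H = {m. \<forall>j. (j \<in> {p..q} \<longrightarrow> m j \<in> {L..H}) \<and> (j \<notin> {p..q} \<longrightarrow> m j = 0)}"

lemma finite_bounded_rows: "finite (bounded_rows p q L H)"
  unfolding bounded_rows_def by (rule finite_set_of_finite_funs) auto

lemma bounded_rowsD: "m \<in> bounded_rows p q L H \<Longrightarrow> p \<le> j \<Longrightarrow> j \<le> q \<Longrightarrow> L \<le> m j \<and> m j \<le> H"
  by (auto simp: bounded_rows_def)

text \<open>Passing from the entries of a row to its drop columns is a conjugation, hence its own inverse.\<close>

definition conj_row :: "int \<Rightarrow> int \<Rightarrow> int \<Rightarrow> int \<Rightarrow> (int \<Rightarrow> int) \<Rightarrow> int \<Rightarrow> int" where
  "conj_row p q L H f j = (if j \<in> {p..q} then drop_col (L + 1) H f (j + 1) - 1 else 0)"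

lemma conj_row_in_bounded_rows:
  assumes "L \<le> H" shows "conj_row p q L H f \<in> bounded_rows p q L H"
proof -
  have "L \<le> drop_col (L + 1) H f c - 1 \<and> drop_col (L + 1) H f c - 1 \<le> H" for c
    using drop_col_bounds[of "L + 1" H f c] assms by auto
  then show ?thesis unfolding bounded_rows_def conj_row_def by simp
qed

lemma antimono_on_conj_row: "antimono_on {p..q} (conj_row p q L H f)"
proof (rule monotone_onI)
  fix j k assume "j \<in> {p..q}" "k \<in> {p..q}" "j \<le> k"
  then show "conj_row p q L H f k \<le> conj_row p q L H f j"
    using antimonoD[OF antimono_drop_col, of "j + 1" "k + 1" "L + 1" H f] by (simp add: conj_row_def)
qed

lemma drop_col_conj_row:
  assumes f: "antimono_on {L..H + 1} f" "f (H + 1) = p" "f L = q + 1" and LH: "L \<le> H" and c: "c \<in> {L..H + 1}"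
  shows "drop_col p q (conj_row p q L H f) c = f c"
proof (rule drop_col_eqI)
  show "p \<le> f c" "f c \<le> q + 1"
    using monotone_onD[OF f(1), of c "H + 1"] monotone_onD[OF f(1), of L c] f(2,3) LH c by auto
  fix j assume j: "p \<le> j" "j \<le> q"
  have "antimono_on {L + 1..H} f" using f(1) by (rule monotone_on_subset) auto
  then have inner: "c \<le> conj_row p q L H f j \<longleftrightarrow> j < f c" if "c \<in> {L + 1..H}"
    using less_drop_col_iff[of "L + 1" H f c "j + 1"] that j by (auto simp: conj_row_def)
  have "L \<le> conj_row p q L H f j" "conj_row p q L H f j \<le> H"
    using bounded_rowsD[OF conj_row_in_bounded_rows[OF LH] j] by auto
  then show "c \<le> conj_row p q L H f j \<longleftrightarrow> j < f c"
    using inner c j f(2,3) by (cases "c = L"; cases "c = H + 1") auto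
qed

lemma conj_row_drop_col:
  assumes m: "m \<in> bounded_rows p q L H" "antimono_on {p..q} m"
  shows "conj_row p q L H (drop_col p q m) = m"
proof
  fix j
  show "conj_row p q L H (drop_col p q m) j = m j"
  proof (cases "j \<in> {p..q}")
    case True
    have "drop_col (L + 1) H (drop_col p q m) (j + 1) = m j + 1"
    proof (rule drop_col_eqI)
      show "j + 1 \<le> drop_col p q m c \<longleftrightarrow> c < m j + 1" for c
        using less_drop_col_iff[OF m(2), of j c] True by auto
    qed (use bounded_rowsD[OF m(1), of j] True in auto)
    then show ?thesis using True by (simp add: conj_row_def)
  qed (use m(1) in \<open>auto simp: conj_row_def bounded_rows_def\<close>)
qed

definition row_offset :: "int \<Rightarrow> int \<Rightarrow> int \<Rightarrow> int \<Rightarrow> int" where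
  "row_offset p q L H = L * (q + 1 - p) - (H - L) * p - (q + 1)"

lemma sum_row_eq_sum_drop_col:
  assumes m: "\<And>j. p \<le> j \<Longrightarrow> j \<le> q \<Longrightarrow> L \<le> m j \<and> m j \<le> H" and LH: "L \<le> H" and pq: "p \<le> q + 1"
  shows "(\<Sum>j\<in>{p..q}. m j) = row_offset p q L H + (\<Sum>c\<in>{L..H}. drop_col p q m c)"
proof -
  have entry: "m j = L + (\<Sum>c\<in>{L + 1..H}. of_bool (c \<le> m j))" if "j \<in> {p..q}" for j
  proof -
    have "{L + 1..H} \<inter> {c. c \<le> m j} = {L + 1..m j}" using m[of j] that by auto
    then show ?thesis using m[of j] that by (simp add: of_bool_def sum.If_cases)
  qed
  have "(\<Sum>j\<in>{p..q}. m j) = (\<Sum>j\<in>{p..q}. L + (\<Sum>c\<in>{L + 1..H}. of_bool (c \<le> m j)))"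
    by (rule sum.cong[OF refl entry])
  also have "\<dots> = L * (q + 1 - p) + (\<Sum>c\<in>{L + 1..H}. \<Sum>j\<in>{p..q}. of_bool (c \<le> m j))"
    using pq by (subst sum.distrib, subst sum.swap) (simp add: algebra_simps)
  also have "(\<lambda>c. \<Sum>j\<in>{p..q}. of_bool (c \<le> m j)) = (\<lambda>c. drop_col p q m c - p)"
    by (simp add: drop_col_def fun_eq_iff of_bool_def sum.If_cases Int_def conj_commute)
  also have "(\<Sum>c\<in>{L + 1..H}. drop_col p q m c - p) = (\<Sum>c\<in>{L + 1..H}. drop_col p q m c) - (H - L) * p"
    using LH by (simp add: sum_subtractf)
  also have "{L..H} = insert L {L + 1..H}" using LH by auto
  then have "(\<Sum>c\<in>{L + 1..H}. drop_col p q m c) = (\<Sum>c\<in>{L..H}. drop_col p q m c) - (q + 1)"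
    using drop_col_bottom[of p q L m] m pq by simp
  finally show ?thesis by (simp add: row_offset_def)
qed

section \<open>Exchange of two steps at a row\<close>

definition row_term :: "'k::field \<Rightarrow> 'k \<Rightarrow> int set \<Rightarrow> int set \<Rightarrow> int set \<Rightarrow> (int \<Rightarrow> int) \<Rightarrow> (int \<Rightarrow> int) \<Rightarrow> (int \<Rightarrow> int) \<Rightarrow> 'k" where
  "row_term t z A M B l n m = pair_wt t A M l m * pair_wt t M B m n * z powi (\<Sum>j\<in>M. m j)"

lemma heights_wt_neq_0D: "heights_wt t P N c u v \<noteq> 0 \<Longrightarrow> u \<le> v"
  by (auto simp: heights_wt_def col_wt_def split: if_splits)

lemma prod_power_int: "(\<Prod>c\<in>A. z powi g c) = (z::'k::field) powi (\<Sum>c\<in>A. g c)" if "z \<noteq> 0"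
  by (induction A rule: infinite_finite_induct) (auto simp: power_int_add that)

locale between_rows =
  fixes p q p\<^sub>1 q\<^sub>1 p\<^sub>2 q\<^sub>2 L H :: int and l n :: "int \<Rightarrow> int"
  assumes antimono_l: "antimono_on {p..q} l" and antimono_n: "antimono_on {p\<^sub>2..q\<^sub>2} n"
    and steps: "steps p q p\<^sub>1 q\<^sub>1" "steps p\<^sub>1 q\<^sub>1 p\<^sub>2 q\<^sub>2"
    and pq: "p \<le> q + 1" "p\<^sub>1 \<le> q\<^sub>1 + 1" "p\<^sub>2 \<le> q\<^sub>2 + 1" and LH: "L \<le> H"
    and l: "\<And>j. p \<le> j \<Longrightarrow> j \<le> q \<Longrightarrow> L \<le> l j \<and> l j \<le> H"
    and n: "\<And>j. p\<^sub>2 \<le> j \<Longrightarrow> j \<le> q\<^sub>2 \<Longrightarrow> L \<le> n j \<and> n j \<le> H"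
begin

abbreviation "P \<equiv> drop_col p q l"
abbreviation "N \<equiv> drop_col p\<^sub>2 q\<^sub>2 n"
abbreviation "D \<equiv> drop_col p\<^sub>1 q\<^sub>1"

definition interlacing_rows :: "(int \<Rightarrow> int) set" where
  "interlacing_rows = {m\<in>bounded_rows p\<^sub>1 q\<^sub>1 L H. interlaced {p..q} {p\<^sub>1..q\<^sub>1} l m \<and> interlaced {p\<^sub>1..q\<^sub>1} {p\<^sub>2..q\<^sub>2} m n}"

definition drop_paths :: "(int \<Rightarrow> int) set" where
  "drop_paths = {f\<in>Pi\<^sub>E {L..H + 1} ((\<lambda>c. mids (P c) (N c))(H + 1 := {p\<^sub>1}, L := {q\<^sub>1 + 1})). antimono_on {L..H + 1} f}"

lemma interlaced_iff_mids:
  assumes "antimono_on {p\<^sub>1..q\<^sub>1} m"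
  shows "interlaced {p..q} {p\<^sub>1..q\<^sub>1} l m \<and> interlaced {p\<^sub>1..q\<^sub>1} {p\<^sub>2..q\<^sub>2} m n \<longleftrightarrow> (\<forall>c. D m c \<in> mids (P c) (N c))"
proof -
  have "d \<in> mids a b \<longleftrightarrow> (d = a - 1 \<or> d = a) \<and> (b = d - 1 \<or> b = d)" for a b d by (auto simp: mids_def)
  then show ?thesis
    unfolding interlaced_iff_drop_col[OF antimono_l assms steps(1) pq(1,2)]
      interlaced_iff_drop_col[OF assms antimono_n steps(2) pq(2,3)] by (simp add: all_conj_distrib)
qed

lemma antimono_on_interlacing_rows: "m \<in> interlacing_rows \<Longrightarrow> antimono_on {p\<^sub>1..q\<^sub>1} m"
  using interlaced_antimono_on(2)[OF steps(1), of l m] by (simp add: interlacing_rows_def)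

lemma drop_col_above:
  assumes "c > H" "m \<in> bounded_rows p\<^sub>1 q\<^sub>1 L H" shows "D m c = p\<^sub>1"
proof (rule drop_col_top[OF _ pq(2)])
  show "m j < c" if "p\<^sub>1 \<le> j" "j \<le> q\<^sub>1" for j using bounded_rowsD[OF assms(2) that] assms(1) by simp
qed

lemma drop_col_below:
  assumes "c \<le> L" "m \<in> bounded_rows p\<^sub>1 q\<^sub>1 L H" shows "D m c = q\<^sub>1 + 1"
proof (rule drop_col_bottom[OF _ pq(2)])
  show "c \<le> m j" if "p\<^sub>1 \<le> j" "j \<le> q\<^sub>1" for j using bounded_rowsD[OF assms(2) that] assms(1) by simp
qed

lemma mids_above:
  assumes "c > H" shows "p\<^sub>1 \<in> mids (P c) (N c)"
proof -
  have "P c = p" by (rule drop_col_top[OF _ pq(1)]) (use l assms in fastforce)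
  moreover have "N c = p\<^sub>2" by (rule drop_col_top[OF _ pq(3)]) (use n assms in fastforce)
  ultimately show ?thesis using steps by (auto simp: steps_def mids_def)
qed

lemma mids_below:
  assumes "c \<le> L" shows "q\<^sub>1 + 1 \<in> mids (P c) (N c)"
proof -
  have "P c = q + 1" by (rule drop_col_bottom[OF _ pq(1)]) (use l assms in fastforce)
  moreover have "N c = q\<^sub>2 + 1" by (rule drop_col_bottom[OF _ pq(3)]) (use n assms in fastforce)
  ultimately show ?thesis using steps by (auto simp: steps_def mids_def)
qed

lemma drop_path_of_row:
  assumes m: "m \<in> interlacing_rows"
  shows "restrict (D m) {L..H + 1} \<in> drop_paths"
proof -
  have "D m c \<in> mids (P c) (N c)" for c
    using interlaced_iff_mids[OF antimono_on_interlacing_rows[OF m]] m by (simp add: interlacing_rows_def)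
  moreover have "D m (H + 1) = p\<^sub>1" "D m L = q\<^sub>1 + 1"
    using m drop_col_above drop_col_below by (simp_all add: interlacing_rows_def)
  moreover have "antimono_on {L..H + 1} (restrict (D m) {L..H + 1})"
    by (rule monotone_onI) (use antimonoD[OF antimono_drop_col] in simp)
  ultimately show ?thesis by (auto simp: drop_paths_def)
qed

lemma drop_path_mem:
  "f \<in> drop_paths \<Longrightarrow> c \<in> {L..H + 1} \<Longrightarrow> f c \<in> ((\<lambda>c. mids (P c) (N c))(H + 1 := {p\<^sub>1}, L := {q\<^sub>1 + 1})) c"
  unfolding drop_paths_def by (blast dest: PiE_mem)

lemma drop_col_conj_drop_path:
  assumes f: "f \<in> drop_paths" and c: "c \<in> {L..H + 1}"
  shows "D (conj_row p\<^sub>1 q\<^sub>1 L H f) c = f c"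
proof (rule drop_col_conj_row[OF _ _ _ LH c])
  show "antimono_on {L..H + 1} f" using f by (simp add: drop_paths_def)
  show "f (H + 1) = p\<^sub>1" "f L = q\<^sub>1 + 1"
    using drop_path_mem[OF f, of "H + 1"] drop_path_mem[OF f, of L] LH by simp_all
qed

lemma row_of_drop_path:
  assumes f: "f \<in> drop_paths"
  shows "conj_row p\<^sub>1 q\<^sub>1 L H f \<in> interlacing_rows"
proof -
  let ?m = "conj_row p\<^sub>1 q\<^sub>1 L H f"
  have m: "?m \<in> bounded_rows p\<^sub>1 q\<^sub>1 L H" by (rule conj_row_in_bounded_rows[OF LH])
  have "D ?m c \<in> mids (P c) (N c)" for c
  proof -
    consider (above) "c > H" | (below) "c \<le> L" | (inside) "c \<in> {L + 1..H}" by fastforce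
    then show ?thesis
    proof cases
      case above
      then show ?thesis using drop_col_above[OF above m] mids_above by simp
    next
      case below
      then show ?thesis using drop_col_below[OF below m] mids_below by simp
    next
      case inside
      then have "f c \<in> mids (P c) (N c)" using drop_path_mem[OF f, of c] by simp
      then show ?thesis using drop_col_conj_drop_path[OF f] inside by simp
    qed
  qed
  then show ?thesis using m interlaced_iff_mids[OF antimono_on_conj_row] by (simp add: interlacing_rows_def)
qed

lemma pair_wt_eq_prod_heights_wt:
  assumes m: "m \<in> interlacing_rows"
  shows "pair_wt t {p..q} {p\<^sub>1..q\<^sub>1} l m * pair_wt t {p\<^sub>1..q\<^sub>1} {p\<^sub>2..q\<^sub>2} m n =
    (\<Prod>c\<in>{L..H}. heights_wt t P N c (D m (c + 1)) (D m c))"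
proof -
  have m: "m \<in> bounded_rows p\<^sub>1 q\<^sub>1 L H" "interlaced {p..q} {p\<^sub>1..q\<^sub>1} l m" "interlaced {p\<^sub>1..q\<^sub>1} {p\<^sub>2..q\<^sub>2} m n"
    using m by (auto simp: interlacing_rows_def)
  have "D m (c + 1) \<le> D m c" for c by (rule antimonoD[OF antimono_drop_col]) simp
  then have "heights_wt t P N c (D m (c + 1)) (D m c) = row_wt t (nat (P c - P (c + 1))) (nat (D m c - D m (c + 1))) *
      row_wt t (nat (D m c - D m (c + 1))) (nat (N c - N (c + 1)))" for c
    by (simp add: heights_wt_def col_wt_def)
  moreover note pair_wt_eq_prod_drop_col[where t = t, OF bounded_rowsD[OF m(1)] m(2)]
    pair_wt_eq_prod_drop_col[where t = t, OF n m(3)]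
  ultimately show ?thesis by (simp add: prod.distrib)
qed

lemma antimono_on_of_heights_wt:
  assumes "\<And>c. c \<in> {L..H} \<Longrightarrow> heights_wt t P N c (f (c + 1)) (f c) \<noteq> 0"
  shows "antimono_on {L..H + 1} f"
  by (rule antimono_on_atLeastAtMost_intI, rule heights_wt_neq_0D, rule assms) simp

lemma row_sum_eq_chain_sum:
  fixes g :: "int \<Rightarrow> int \<Rightarrow> int \<Rightarrow> 'k::field"
  shows "(\<Sum>m\<in>bounded_rows p\<^sub>1 q\<^sub>1 L H. pair_wt t {p..q} {p\<^sub>1..q\<^sub>1} l m * pair_wt t {p\<^sub>1..q\<^sub>1} {p\<^sub>2..q\<^sub>2} m n *
      (\<Prod>c\<in>{L..H}. g c (D m (c + 1)) (D m c))) =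
    chain_sum ((\<lambda>c. mids (P c) (N c))(H + 1 := {p\<^sub>1})) (\<lambda>c u v. heights_wt t P N c u v * g c u v) (H + 1) L (q\<^sub>1 + 1)"
    (is "?rows = ?paths")
proof -
  let ?row_wt = "\<lambda>m. pair_wt t {p..q} {p\<^sub>1..q\<^sub>1} l m * pair_wt t {p\<^sub>1..q\<^sub>1} {p\<^sub>2..q\<^sub>2} m n *
    (\<Prod>c\<in>{L..H}. g c (D m (c + 1)) (D m c))"
  let ?path_wt = "\<lambda>f. \<Prod>c\<in>{L..H}. heights_wt t P N c (f (c + 1)) (f c) * g c (f (c + 1)) (f c)"
  have "?rows = sum ?row_wt interlacing_rows"
    by (rule sum.mono_neutral_right) (auto simp: finite_bounded_rows interlacing_rows_def pair_wt_def)
  also have "\<dots> = sum ?path_wt drop_paths"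
  proof (rule sum.reindex_bij_witness[where j = "\<lambda>m. restrict (D m) {L..H + 1}" and i = "conj_row p\<^sub>1 q\<^sub>1 L H"])
    fix m assume m: "m \<in> interlacing_rows"
    show "restrict (D m) {L..H + 1} \<in> drop_paths" by (rule drop_path_of_row[OF m])
    have "conj_row p\<^sub>1 q\<^sub>1 L H (restrict (D m) {L..H + 1}) = conj_row p\<^sub>1 q\<^sub>1 L H (D m)"
      unfolding conj_row_def using drop_col_cong[of "L + 1" H "restrict (D m) {L..H + 1}" "D m"] by (simp add: fun_eq_iff)
    also have "\<dots> = m"
      by (rule conj_row_drop_col[OF _ antimono_on_interlacing_rows[OF m]]) (use m in \<open>simp add: interlacing_rows_def\<close>)
    finally show "conj_row p\<^sub>1 q\<^sub>1 L H (restrict (D m) {L..H + 1}) = m" .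
    show "?path_wt (restrict (D m) {L..H + 1}) = ?row_wt m"
      unfolding pair_wt_eq_prod_heights_wt[OF m] prod.distrib[symmetric] by (rule prod.cong) auto
  next
    fix f assume f: "f \<in> drop_paths"
    show "conj_row p\<^sub>1 q\<^sub>1 L H f \<in> interlacing_rows" by (rule row_of_drop_path[OF f])
    show "restrict (D (conj_row p\<^sub>1 q\<^sub>1 L H f)) {L..H + 1} = f"
    proof (rule extensionalityI[of _ "{L..H + 1}"])
      show "f \<in> extensional {L..H + 1}" using f by (auto simp: drop_paths_def PiE_def)
    qed (simp_all add: drop_col_conj_drop_path[OF f])
  qed
  also have "\<dots> = ?paths"
  proof -
    have "{L..<H + 1} = {L..H}" by auto
    then have "?paths = sum ?path_wt (Pi\<^sub>E {L..H + 1} ((\<lambda>c. mids (P c) (N c))(H + 1 := {p\<^sub>1}, L := {q\<^sub>1 + 1})))"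
      by (simp add: chain_sum_def)
    also have "\<dots> = sum ?path_wt drop_paths"
      by (rule sum.mono_neutral_right) (auto simp: drop_paths_def intro!: finite_PiE intro: antimono_on_of_heights_wt)
    finally show ?thesis ..
  qed
  finally show ?thesis .
qed

lemma tail_wt_eq_prod_end_wt:
  assumes m: "m \<in> interlacing_rows" and "p\<^sub>1 \<le> q\<^sub>1" "L < H"
  shows "tail_wt (1 / z) (L - m q\<^sub>1) * tail_wt z (m p\<^sub>1 - H) = (\<Prod>c\<in>{L..H}. end_wt z L H c (D m (c + 1)) (D m c))"
proof -
  have bounded: "m \<in> bounded_rows p\<^sub>1 q\<^sub>1 L H" using m by (simp add: interlacing_rows_def)
  note outside = drop_col_above[OF _ bounded, of "H + 1", simplified] drop_col_below[OF order_refl bounded]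
    and bounds = drop_col_bounds[OF pq(2), of m]
    and entry = less_drop_col_iff[OF antimono_on_interlacing_rows[OF m]]
  have top: "m p\<^sub>1 = H \<longleftrightarrow> D m (H + 1) \<noteq> D m H"
    using entry[of p\<^sub>1 H] bounded_rowsD[OF bounded, of p\<^sub>1] bounds[of H] outside(1) assms(2) by auto
  have bottom: "m q\<^sub>1 = L \<longleftrightarrow> D m (L + 1) \<noteq> D m L"
    using entry[of q\<^sub>1 "L + 1"] bounded_rowsD[OF bounded, of q\<^sub>1] bounds[of "L + 1"] outside(2) assms(2) by auto
  have "(\<Prod>c\<in>{L..H}. end_wt z L H c (D m (c + 1)) (D m c)) =
    (\<Prod>c\<in>{L..H}. if H = c then (if D m (c + 1) \<noteq> D m c then 1 / (1 - z) else 1) else 1) *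
    (\<Prod>c\<in>{L..H}. if L = c then (if D m (c + 1) \<noteq> D m c then 1 / (1 - 1 / z) else 1) else 1)"
    unfolding prod.distrib[symmetric] end_wt_def by (rule prod.cong) auto
  then show ?thesis
    using assms(2,3) bounded_rowsD[OF bounded, of p\<^sub>1] bounded_rowsD[OF bounded, of q\<^sub>1]
    by (simp add: prod.delta tail_wt_def flip: top bottom)
qed

lemma row_sum_tail_wt:
  fixes t z :: "'k::field"
  assumes z: "z \<noteq> 0" and "p\<^sub>1 \<le> q\<^sub>1" "L < H"
  shows "(\<Sum>m\<in>bounded_rows p\<^sub>1 q\<^sub>1 L H. tail_wt (1 / z) (L - m q\<^sub>1) * (tail_wt z (m p\<^sub>1 - H) *
      row_term t z {p..q} {p\<^sub>1..q\<^sub>1} {p\<^sub>2..q\<^sub>2} l n m)) =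
    z powi row_offset p\<^sub>1 q\<^sub>1 L H * chain_sum ((\<lambda>c. mids (P c) (N c))(H + 1 := {p\<^sub>1}))
      (\<lambda>c u v. heights_wt t P N c u v * (z powi v * end_wt z L H c u v)) (H + 1) L (q\<^sub>1 + 1)"
  unfolding row_sum_eq_chain_sum[symmetric] sum_distrib_left
proof (rule sum.cong[OF refl])
  fix m assume m: "m \<in> bounded_rows p\<^sub>1 q\<^sub>1 L H"
  let ?w = "pair_wt t {p..q} {p\<^sub>1..q\<^sub>1} l m * pair_wt t {p\<^sub>1..q\<^sub>1} {p\<^sub>2..q\<^sub>2} m n"
  show "tail_wt (1 / z) (L - m q\<^sub>1) * (tail_wt z (m p\<^sub>1 - H) * row_term t z {p..q} {p\<^sub>1..q\<^sub>1} {p\<^sub>2..q\<^sub>2} l n m) =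
    z powi row_offset p\<^sub>1 q\<^sub>1 L H * (?w * (\<Prod>c\<in>{L..H}. z powi D m c * end_wt z L H c (D m (c + 1)) (D m c)))"
  proof (cases "?w = 0")
    case False
    then have "m \<in> interlacing_rows" using m by (auto simp: interlacing_rows_def dest: interlaced_of_pair_wt)
    moreover have "(\<Sum>j\<in>{p\<^sub>1..q\<^sub>1}. m j) = row_offset p\<^sub>1 q\<^sub>1 L H + (\<Sum>c\<in>{L..H}. D m c)"
      by (rule sum_row_eq_sum_drop_col[OF bounded_rowsD[OF m] LH pq(2)])
    ultimately show ?thesis
      using assms by (simp add: row_term_def prod.distrib prod_power_int power_int_add mult_ac flip: tail_wt_eq_prod_end_wt)
  qed (auto simp: row_term_def)
qed

lemma row_sum_inverse:
  fixes t z :: "'k::field"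
  assumes z: "z \<noteq> 0"
  shows "z powi ((\<Sum>j\<in>{p..q}. l j) + (\<Sum>j\<in>{p\<^sub>2..q\<^sub>2}. n j)) *
      (\<Sum>m\<in>bounded_rows p\<^sub>1 q\<^sub>1 L H. row_term t (1 / z) {p..q} {p\<^sub>1..q\<^sub>1} {p\<^sub>2..q\<^sub>2} l n m) =
    z powi (row_offset p q L H + row_offset p\<^sub>2 q\<^sub>2 L H - row_offset p\<^sub>1 q\<^sub>1 L H) *
      chain_sum ((\<lambda>c. mids (P c) (N c))(H + 1 := {p\<^sub>1}))
      (\<lambda>c u v. heights_wt t P N c u v * z powi (P c + N c - v)) (H + 1) L (q\<^sub>1 + 1)"
  unfolding row_sum_eq_chain_sum[symmetric] sum_distrib_left
proof (rule sum.cong[OF refl])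
  fix m assume m: "m \<in> bounded_rows p\<^sub>1 q\<^sub>1 L H"
  have sums: "(\<Sum>j\<in>{p\<^sub>1..q\<^sub>1}. m j) = row_offset p\<^sub>1 q\<^sub>1 L H + (\<Sum>c\<in>{L..H}. D m c)"
    "(\<Sum>j\<in>{p..q}. l j) = row_offset p q L H + (\<Sum>c\<in>{L..H}. P c)"
    "(\<Sum>j\<in>{p\<^sub>2..q\<^sub>2}. n j) = row_offset p\<^sub>2 q\<^sub>2 L H + (\<Sum>c\<in>{L..H}. N c)"
    by (rule sum_row_eq_sum_drop_col; use bounded_rowsD[OF m] l n LH pq in blast)+
  have inverse: "(1 / z) powi k = z powi (- k)" for k by (simp add: power_int_minus divide_inverse power_int_inverse)
  let ?w = "pair_wt t {p..q} {p\<^sub>1..q\<^sub>1} l m * pair_wt t {p\<^sub>1..q\<^sub>1} {p\<^sub>2..q\<^sub>2} m n"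
    and ?e = "(\<Sum>j\<in>{p..q}. l j) + (\<Sum>j\<in>{p\<^sub>2..q\<^sub>2}. n j)"
    and ?k = "row_offset p q L H + row_offset p\<^sub>2 q\<^sub>2 L H - row_offset p\<^sub>1 q\<^sub>1 L H"
  have monomial: "z powi ?e * (1 / z) powi (\<Sum>j\<in>{p\<^sub>1..q\<^sub>1}. m j) = z powi ?k * (\<Prod>c\<in>{L..H}. z powi (P c + N c - D m c))"
    unfolding prod_power_int[OF z] inverse sums using z
    by (simp add: sum_subtractf sum.distrib algebra_simps flip: power_int_add)
  have "z powi ?e * row_term t (1 / z) {p..q} {p\<^sub>1..q\<^sub>1} {p\<^sub>2..q\<^sub>2} l n m =
    ?w * (z powi ?e * (1 / z) powi (\<Sum>j\<in>{p\<^sub>1..q\<^sub>1}. m j))"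
    unfolding row_term_def by (simp only: mult_ac)
  also have "\<dots> = z powi ?k * (?w * (\<Prod>c\<in>{L..H}. z powi (P c + N c - D m c)))"
    unfolding monomial by (rule mult.left_commute)
  finally show "z powi ?e * row_term t (1 / z) {p..q} {p\<^sub>1..q\<^sub>1} {p\<^sub>2..q\<^sub>2} l n m =
    z powi ?k * (?w * (\<Prod>c\<in>{L..H}. z powi (P c + N c - D m c)))" .
qed

end

lemma row_exchange:
  fixes t z :: "'k::field"
  assumes z: "z \<noteq> 0" "z \<noteq> 1" and LH: "L < H"
    and pq: "p \<le> q + 1" "p\<^sub>2 \<le> q\<^sub>2" and p\<^sub>2: "p\<^sub>2 = p - 1 \<or> p\<^sub>2 = p - 2" and q\<^sub>2: "q\<^sub>2 = q \<or> q\<^sub>2 = q - 1"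
    and l: "\<And>j. p \<le> j \<Longrightarrow> j \<le> q \<Longrightarrow> L < l j \<and> l j < H"
    and n: "\<And>j. p\<^sub>2 \<le> j \<Longrightarrow> j \<le> q\<^sub>2 \<Longrightarrow> L < n j \<and> n j < H"
  shows "bottom_factor t z q q\<^sub>2 * (\<Sum>m\<in>bounded_rows (p - 1) q L H. tail_wt (1 / z) (L - m q) *
      (tail_wt z (m (p - 1) - H) * row_term t z {p..q} {p - 1..q} {p\<^sub>2..q\<^sub>2} l n m)) =
    top_factor t z p p\<^sub>2 * (z powi ((\<Sum>j\<in>{p..q}. l j) + (\<Sum>j\<in>{p\<^sub>2..q\<^sub>2}. n j)) *
      (\<Sum>m\<in>bounded_rows (p\<^sub>2 + 1) q\<^sub>2 L H. row_term t (1 / z) {p..q} {p\<^sub>2 + 1..q\<^sub>2} {p\<^sub>2..q\<^sub>2} l n m))"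
proof -
  have steps: "steps p q (p - 1) q" "steps (p - 1) q p\<^sub>2 q\<^sub>2" "steps p q (p\<^sub>2 + 1) q\<^sub>2" "steps (p\<^sub>2 + 1) q\<^sub>2 p\<^sub>2 q\<^sub>2"
    using p\<^sub>2 q\<^sub>2 by (auto simp: steps_def)
  show ?thesis
  proof (cases "antimono_on {p..q} l \<and> antimono_on {p\<^sub>2..q\<^sub>2} n")
    case False
    have "row_term t z' {p..q} {p\<^sub>1..q\<^sub>1} {p\<^sub>2..q\<^sub>2} l n m = 0" if "steps p q p\<^sub>1 q\<^sub>1" "steps p\<^sub>1 q\<^sub>1 p\<^sub>2 q\<^sub>2" for z' p\<^sub>1 q\<^sub>1 m
      using False interlaced_antimono_on(1)[OF that(1), of l m] interlaced_antimono_on(2)[OF that(2), of m n]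
      by (auto simp: row_term_def pair_wt_def)
    then show ?thesis using steps by simp
  next
    case True
    have weak: "p \<le> j \<Longrightarrow> j \<le> q \<Longrightarrow> L \<le> l j \<and> l j \<le> H" "p\<^sub>2 \<le> j \<Longrightarrow> j \<le> q\<^sub>2 \<Longrightarrow> L \<le> n j \<and> n j \<le> H" for j
      using l[of j] n[of j] by auto
    interpret upper: between_rows p q "p - 1" q p\<^sub>2 q\<^sub>2 L H l n
      by unfold_locales (use True steps pq LH weak in auto)
    interpret lower: between_rows p q "p\<^sub>2 + 1" q\<^sub>2 p\<^sub>2 q\<^sub>2 L H l n
      by unfold_locales (use True steps pq LH weak in auto)
    have offset: "row_offset (p - 1) q L H = row_offset p q L H + row_offset p\<^sub>2 q\<^sub>2 L H - row_offset (p\<^sub>2 + 1) q\<^sub>2 L H"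
      by (simp add: row_offset_def algebra_simps)
    interpret window: step_exchange t z upper.P upper.N L H p q p\<^sub>2 q\<^sub>2
    proof
      show "upper.P c = p" "upper.N c = p\<^sub>2" if "c \<ge> H" for c
        using that l n pq by (auto intro!: drop_col_top intro: less_le_trans)
      show "upper.P c = q + 1" "upper.N c = q\<^sub>2 + 1" if "c \<le> L + 1" for c
        using that l n pq by (fastforce intro!: drop_col_bottom)+
    qed (fact z LH p\<^sub>2 q\<^sub>2 antimono_drop_col)+
    show ?thesis
      unfolding lower.row_sum_inverse[OF z(1)] offset[symmetric] upper.row_sum_tail_wt[OF z(1) pq(1)[folded diff_le_eq] LH]
      using window.upper_sum_eq_lower_sum[unfolded window.upper_sum_def window.lower_sum_def]
      by (simp add: mult.left_commute)
  qed
qed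

section \<open>Summation over one row of an array\<close>

lemma prod_image_level_sets:
  "(\<Prod>c\<in>m ` B. F {j\<in>A. l j = c} {j\<in>B. m j = c}) =
   (\<Prod>(X, Y)\<in>(\<lambda>k. ({j\<in>A. l j = m k}, {j\<in>B. m j = m k})) ` B. F X Y)"
proof -
  let ?level = "\<lambda>c. ({j\<in>A. l j = c}, {j\<in>B. m j = c})"
  have "(\<lambda>k. ({j\<in>A. l j = m k}, {j\<in>B. m j = m k})) ` B = ?level ` (m ` B)" by (simp add: image_image)
  moreover have "inj_on ?level (m ` B)" by (rule inj_onI) auto
  ultimately show ?thesis by (simp add: prod.reindex)
qed

lemma pair_wt_order_cong:
  assumes le: "\<And>j k. j \<in> A \<Longrightarrow> k \<in> B \<Longrightarrow> (l j \<le> m k \<longleftrightarrow> l' j \<le> m' k) \<and> (m k \<le> l j \<longleftrightarrow> m' k \<le> l' j)"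
    and eq: "\<And>j k. j \<in> B \<Longrightarrow> k \<in> B \<Longrightarrow> m j = m k \<longleftrightarrow> m' j = m' k"
  shows "pair_wt t A B l m = pair_wt t A B l' m'"
proof -
  have interlaced: "interlaced A B l m \<longleftrightarrow> interlaced A B l' m'"
    unfolding interlaced_def using le by auto
  have "l j = m k \<longleftrightarrow> l' j = m' k" if "j \<in> A" "k \<in> B" for j k
    using le[OF that] by presburger
  then have levels: "(\<lambda>k. ({j\<in>A. l j = m k}, {j\<in>B. m j = m k})) ` B = (\<lambda>k. ({j\<in>A. l' j = m' k}, {j\<in>B. m' j = m' k})) ` B"
    using eq by (intro image_cong) auto
  show ?thesis
    unfolding pair_wt_def prod_image_level_sets[where F = "\<lambda>X Y. row_wt t (card X) (card Y)"] interlaced levels ..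
qed

lemma row_term_upd:
  assumes z: "z \<noteq> 0" and M: "finite M" "k \<in> M"
    and order: "\<And>w. w \<in> l ` A \<union> n ` B \<union> m ` (M - {k}) \<Longrightarrow> (w \<le> x \<longleftrightarrow> w \<le> m k) \<and> (x \<le> w \<longleftrightarrow> m k \<le> w)"
  shows "row_term t z A M B l n (m(k := x)) = z powi (x - m k) * row_term t z A M B l n m"
proof -
  have l: "(l j \<le> x \<longleftrightarrow> l j \<le> m k) \<and> (x \<le> l j \<longleftrightarrow> m k \<le> l j)" if "j \<in> A" for j
    using order[of "l j"] that by simp
  have n: "(n j \<le> x \<longleftrightarrow> n j \<le> m k) \<and> (x \<le> n j \<longleftrightarrow> m k \<le> n j)" if "j \<in> B" for j
    using order[of "n j"] that by simp
  have m: "m j = x \<longleftrightarrow> m j = m k" if "j \<in> M" "j \<noteq> k" for j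
    using order[of "m j"] that by (simp, presburger)
  have "pair_wt t A M l (m(k := x)) = pair_wt t A M l m"
  proof (rule pair_wt_order_cong)
    show "(m(k := x)) i = (m(k := x)) j \<longleftrightarrow> m i = m j" if "i \<in> M" "j \<in> M" for i j
      using m[of i] m[of j] that by (auto simp: eq_commute[of x])
  qed (use l in simp)
  moreover have "pair_wt t M B (m(k := x)) n = pair_wt t M B m n"
    by (rule pair_wt_order_cong) (use n in simp_all)
  moreover have "(\<Sum>j\<in>M. (m(k := x)) j) = (x - m k) + (\<Sum>j\<in>M. m j)"
    using M by (simp add: sum.remove[of M k])
  ultimately show ?thesis using z by (simp add: row_term_def power_int_add)
qed

abbreviation (input) entries :: "(vertex \<Rightarrow>\<^sub>0 int) \<Rightarrow> int \<Rightarrow> int \<Rightarrow> int" where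
  "entries s i \<equiv> \<lambda>j. lookup s (i, j)"

definition off_row :: "int \<Rightarrow> (vertex \<Rightarrow>\<^sub>0 int) \<Rightarrow> (vertex \<Rightarrow>\<^sub>0 int)" where
  "off_row r = Poly_Mapping.mapp (\<lambda>v k. if fst v = r then 0 else k)"

lemma lookup_off_row: "lookup (off_row r s) v = (if fst v = r then 0 else lookup s v)"
  by (auto simp: off_row_def lookup_mapp when_def in_keys_iff)

lemma off_row_diff: "off_row r (s - s') = off_row r s - off_row r s'"
  by (rule poly_mapping_eqI) (simp add: lookup_off_row lookup_minus)

lemma entries_add_single: "entries (s + single (r, j) k) r = (entries s r)(j := entries s r j + k)"
  by (auto simp: lookup_add lookup_single when_def)

lemma off_row_eq_iff: "off_row r s = off_row r y \<longleftrightarrow> (\<forall>i. i \<noteq> r \<longrightarrow> entries s i = entries y i)"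
  by (auto simp: poly_mapping_eq_iff fun_eq_iff lookup_off_row)

lemma off_row_add_single: "off_row r (s + single (r, j) k) = off_row r s"
  by (auto simp: off_row_eq_iff lookup_add lookup_single)

abbreviation (input) slice :: "int \<Rightarrow> (vertex \<Rightarrow>\<^sub>0 int) \<Rightarrow> ((vertex \<Rightarrow>\<^sub>0 int) \<Rightarrow> 'k::zero) \<Rightarrow> (vertex \<Rightarrow>\<^sub>0 int) \<Rightarrow> 'k" where
  "slice r y \<equiv> fibre (off_row r) (off_row r y)"

definition set_row :: "int \<Rightarrow> int set \<Rightarrow> (vertex \<Rightarrow>\<^sub>0 int) \<Rightarrow> (int \<Rightarrow> int) \<Rightarrow> (vertex \<Rightarrow>\<^sub>0 int)" where
  "set_row r M y m = off_row r y + (\<Sum>j\<in>M. single (r, j) (m j))"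

lemma lookup_set_row:
  assumes "finite M"
  shows "lookup (set_row r M y m) (i, j) = (if i \<noteq> r then lookup y (i, j) else if j \<in> M then m j else 0)"
proof -
  have "(\<Sum>k\<in>M. lookup (single (r, k) (m k)) (i, j)) = (\<Sum>k\<in>M. if k = j then (m j when i = r) else 0)"
    by (rule sum.cong) (auto simp: lookup_single when_def)
  then show ?thesis using assms by (simp add: set_row_def lookup_add lookup_sum lookup_off_row)
qed

definition row_fibre :: "int \<Rightarrow> (vertex \<Rightarrow>\<^sub>0 int) \<Rightarrow> ((int \<Rightarrow> int) \<Rightarrow> 'k::zero) \<Rightarrow> (vertex \<Rightarrow>\<^sub>0 int) \<Rightarrow> 'k" where
  "row_fibre r y W s = (W (entries s r) when off_row r s = off_row r y)"

lemma finite_support_and_Sum_any_row_fibre: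
  fixes W :: "(int \<Rightarrow> int) \<Rightarrow> 'k::comm_monoid_add"
  assumes W: "\<And>m. W m \<noteq> 0 \<Longrightarrow> m \<in> bounded_rows p q L H"
  shows "finite_support (row_fibre r y W) \<and> Sum_any (row_fibre r y W) = (\<Sum>m\<in>bounded_rows p q L H. W m)"
proof -
  let ?set = "set_row r {p..q} y" and ?B = "bounded_rows p q L H"
  have entries_set: "entries (?set m) r = m" if "m \<in> ?B" for m
    using that by (auto simp: lookup_set_row bounded_rows_def)
  have support: "s \<in> ?set ` ?B" if "row_fibre r y W s \<noteq> 0" for s
  proof (rule image_eqI)
    have s: "W (entries s r) \<noteq> 0" "\<And>i. i \<noteq> r \<Longrightarrow> entries s i = entries y i"
      using that by (auto simp: row_fibre_def off_row_eq_iff)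
    show "entries s r \<in> ?B" by (rule W[OF s(1)])
    then show "s = ?set (entries s r)"
      using s(2) by (auto simp: poly_mapping_eq_iff fun_eq_iff lookup_set_row bounded_rows_def)
  qed
  have finite: "finite (?set ` ?B)" by (intro finite_imageI finite_bounded_rows)
  have "Sum_any (row_fibre r y W) = (\<Sum>s\<in>?set ` ?B. row_fibre r y W s)"
    by (rule Sum_any.expand_superset[OF finite]) (use support in blast)
  also have "\<dots> = (\<Sum>m\<in>?B. row_fibre r y W (?set m))"
    by (rule sum.reindex[unfolded o_def], rule inj_on_inverseI[where g = "\<lambda>s. entries s r"]) (rule entries_set)
  also have "\<dots> = (\<Sum>m\<in>?B. W m)"
    using entries_set by (intro sum.cong) (simp_all add: row_fibre_def off_row_eq_iff lookup_set_row)
  finally show ?thesis using finite_supportI[OF finite support] by simp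
qed

lemma has_reg_sum_row_fibre:
  fixes W :: "(int \<Rightarrow> int) \<Rightarrow> 'k::field"
  assumes z: "z \<noteq> 0" "z \<noteq> 1" and LH: "L < H"
    and top: "\<And>m. m p \<ge> H \<Longrightarrow> W (m(p := m p + 1)) = z * W m"
    and bottom: "\<And>m. m q \<le> L \<Longrightarrow> W (m(q := m q - 1)) = 1 / z * W m"
    and outside: "\<And>m j. W m \<noteq> 0 \<Longrightarrow> j \<notin> {p..q} \<Longrightarrow> m j = 0"
    and inner: "\<And>m j. W m \<noteq> 0 \<Longrightarrow> p < j \<Longrightarrow> j \<le> q \<Longrightarrow> m j \<le> H" "\<And>m j. W m \<noteq> 0 \<Longrightarrow> p \<le> j \<Longrightarrow> j < q \<Longrightarrow> L \<le> m j"
  shows "has_reg_sum (row_fibre r y W)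
    (\<Sum>m\<in>bounded_rows p q L H. tail_wt (1 / z) (L - m q) * (tail_wt z (m p - H) * W m))"
proof -
  let ?w = "row_fibre r y W" and ?truncated = "\<lambda>m. tail_wt (1 / z) (L - m q) * (tail_wt z (m p - H) * W m)"
  have bounded: "m \<in> bounded_rows p q L H" if "W m \<noteq> 0" "m p \<le> H" "L \<le> m q" for m
  proof -
    have "L \<le> m j \<and> m j \<le> H" if "p \<le> j" "j \<le> q" for j
      using inner[OF \<open>W m \<noteq> 0\<close>, of j] \<open>m p \<le> H\<close> \<open>L \<le> m q\<close> that by (cases "j = p"; cases "j = q") auto
    then show ?thesis using outside[OF that(1)] by (auto simp: bounded_rows_def)
  qed
  have "has_reg_sum ?w (Sum_any (\<lambda>s. tail_wt (1 / z) (- lookup s (r, q) - - L) * (tail_wt z (lookup s (r, p) - H) * ?w s)))"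
  proof (rule has_reg_sum_two_geometric_tails)
    show "lookup (s + single (r, p) 1) (r, p) = lookup s (r, p) + 1"
      "- lookup (s + single (r, q) (- 1)) (r, q) = - lookup s (r, q) + 1" for s :: "vertex \<Rightarrow>\<^sub>0 int"
      by (simp_all add: lookup_add)
    show "z \<noteq> 1" "1 / z \<noteq> 1" using z by auto
    show "?w (s + single (r, p) 1) = z * ?w s" if "H \<le> lookup s (r, p)" for s
      using top[of "entries s r"] that by (simp add: row_fibre_def off_row_add_single entries_add_single mult_when)
    show "?w (s + single (r, q) (- 1)) = 1 / z * ?w s" if "- L \<le> - lookup s (r, q)" for s
      using bottom[of "entries s r"] that by (simp add: row_fibre_def off_row_add_single entries_add_single mult_when)
    show "lookup (s + single (r, q) (- 1)) (r, p) = lookup s (r, p) \<or>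
        lookup (s + single (r, q) (- 1)) (r, p) < H \<and> lookup s (r, p) < H" if "- L \<le> - lookup s (r, q)" for s
      using that LH by (cases "p = q") (auto simp: lookup_add lookup_single)
    have "finite_support (row_fibre r y (\<lambda>m. W m when m p \<le> H \<and> L \<le> m q))"
      by (rule finite_support_and_Sum_any_row_fibre[THEN conjunct1]) (use bounded in auto)
    then show "finite {s. ?w s \<noteq> 0 \<and> lookup s (r, p) \<le> H \<and> - lookup s (r, q) \<le> - L}"
      unfolding finite_support_def by (rule rev_finite_subset) (auto simp: row_fibre_def)
  qed
  also have "(\<lambda>s. tail_wt (1 / z) (- lookup s (r, q) - - L) * (tail_wt z (lookup s (r, p) - H) * ?w s)) =
    row_fibre r y ?truncated"
    by (simp add: row_fibre_def fun_eq_iff when_def)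
  also have "Sum_any \<dots> = (\<Sum>m\<in>bounded_rows p q L H. ?truncated m)"
    by (rule finite_support_and_Sum_any_row_fibre[THEN conjunct2])
      (rule bounded, auto simp: tail_wt_def split: if_splits)
  finally show ?thesis .
qed

definition supported_row_term ::
  "'k::field \<Rightarrow> 'k \<Rightarrow> int set \<Rightarrow> int set \<Rightarrow> int set \<Rightarrow> (int \<Rightarrow> int) \<Rightarrow> (int \<Rightarrow> int) \<Rightarrow> (int \<Rightarrow> int) \<Rightarrow> 'k" where
  "supported_row_term t z A M B l n m = (row_term t z A M B l n m when (\<forall>j. j \<notin> M \<longrightarrow> m j = 0))"

lemma supported_row_term_upd:
  assumes "z \<noteq> 0" "finite M" "k \<in> M"
    "\<And>w. w \<in> l ` A \<union> n ` B \<union> m ` (M - {k}) \<Longrightarrow> (w \<le> x \<longleftrightarrow> w \<le> m k) \<and> (x \<le> w \<longleftrightarrow> m k \<le> w)"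
  shows "supported_row_term t z A M B l n (m(k := x)) = z powi (x - m k) * supported_row_term t z A M B l n m"
proof -
  have "(\<forall>j. j \<notin> M \<longrightarrow> (m(k := x)) j = 0) \<longleftrightarrow> (\<forall>j. j \<notin> M \<longrightarrow> m j = 0)" using assms(3) by auto
  then show ?thesis using row_term_upd[of z M k l A n B m x t] assms by (simp add: supported_row_term_def mult_when)
qed

lemma sum_supported_row_term:
  "(\<Sum>m\<in>bounded_rows p q L H. f m * supported_row_term t z A {p..q} B l n m) =
   (\<Sum>m\<in>bounded_rows p q L H. f m * row_term t z A {p..q} B l n m)"
  by (rule sum.cong) (auto simp: supported_row_term_def bounded_rows_def)

locale upper_row =
  fixes t z :: "'k::field" and p q p\<^sub>2 q\<^sub>2 L H :: int and l n :: "int \<Rightarrow> int"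
  assumes z: "z \<noteq> 0" "z \<noteq> 1" and pq: "p \<le> q + 1" and LH: "L < H"
    and l: "\<And>j. p \<le> j \<Longrightarrow> j \<le> q \<Longrightarrow> L < l j \<and> l j < H"
    and n: "\<And>j. p\<^sub>2 \<le> j \<Longrightarrow> j \<le> q\<^sub>2 \<Longrightarrow> L < n j \<and> n j < H"
begin

abbreviation "W \<equiv> supported_row_term t z {p..q} {p - 1..q} {p\<^sub>2..q\<^sub>2} l n"

lemma interlaced_of_W: "W m \<noteq> 0 \<Longrightarrow> interlaced {p..q} {p - 1..q} l m"
  by (auto simp: supported_row_term_def row_term_def intro: interlaced_of_pair_wt)

lemma entry_less_top:
  assumes "W m \<noteq> 0" "p \<le> j" "j \<le> q" shows "m j < H"
proof -
  have "m j \<le> l j" using interlaced_of_W[OF assms(1)] assms(2,3) by (simp add: interlaced_def)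
  then show ?thesis using l[OF assms(2,3)] by simp
qed

lemma entry_greater_bottom:
  assumes "W m \<noteq> 0" "p - 1 \<le> j" "j < q" shows "L < m j"
proof -
  have "l (j + 1) \<le> m j" using interlaced_of_W[OF assms(1)] assms(2,3) by (simp add: interlaced_def)
  then show ?thesis using l[of "j + 1"] assms(2,3) by simp
qed

lemma W_raise_first:
  assumes H: "H \<le> m (p - 1)"
  shows "W (m(p - 1 := m (p - 1) + 1)) = z * W m"
proof (cases "\<forall>j\<in>{p..q}. m j < H")
  case True
  have others: "w < H" if "w \<in> l ` {p..q} \<union> n ` {p\<^sub>2..q\<^sub>2} \<union> m ` ({p - 1..q} - {p - 1})" for w
    using that l n True by auto
  have "W (m(p - 1 := m (p - 1) + 1)) = z powi (m (p - 1) + 1 - m (p - 1)) * W m"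
  proof (rule supported_row_term_upd)
    show "(w \<le> m (p - 1) + 1 \<longleftrightarrow> w \<le> m (p - 1)) \<and> (m (p - 1) + 1 \<le> w \<longleftrightarrow> m (p - 1) \<le> w)"
      if "w \<in> l ` {p..q} \<union> n ` {p\<^sub>2..q\<^sub>2} \<union> m ` ({p - 1..q} - {p - 1})" for w
      using others[OF that] H by simp
  qed (use pq z(1) in auto)
  then show ?thesis by simp
next
  case False
  then obtain j where j: "p \<le> j" "j \<le> q" "\<not> m j < H" by auto
  have "W m = 0" using entry_less_top[OF _ j(1,2), of m] j(3) by auto
  moreover have "W (m(p - 1 := m (p - 1) + 1)) = 0"
    using entry_less_top[OF _ j(1,2), of "m(p - 1 := m (p - 1) + 1)"] j by auto
  ultimately show ?thesis by simp
qed

lemma W_lower_last: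
  assumes L: "m q \<le> L"
  shows "W (m(q := m q - 1)) = 1 / z * W m"
proof (cases "\<forall>j\<in>{p - 1..<q}. L < m j")
  case True
  have others: "L < w" if "w \<in> l ` {p..q} \<union> n ` {p\<^sub>2..q\<^sub>2} \<union> m ` ({p - 1..q} - {q})" for w
    using that l n True by auto
  have "W (m(q := m q - 1)) = z powi (m q - 1 - m q) * W m"
  proof (rule supported_row_term_upd)
    show "(w \<le> m q - 1 \<longleftrightarrow> w \<le> m q) \<and> (m q - 1 \<le> w \<longleftrightarrow> m q \<le> w)"
      if "w \<in> l ` {p..q} \<union> n ` {p\<^sub>2..q\<^sub>2} \<union> m ` ({p - 1..q} - {q})" for w
      using others[OF that] L by simp
  qed (use pq z(1) in auto)
  then show ?thesis by (simp add: power_int_minus divide_inverse)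
next
  case False
  then obtain j where j: "p - 1 \<le> j" "j < q" "\<not> L < m j" by auto
  have "W m = 0" using entry_greater_bottom[OF _ j(1,2), of m] j(3) by auto
  moreover have "W (m(q := m q - 1)) = 0"
    using entry_greater_bottom[OF _ j(1,2), of "m(q := m q - 1)"] j by auto
  ultimately show ?thesis by simp
qed

lemma has_reg_sum_upper_row:
  "has_reg_sum (row_fibre r y W) (\<Sum>m\<in>bounded_rows (p - 1) q L H. tail_wt (1 / z) (L - m q) *
    (tail_wt z (m (p - 1) - H) * row_term t z {p..q} {p - 1..q} {p\<^sub>2..q\<^sub>2} l n m))"
proof -
  have "has_reg_sum (row_fibre r y W)
    (\<Sum>m\<in>bounded_rows (p - 1) q L H. tail_wt (1 / z) (L - m q) * (tail_wt z (m (p - 1) - H) * W m))"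
  proof (rule has_reg_sum_row_fibre[where W = W and p = "p - 1" and q = q, OF z LH])
    show "W (m(p - 1 := m (p - 1) + 1)) = z * W m" if "H \<le> m (p - 1)" for m by (rule W_raise_first[of m]) (rule that)
    show "W (m(q := m q - 1)) = 1 / z * W m" if "m q \<le> L" for m by (rule W_lower_last[of m]) (rule that)
    show "m j \<le> H" if "W m \<noteq> 0" "p - 1 < j" "j \<le> q" for m j using entry_less_top[OF that(1), of j] that(2,3) by simp
    show "L \<le> m j" if "W m \<noteq> 0" "p - 1 \<le> j" "j < q" for m j using entry_greater_bottom[OF that] by simp
    show "m j = 0" if "W m \<noteq> 0" "j \<notin> {p - 1..q}" for m j
      using that(1)[unfolded supported_row_term_def when_neq_zero] that(2) by blast
  qed
  then show ?thesis unfolding mult.assoc[symmetric] sum_supported_row_term .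
qed

end

lemma Sum_any_lower_row:
  fixes t z :: "'k::field"
  assumes n: "\<And>j. p\<^sub>2 \<le> j \<Longrightarrow> j \<le> q\<^sub>2 \<Longrightarrow> L < n j \<and> n j < H"
  shows "finite_support (row_fibre r y (supported_row_term t z A {p\<^sub>2 + 1..q\<^sub>2} {p\<^sub>2..q\<^sub>2} l n)) \<and>
    Sum_any (row_fibre r y (supported_row_term t z A {p\<^sub>2 + 1..q\<^sub>2} {p\<^sub>2..q\<^sub>2} l n)) =
      (\<Sum>m\<in>bounded_rows (p\<^sub>2 + 1) q\<^sub>2 L H. row_term t z A {p\<^sub>2 + 1..q\<^sub>2} {p\<^sub>2..q\<^sub>2} l n m)"
proof -
  let ?W = "supported_row_term t z A {p\<^sub>2 + 1..q\<^sub>2} {p\<^sub>2..q\<^sub>2} l n"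
  have "m \<in> bounded_rows (p\<^sub>2 + 1) q\<^sub>2 L H" if "?W m \<noteq> 0" for m
  proof -
    have m: "interlaced {p\<^sub>2 + 1..q\<^sub>2} {p\<^sub>2..q\<^sub>2} m n" "\<forall>j. j \<notin> {p\<^sub>2 + 1..q\<^sub>2} \<longrightarrow> m j = 0"
      using that by (auto simp: supported_row_term_def row_term_def intro: interlaced_of_pair_wt)
    have "L \<le> m j \<and> m j \<le> H" if j: "j \<in> {p\<^sub>2 + 1..q\<^sub>2}" for j
    proof -
      have "n j \<le> m j" using m(1) j by (auto simp: interlaced_def)
      moreover have "m (j - 1 + 1) \<le> n (j - 1)"
        using m(1)[unfolded interlaced_def, THEN conjunct2, THEN bspec, of "j - 1"] j by simp
      ultimately show ?thesis using n[of j] n[of "j - 1"] j by auto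
    qed
    then show ?thesis using m(2) by (simp add: bounded_rows_def)
  qed
  from finite_support_and_Sum_any_row_fibre[of ?W, OF this, of r y]
  show ?thesis using sum_supported_row_term[of "\<lambda>m. 1" t z A "p\<^sub>2 + 1" q\<^sub>2 "{p\<^sub>2..q\<^sub>2}" l n L H] by simp
qed

section \<open>Diagrams\<close>

text \<open>
  Rows may be empty, and an empty row \<open>n\<close> is added at the bottom, so that an enlarging step can be
  moved down to the very end.
\<close>

definition diagram :: "int \<Rightarrow> int \<Rightarrow> (int \<Rightarrow> int) \<Rightarrow> (int \<Rightarrow> int) \<Rightarrow> bool" where
  "diagram a n p q \<longleftrightarrow> a \<le> n \<and> (\<forall>i. a \<le> i \<and> i < n \<longrightarrow> steps (p i) (q i) (p (i + 1)) (q (i + 1))) \<and>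
    (\<forall>i. a \<le> i \<and> i \<le> n \<longrightarrow> p i \<le> q i + 1) \<and> p n = q n + 1"

definition cells :: "int \<Rightarrow> int \<Rightarrow> (int \<Rightarrow> int) \<Rightarrow> (int \<Rightarrow> int) \<Rightarrow> vertex set" where
  "cells a n p q = (SIGMA i:{a..n}. {p i..q i})"

definition admissible :: "int \<Rightarrow> int \<Rightarrow> (int \<Rightarrow> int) \<Rightarrow> (int \<Rightarrow> int) \<Rightarrow> (int \<Rightarrow> int) \<Rightarrow> (vertex \<Rightarrow>\<^sub>0 int) \<Rightarrow> bool" where
  "admissible a n p q \<beta> s \<longleftrightarrow> (\<forall>v. v \<notin> cells a n p q \<longrightarrow> lookup s v = 0) \<and> (\<forall>j\<in>{p a..q a}. lookup s (a, j) = \<beta> j)"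

definition layer_wt :: "'k::field \<Rightarrow> (int \<Rightarrow> int) \<Rightarrow> (int \<Rightarrow> int) \<Rightarrow> (vertex \<Rightarrow>\<^sub>0 int) \<Rightarrow> int \<Rightarrow> 'k" where
  "layer_wt t p q s i = pair_wt t {p i..q i} {p (i + 1)..q (i + 1)} (entries s i) (entries s (i + 1))"

definition diagram_wt :: "'k::field \<Rightarrow> int \<Rightarrow> int \<Rightarrow> (int \<Rightarrow> int) \<Rightarrow> (int \<Rightarrow> int) \<Rightarrow> (int \<Rightarrow> int) \<Rightarrow> (vertex \<Rightarrow>\<^sub>0 int) \<Rightarrow> 'k" where
  "diagram_wt t a n p q \<beta> s = ((\<Prod>i\<in>{a..<n}. layer_wt t p q s i) when admissible a n p q \<beta> s)"

definition row_monomial :: "(int \<Rightarrow> 'k::field) \<Rightarrow> int \<Rightarrow> int \<Rightarrow> (int \<Rightarrow> int) \<Rightarrow> (int \<Rightarrow> int) \<Rightarrow> (vertex \<Rightarrow>\<^sub>0 int) \<Rightarrow> 'k" where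
  "row_monomial x a n p q s = (\<Prod>i\<in>{a..n}. (x (i + 1) / x i) powi (\<Sum>j\<in>{p i..q i}. lookup s (i, j)))"

definition diagram_series ::
  "'k::field \<Rightarrow> (int \<Rightarrow> 'k) \<Rightarrow> int \<Rightarrow> int \<Rightarrow> (int \<Rightarrow> int) \<Rightarrow> (int \<Rightarrow> int) \<Rightarrow> (int \<Rightarrow> int) \<Rightarrow> (vertex \<Rightarrow>\<^sub>0 int) \<Rightarrow> 'k" where
  "diagram_series t x a n p q \<beta> s = diagram_wt t a n p q \<beta> s * row_monomial x a n p q s"

lemma finite_cells [simp]: "finite (cells a n p q)"
  by (simp add: cells_def)

lemma mem_cells: "(i, j) \<in> cells a n p q \<longleftrightarrow> a \<le> i \<and> i \<le> n \<and> p i \<le> j \<and> j \<le> q i"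
  by (auto simp: cells_def)

subsection \<open>Genericity\<close>

definition generic :: "'k::field \<Rightarrow> (int \<Rightarrow> 'k) \<Rightarrow> bool" where
  "generic t x \<longleftrightarrow> (\<forall>i. x i \<noteq> 0) \<and> (\<forall>i j. i \<noteq> j \<longrightarrow> x i \<noteq> t * x j) \<and>
    (\<forall>A e. finite A \<longrightarrow> (\<exists>i\<in>A. e i \<noteq> 0) \<longrightarrow> (\<Prod>i\<in>A. x i powi e i) \<noteq> 1)"

lemma generic_nonzero: "generic t x \<Longrightarrow> x i \<noteq> 0"
  by (simp add: generic_def)

lemma generic_prod_neq_1: "generic t x \<Longrightarrow> finite A \<Longrightarrow> \<exists>i\<in>A. e i \<noteq> 0 \<Longrightarrow> (\<Prod>i\<in>A. x i powi e i) \<noteq> 1"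
  unfolding generic_def by blast

lemma generic_compose_bij:
  assumes "generic t x" "bij \<sigma>"
  shows "generic t (x \<circ> \<sigma>)"
proof -
  have inj: "inj_on \<sigma> A" for A using assms(2) by (auto simp: bij_def intro: inj_on_subset)
  have "(\<Prod>i\<in>A. x (\<sigma> i) powi e i) \<noteq> 1" if "finite A" "\<exists>i\<in>A. e i \<noteq> 0" for A e
  proof -
    have inv: "inv \<sigma> (\<sigma> i) = i" for i using assms(2) by (simp add: bij_is_inj)
    have "(\<Prod>i\<in>A. x (\<sigma> i) powi e i) = (\<Prod>k\<in>\<sigma> ` A. x k powi e (inv \<sigma> k))"
      using inj by (simp add: prod.reindex inv)
    also have "\<dots> \<noteq> 1" using that by (intro generic_prod_neq_1[OF assms(1)]) (auto simp: inv)
    finally show ?thesis .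
  qed
  moreover have "x (\<sigma> i) \<noteq> t * x (\<sigma> j)" if "i \<noteq> j" for i j
    using that assms by (simp add: generic_def bij_is_inj inj_eq)
  ultimately show ?thesis using generic_nonzero[OF assms(1)] by (simp add: generic_def)
qed

lemma generic_ratio:
  assumes "generic t x"
  shows "x (r + 1) / x r \<noteq> 0" "x (r + 1) / x r \<noteq> 1" "x (r + 1) / x r \<noteq> t"
proof -
  note nonzero = generic_nonzero[OF assms]
  then show "x (r + 1) / x r \<noteq> 0" by simp
  have "x (r + 1) \<noteq> t * x r" using assms by (simp add: generic_def)
  then show "x (r + 1) / x r \<noteq> t" using nonzero by (simp add: divide_eq_eq)
  have "(\<Prod>i\<in>{r, r + 1}. x i powi (if i = r then -1 else 1)) \<noteq> 1"
    by (rule generic_prod_neq_1[OF assms]) auto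
  then show "x (r + 1) / x r \<noteq> 1" by (simp add: power_int_minus field_simps)
qed

lemma row_monomial_add:
  assumes "\<And>i. x i \<noteq> 0"
  shows "row_monomial x a n p q (s + s') = row_monomial x a n p q s * row_monomial x a n p q s'"
  unfolding row_monomial_def prod.distrib[symmetric]
  by (rule prod.cong) (auto simp: lookup_add sum.distrib power_int_add assms)

lemma prod_ratio_powi:
  fixes x :: "int \<Rightarrow> 'k::field" and u :: "int \<Rightarrow> int"
  assumes x: "\<And>i. x i \<noteq> 0" and u: "\<And>i. i \<notin> {a..n} \<Longrightarrow> u i = 0"
  shows "(\<Prod>i\<in>{a..n}. (x (i + 1) / x i) powi u i) = (\<Prod>i\<in>{a..n + 1}. x i powi (u (i - 1) - u i))"
proof -
  have "(\<Prod>i\<in>{a..n}. (x (i + 1) / x i) powi u i) = (\<Prod>i\<in>{a..n}. x (i + 1) powi u i) * (\<Prod>i\<in>{a..n}. x i powi (- u i))"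
    unfolding prod.distrib[symmetric] by (simp add: power_int_divide_distrib power_int_minus inverse_eq_divide)
  also have "(\<Prod>i\<in>{a..n}. x (i + 1) powi u i) = (\<Prod>i\<in>{a + 1..n + 1}. x i powi u (i - 1))"
    by (rule prod.reindex_bij_witness[where j = "\<lambda>i. i + 1" and i = "\<lambda>i. i - 1"]) auto
  also have "\<dots> = (\<Prod>i\<in>{a..n + 1}. x i powi u (i - 1))"
    by (rule prod.mono_neutral_left) (use u in auto)
  also have "(\<Prod>i\<in>{a..n}. x i powi (- u i)) = (\<Prod>i\<in>{a..n + 1}. x i powi (- u i))"
    by (rule prod.mono_neutral_left) (use u in auto)
  finally show ?thesis
    unfolding prod.distrib[symmetric] by (simp add: x flip: power_int_add)
qed

lemma row_monomial_neq_1: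
  assumes x: "generic t x" and s: "i \<in> {a..n}" "(\<Sum>j\<in>{p i..q i}. lookup s (i, j)) \<noteq> 0"
  shows "row_monomial x a n p q s \<noteq> 1"
proof -
  define u where "u i = ((\<Sum>j\<in>{p i..q i}. lookup s (i, j)) when i \<in> {a..n})" for i
  have "row_monomial x a n p q s = (\<Prod>i\<in>{a..n}. (x (i + 1) / x i) powi u i)"
    unfolding row_monomial_def u_def by (rule prod.cong) auto
  also have "\<dots> = (\<Prod>i\<in>{a..n + 1}. x i powi (u (i - 1) - u i))"
    by (rule prod_ratio_powi[OF generic_nonzero[OF x]]) (simp add: u_def)
  also have "\<dots> \<noteq> 1"
  proof (rule generic_prod_neq_1[OF x])
    show "\<exists>i\<in>{a..n + 1}. u (i - 1) - u i \<noteq> 0"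
    proof (rule ccontr)
      assume const: "\<not> (\<exists>i\<in>{a..n + 1}. u (i - 1) - u i \<noteq> 0)"
      have "a - 1 \<le> i" using s(1) by simp
      then have "i \<le> n \<longrightarrow> u i = 0"
      proof (induction i rule: int_ge_induct)
        case base
        then show ?case by (simp add: u_def)
      next
        case (step i)
        then show ?case using const by (auto dest!: bspec[of _ _ "i + 1"])
      qed
      then show False using s by (simp add: u_def)
    qed
  qed simp
  finally show ?thesis .
qed

lemma row_monomial_char_vec_neq_1:
  assumes x: "generic t x" and U: "U \<subseteq> cells a n p q" "U \<noteq> {}"
  shows "row_monomial x a n p q (char_vec U) \<noteq> 1"
proof -
  obtain i j where ij: "(i, j) \<in> U" using U(2) by auto
  then have cell: "i \<in> {a..n}" "j \<in> {p i..q i}" using U(1) by (auto simp: mem_cells)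
  have "finite U" using U(1) finite_cells by (rule finite_subset)
  then have "0 < (\<Sum>k\<in>{p i..q i}. lookup (char_vec U) (i, k))"
    using cell(2) ij by (intro sum_pos2[of _ j]) (auto simp: lookup_char_vec)
  then show ?thesis using cell(1) by (intro row_monomial_neq_1[OF x]) auto
qed

subsection \<open>Existence of the regularized sum\<close>

lemma diagram_wt_order_cong:
  assumes order: "\<And>u v. u \<in> cells a n p q \<Longrightarrow> v \<in> cells a n p q \<Longrightarrow> lookup s u \<le> lookup s v \<longleftrightarrow> lookup s' u \<le> lookup s' v"
    and outside: "\<And>v. v \<notin> cells a n p q \<Longrightarrow> lookup s v = lookup s' v"
    and top: "\<And>j. lookup s (a, j) = lookup s' (a, j)"
  shows "diagram_wt t a n p q \<beta> s = diagram_wt t a n p q \<beta> s'"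
proof -
  have "layer_wt t p q s i = layer_wt t p q s' i" if i: "i \<in> {a..<n}" for i
    unfolding layer_wt_def
  proof (rule pair_wt_order_cong)
    fix j k assume "j \<in> {p i..q i}" "k \<in> {p (i + 1)..q (i + 1)}"
    then show "(lookup s (i, j) \<le> lookup s (i + 1, k) \<longleftrightarrow> lookup s' (i, j) \<le> lookup s' (i + 1, k)) \<and>
      (lookup s (i + 1, k) \<le> lookup s (i, j) \<longleftrightarrow> lookup s' (i + 1, k) \<le> lookup s' (i, j))"
      using i by (intro conjI order) (auto simp: mem_cells)
  next
    fix j k assume "j \<in> {p (i + 1)..q (i + 1)}" "k \<in> {p (i + 1)..q (i + 1)}"
    then show "lookup s (i + 1, j) = lookup s (i + 1, k) \<longleftrightarrow> lookup s' (i + 1, j) = lookup s' (i + 1, k)"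
      using i order[of "(i + 1, j)" "(i + 1, k)"] order[of "(i + 1, k)" "(i + 1, j)"] by (auto simp: mem_cells)
  qed
  moreover have "admissible a n p q \<beta> s \<longleftrightarrow> admissible a n p q \<beta> s'"
    using outside top by (simp add: admissible_def)
  ultimately show ?thesis by (simp add: diagram_wt_def)
qed

lemma diagram_wt_add_char_vec:
  assumes U: "U \<subseteq> cells a n p q" "\<And>j. (a, j) \<notin> U"
    and separated: "separated (cells a n p q) U (lookup s) 1" "separated (cells a n p q) U (lookup (s + char_vec U)) 1"
  shows "diagram_wt t a n p q \<beta> (s + char_vec U) = diagram_wt t a n p q \<beta> s"
proof (rule diagram_wt_order_cong)
  have lookup: "lookup (s + char_vec U) v = lookup s v + of_bool (v \<in> U)" for v
    using finite_subset[OF U(1) finite_cells] by (simp add: lookup_add lookup_char_vec)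
  have cross: "(lookup s u + 1 \<le> lookup s v \<longleftrightarrow> lookup s u \<le> lookup s v) \<and>
      (lookup s v \<le> lookup s u + 1 \<longleftrightarrow> lookup s v \<le> lookup s u)" if "u \<in> U" "v \<in> cells a n p q - U" for u v
  proof -
    have "lookup s v + 1 \<le> lookup s u \<or> lookup s u + 1 \<le> lookup s v"
      using separated(1) that unfolding separated_def by blast
    moreover have "lookup s v + 1 \<le> lookup s u + 1 \<or> lookup s u + 1 + 1 \<le> lookup s v"
      using separated(2) that unfolding separated_def lookup by fastforce
    ultimately show ?thesis by linarith
  qed
  show "lookup (s + char_vec U) u \<le> lookup (s + char_vec U) v \<longleftrightarrow> lookup s u \<le> lookup s v"
    if "u \<in> cells a n p q" "v \<in> cells a n p q" for u v
    using cross[of u v] cross[of v u] that by (cases "u \<in> U"; cases "v \<in> U") (simp_all add: lookup)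
  show "lookup (s + char_vec U) v = lookup s v" if "v \<notin> cells a n p q" for v
    using U(1) that by (auto simp: lookup)
  show "lookup (s + char_vec U) (a, j) = lookup s (a, j)" for j using U(2)[of j] by (simp add: lookup)
qed

lemma finite_support_conv_of_diagram_wt:
  fixes g :: "(vertex \<Rightarrow>\<^sub>0 int) \<Rightarrow> 'c::comm_ring_1"
  assumes I: "I \<subseteq> cells a n p q" "\<And>j. (a, j) \<notin> I"
    and shift: "\<And>s U. U \<subseteq> I \<Longrightarrow> diagram_wt t a n p q \<beta> (s + char_vec U) = diagram_wt t a n p q \<beta> s \<Longrightarrow>
      g (s + char_vec U) = \<omega> U * g s"
    and supp: "\<And>s v. g s \<noteq> 0 \<Longrightarrow> v \<notin> I \<Longrightarrow> lookup s v = b v"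
  shows "finite_support (conv (subset_kernel (Pow I - {{}}) \<omega>) g)"
proof (rule finite_support_conv_subset_kernel[OF I(1) finite_cells _ supp])
  fix s U assume U: "U \<subseteq> I" and separated: "separated (cells a n p q) U (lookup s) 1"
    "separated (cells a n p q) U (lookup (s + char_vec U)) 1"
  have "diagram_wt t a n p q \<beta> (s + char_vec U) = diagram_wt t a n p q \<beta> s"
    by (rule diagram_wt_add_char_vec[OF _ _ separated]) (use U I in auto)
  then show "g (s + char_vec U) = \<omega> U * g s" by (rule shift[OF U])
qed

lemma diagram_series_add:
  assumes "generic t x" "diagram_wt t a n p q \<beta> (s + s') = diagram_wt t a n p q \<beta> s"
  shows "diagram_series t x a n p q \<beta> (s + s') = row_monomial x a n p q s' * diagram_series t x a n p q \<beta> s"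
  by (simp add: diagram_series_def assms(2) row_monomial_add[OF generic_nonzero[OF assms(1)]] mult_ac)

lemma mass_diagram_kernel_neq_0:
  assumes "generic t x" "I \<subseteq> cells a n p q"
  shows "mass (subset_kernel (Pow I - {{}}) (\<lambda>U. row_monomial x a n p q (char_vec U))) \<noteq> 0"
proof -
  have "row_monomial x a n p q (char_vec U) \<noteq> 1" if "U \<in> Pow I - {{}}" for U
    by (rule row_monomial_char_vec_neq_1[OF assms(1)]) (use that assms(2) in auto)
  moreover have "finite I" using assms(2) finite_cells by (rule finite_subset)
  ultimately show ?thesis by (simp add: mass_subset_kernel)
qed

lemma lookup_frozen_of_diagram_wt:
  assumes "diagram_wt t a n p q \<beta> s \<noteq> 0" "v \<notin> cells a n p q - {a} \<times> UNIV"
  shows "lookup s v = (\<beta> (snd v) when v \<in> cells a n p q)"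
proof -
  have "admissible a n p q \<beta> s" using assms(1) by (simp add: diagram_wt_def)
  then show ?thesis using assms(2) by (cases v) (auto simp: admissible_def mem_cells when_def)
qed

lemma has_reg_sum_diagram_series_exists:
  assumes x: "generic t x"
  shows "\<exists>s. has_reg_sum (diagram_series t x a n p q \<beta>) s"
proof (rule has_reg_sum_exists)
  let ?I = "cells a n p q - {a} \<times> UNIV"
  let ?K = "subset_kernel (Pow ?I - {{}}) (\<lambda>U. row_monomial x a n p q (char_vec U))"
  show "mass ?K \<noteq> 0" by (rule mass_diagram_kernel_neq_0[OF x]) auto
  show "finite_support (conv ?K (diagram_series t x a n p q \<beta>))"
  proof (rule finite_support_conv_of_diagram_wt)
    show "lookup s v = (\<beta> (snd v) when v \<in> cells a n p q)" if "diagram_series t x a n p q \<beta> s \<noteq> 0" "v \<notin> ?I" for s v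
      using that by (intro lookup_frozen_of_diagram_wt[of t]) (auto simp: diagram_series_def)
  qed (auto intro: diagram_series_add[OF x])
qed

lemma row_kernel:
  assumes x: "generic t x" and r: "a < r" "r \<le> n"
  obtains Q where "mass Q \<noteq> 0" "\<And>m. m \<in> keys Q \<Longrightarrow> off_row r m = 0"
    "\<And>y. finite_support (conv Q (slice r y (diagram_series t x a n p q \<beta>)))"
proof -
  let ?I = "{r} \<times> {p r..q r}"
  let ?K = "subset_kernel (Pow ?I - {{}}) (\<lambda>U. row_monomial x a n p q (char_vec U))"
  have I: "?I \<subseteq> cells a n p q" using r by (auto simp: mem_cells)
  show thesis
  proof (rule that)
    show "mass ?K \<noteq> 0" by (rule mass_diagram_kernel_neq_0[OF x I])
    show "off_row r m = 0" if m: "m \<in> keys ?K" for m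
      using keys_subset_kernel_outside[OF _ m] by (auto simp: poly_mapping_eq_iff fun_eq_iff lookup_off_row)
    show "finite_support (conv ?K (slice r y (diagram_series t x a n p q \<beta>)))" for y
    proof (rule finite_support_conv_of_diagram_wt[OF I])
      fix s U assume U: "U \<subseteq> ?I" and "diagram_wt t a n p q \<beta> (s + char_vec U) = diagram_wt t a n p q \<beta> s"
      moreover have "off_row r (s + char_vec U) = off_row r s"
        using U finite_subset[OF U] by (auto simp: off_row_eq_iff fun_eq_iff lookup_add lookup_char_vec)
      ultimately show "slice r y (diagram_series t x a n p q \<beta>) (s + char_vec U) =
        row_monomial x a n p q (char_vec U) * slice r y (diagram_series t x a n p q \<beta>) s"
        by (simp add: fibre_def diagram_series_add[OF x] mult_when)
    next
      fix s v assume s: "slice r y (diagram_series t x a n p q \<beta>) s \<noteq> 0" and v: "v \<notin> ?I"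
      then have "off_row r s = off_row r y" and admissible: "admissible a n p q \<beta> s"
        by (auto simp: fibre_def diagram_series_def diagram_wt_def)
      then have other_rows: "lookup s (i, j) = lookup y (i, j)" if "i \<noteq> r" for i j
        using that by (simp add: off_row_eq_iff fun_eq_iff)
      obtain i j where v_eq: "v = (i, j)" by fastforce
      show "lookup s v = (lookup y v when fst v \<noteq> r)"
        using v admissible by (cases "i = r") (auto simp: v_eq other_rows admissible_def mem_cells)
    qed (use r in auto)
  qed
qed

subsection \<open>Moving an enlarging step down\<close>

definition rest_wt ::
  "'k::field \<Rightarrow> (int \<Rightarrow> 'k) \<Rightarrow> int \<Rightarrow> int \<Rightarrow> (int \<Rightarrow> int) \<Rightarrow> (int \<Rightarrow> int) \<Rightarrow> (int \<Rightarrow> int) \<Rightarrow> int \<Rightarrow> (vertex \<Rightarrow>\<^sub>0 int) \<Rightarrow> 'k" where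
  "rest_wt t x a n p q \<beta> r y = ((\<Prod>i\<in>{a..<n} - {r - 1, r}. layer_wt t p q y i) *
    (\<Prod>i\<in>{a..n} - {r}. (x (i + 1) / x i) powi (\<Sum>j\<in>{p i..q i}. lookup y (i, j))) when admissible a n p q \<beta> (off_row r y))"

lemma admissible_off_row:
  assumes "a < r" "r \<le> n"
  shows "admissible a n p q \<beta> s \<longleftrightarrow>
    admissible a n p q \<beta> (off_row r s) \<and> (\<forall>j. j \<notin> {p r..q r} \<longrightarrow> lookup s (r, j) = 0)"
proof -
  have row: "(r, j) \<in> cells a n p q \<longleftrightarrow> j \<in> {p r..q r}" for j using assms by (simp add: mem_cells)
  have "(\<forall>v. v \<notin> cells a n p q \<longrightarrow> lookup s v = 0) \<longleftrightarrow>
    (\<forall>v. v \<notin> cells a n p q \<longrightarrow> lookup (off_row r s) v = 0) \<and> (\<forall>j. j \<notin> {p r..q r} \<longrightarrow> lookup s (r, j) = 0)"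
    unfolding row[symmetric] by (auto simp: lookup_off_row)
  then show ?thesis using assms by (auto simp: admissible_def lookup_off_row)
qed

lemma slice_diagram_series:
  assumes r: "a < r" "r < n"
  shows "slice r y (diagram_series t x a n p q \<beta>) =
    (\<lambda>s. rest_wt t x a n p q \<beta> r y * row_fibre r y (supported_row_term t (x (r + 1) / x r)
      {p (r - 1)..q (r - 1)} {p r..q r} {p (r + 1)..q (r + 1)} (entries y (r - 1)) (entries y (r + 1))) s)"
proof
  fix s
  let ?ratio = "\<lambda>s i. (x (i + 1) / x i) powi (\<Sum>j\<in>{p i..q i}. lookup s (i, j))"
  let ?W = "supported_row_term t (x (r + 1) / x r) {p (r - 1)..q (r - 1)} {p r..q r} {p (r + 1)..q (r + 1)}
    (entries y (r - 1)) (entries y (r + 1))"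
  show "slice r y (diagram_series t x a n p q \<beta>) s = rest_wt t x a n p q \<beta> r y * row_fibre r y ?W s"
  proof (cases "off_row r s = off_row r y")
    case True
    then have s: "lookup s (i, j) = lookup y (i, j)" if "i \<noteq> r" for i j
      using that by (simp add: off_row_eq_iff fun_eq_iff)
    have "(\<Prod>i\<in>{a..<n}. layer_wt t p q s i) =
      layer_wt t p q s (r - 1) * layer_wt t p q s r * (\<Prod>i\<in>{a..<n} - {r - 1, r}. layer_wt t p q s i)"
      using r by (subst prod.subset_diff[of "{r - 1, r}"]) (auto simp: mult.commute)
    also have "(\<Prod>i\<in>{a..<n} - {r - 1, r}. layer_wt t p q s i) = (\<Prod>i\<in>{a..<n} - {r - 1, r}. layer_wt t p q y i)"
      by (rule prod.cong) (auto simp: layer_wt_def s)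
    finally have layers: "(\<Prod>i\<in>{a..<n}. layer_wt t p q s i) =
      layer_wt t p q s (r - 1) * layer_wt t p q s r * (\<Prod>i\<in>{a..<n} - {r - 1, r}. layer_wt t p q y i)" .
    have "(\<Prod>i\<in>{a..n}. ?ratio s i) = ?ratio s r * (\<Prod>i\<in>{a..n} - {r}. ?ratio s i)"
      using r by (intro prod.remove) auto
    also have "(\<Prod>i\<in>{a..n} - {r}. ?ratio s i) = (\<Prod>i\<in>{a..n} - {r}. ?ratio y i)"
      by (rule prod.cong) (auto simp: s)
    finally have ratios: "(\<Prod>i\<in>{a..n}. ?ratio s i) = ?ratio s r * (\<Prod>i\<in>{a..n} - {r}. ?ratio y i)" .
    have row: "layer_wt t p q s (r - 1) * layer_wt t p q s r * ?ratio s r = row_term t (x (r + 1) / x r)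
        {p (r - 1)..q (r - 1)} {p r..q r} {p (r + 1)..q (r + 1)} (entries y (r - 1)) (entries y (r + 1)) (entries s r)"
      by (simp add: layer_wt_def row_term_def s)
    have "slice r y (diagram_series t x a n p q \<beta>) s =
      ((\<Prod>i\<in>{a..<n}. layer_wt t p q s i) * (\<Prod>i\<in>{a..n}. ?ratio s i)
        when admissible a n p q \<beta> (off_row r y) \<and> (\<forall>j. j \<notin> {p r..q r} \<longrightarrow> lookup s (r, j) = 0))"
      using True admissible_off_row[OF r(1) less_imp_le[OF r(2)], of p q \<beta> s]
      by (simp only: fibre_def diagram_series_def diagram_wt_def row_monomial_def when_mult when_simps refl)
    also have "(\<Prod>i\<in>{a..<n}. layer_wt t p q s i) * (\<Prod>i\<in>{a..n}. ?ratio s i) =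
      (\<Prod>i\<in>{a..<n} - {r - 1, r}. layer_wt t p q y i) * (\<Prod>i\<in>{a..n} - {r}. ?ratio y i) *
      (layer_wt t p q s (r - 1) * layer_wt t p q s r * ?ratio s r)"
      unfolding layers ratios by (simp only: mult_ac)
    finally show ?thesis
      unfolding row by (simp only: rest_wt_def row_fibre_def supported_row_term_def True when_simps
          mult_when when_mult when_when conj_commute simp_thms)
  qed (simp add: fibre_def row_fibre_def)
qed

lemma rest_wt_exchange:
  fixes x :: "int \<Rightarrow> 'k::field"
  assumes r: "a < r" "r < n" and x: "\<And>i. x i \<noteq> 0"
    and p: "\<And>i. i \<noteq> r \<Longrightarrow> p' i = p i" and q: "\<And>i. i \<noteq> r \<Longrightarrow> q' i = q i"
  shows "rest_wt t (x \<circ> Transposition.transpose r (r + 1)) a n p' q' \<beta> r y = rest_wt t x a n p q \<beta> r y *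
    (x (r + 1) / x r) powi
      ((\<Sum>j\<in>{p (r - 1)..q (r - 1)}. lookup y (r - 1, j)) + (\<Sum>j\<in>{p (r + 1)..q (r + 1)}. lookup y (r + 1, j)))"
proof -
  let ?x = "x \<circ> Transposition.transpose r (r + 1)" and ?z = "x (r + 1) / x r"
  let ?sum = "\<lambda>i. \<Sum>j\<in>{p i..q i}. lookup y (i, j)" and ?neighbour = "\<lambda>i. i = r - 1 \<or> i = r + 1"
  have "(i, j) \<in> cells a n p' q' \<longleftrightarrow> (i, j) \<in> cells a n p q" if "i \<noteq> r" for i j
    using that by (simp add: mem_cells p q)
  then have admissible: "admissible a n p' q' \<beta> (off_row r y) \<longleftrightarrow> admissible a n p q \<beta> (off_row r y)"
    using r by (auto simp: admissible_def lookup_off_row p q)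
  have layers: "(\<Prod>i\<in>{a..<n} - {r - 1, r}. layer_wt t p' q' y i) = (\<Prod>i\<in>{a..<n} - {r - 1, r}. layer_wt t p q y i)"
    by (rule prod.cong) (auto simp: layer_wt_def p q)
  have ratio: "?x (i + 1) / ?x i = x (i + 1) / x i * (if ?neighbour i then ?z else 1)" if "i \<noteq> r" for i
    using that x[of r] x[of "r + 1"] x[of i] by (auto simp: transpose_def)
  have "(\<Prod>i\<in>{a..n} - {r}. (?x (i + 1) / ?x i) powi (\<Sum>j\<in>{p' i..q' i}. lookup y (i, j))) =
    (\<Prod>i\<in>{a..n} - {r}. (x (i + 1) / x i) powi ?sum i * (if ?neighbour i then ?z powi ?sum i else 1))"
  proof (rule prod.cong[OF refl])
    fix i assume "i \<in> {a..n} - {r}"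
    then have "i \<noteq> r" by simp
    show "(?x (i + 1) / ?x i) powi (\<Sum>j\<in>{p' i..q' i}. lookup y (i, j)) =
      (x (i + 1) / x i) powi ?sum i * (if ?neighbour i then ?z powi ?sum i else 1)"
      unfolding ratio[OF \<open>i \<noteq> r\<close>] p[OF \<open>i \<noteq> r\<close>] q[OF \<open>i \<noteq> r\<close>] power_int_mult_distrib by simp
  qed
  also have "\<dots> = (\<Prod>i\<in>{a..n} - {r}. (x (i + 1) / x i) powi ?sum i) *
    (\<Prod>i\<in>{a..n} - {r}. if ?neighbour i then ?z powi ?sum i else 1)"
    by (rule prod.distrib)
  also have "(\<Prod>i\<in>{a..n} - {r}. if ?neighbour i then ?z powi ?sum i else 1) =
    (\<Prod>i\<in>{r - 1, r + 1}. if ?neighbour i then ?z powi ?sum i else 1)"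
    by (rule prod.mono_neutral_right) (use r in auto)
  also have "\<dots> = ?z powi (?sum (r - 1) + ?sum (r + 1))" using x by (simp add: power_int_add)
  finally show ?thesis by (simp add: rest_wt_def admissible layers mult.assoc when_mult)
qed

lemma exists_strict_bounds:
  fixes y :: "'v \<Rightarrow>\<^sub>0 int"
  obtains L H where "L < H" "\<And>v. L < lookup y v \<and> lookup y v < H"
proof -
  define H where "H = 1 + (\<Sum>v\<in>keys y. \<bar>lookup y v\<bar>)"
  have nonneg: "0 \<le> (\<Sum>v\<in>keys y. \<bar>lookup y v\<bar>)" by (intro sum_nonneg) auto
  have bound: "\<bar>lookup y v\<bar> < H" for v
  proof (cases "v \<in> keys y")
    case True
    then have "\<bar>lookup y v\<bar> \<le> (\<Sum>v\<in>keys y. \<bar>lookup y v\<bar>)" by (intro member_le_sum) auto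
    then show ?thesis by (simp add: H_def)
  qed (simp add: H_def in_keys_iff add_pos_nonneg nonneg)
  show thesis
  proof (rule that[of "- H" H])
    show "- H < H" using nonneg unfolding H_def by linarith
    show "- H < lookup y v \<and> lookup y v < H" for v using bound[of v] by (simp add: abs_less_iff)
  qed
qed

locale enlarging_row =
  fixes t :: "'k::field" and x :: "int \<Rightarrow> 'k" and a n :: int and p q :: "int \<Rightarrow> int" and r :: int
  assumes diagram: "diagram a n p q" and x: "generic t x" and r: "a < r" "r < n"
    and enlarging: "p r = p (r - 1) - 1" "q r = q (r - 1)"
begin

abbreviation "p' \<equiv> p(r := p (r + 1) + 1)"
abbreviation "q' \<equiv> q(r := q (r + 1))"
abbreviation "x' \<equiv> x \<circ> Transposition.transpose r (r + 1)"
abbreviation "exchanged_series \<equiv> diagram_series t x' a n p' q'"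

definition exchange_factor :: 'k where
  "exchange_factor = top_factor t (x (r + 1) / x r) (p (r - 1)) (p (r + 1)) /
    bottom_factor t (x (r + 1) / x r) (q (r - 1)) (q (r + 1))"

lemma neighbour_bounds:
  "p (r - 1) \<le> q (r - 1) + 1" "p (r + 1) \<le> q (r + 1) + 1"
  "p (r + 1) = p (r - 1) - 1 \<or> p (r + 1) = p (r - 1) - 2" "q (r + 1) = q (r - 1) \<or> q (r + 1) = q (r - 1) - 1"
proof -
  have "steps (p r) (q r) (p (r + 1)) (q (r + 1))" using diagram r by (simp add: diagram_def)
  then show "p (r + 1) = p (r - 1) - 1 \<or> p (r + 1) = p (r - 1) - 2" "q (r + 1) = q (r - 1) \<or> q (r + 1) = q (r - 1) - 1"
    using enlarging by (auto simp: steps_def)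
qed (use diagram r in \<open>simp_all add: diagram_def\<close>)

lemma has_reg_sum_between_empty_rows:
  assumes empty: "\<not> p (r + 1) \<le> q (r + 1)"
  shows "has_reg_sum (diagram_series t x a n p q \<beta>) 0"
proof (rule has_reg_sum_periodic)
  let ?v = "single (r, q r) 1 :: vertex \<Rightarrow>\<^sub>0 int"
  have shape: "{p (r - 1)..q (r - 1)} = {}" "{p r..q r} = {q r}" "{p (r + 1)..q (r + 1)} = {}"
    using neighbour_bounds enlarging empty by auto
  show "diagram_series t x a n p q \<beta> (s + ?v) = x (r + 1) / x r * diagram_series t x a n p q \<beta> s" for s
  proof -
    have lookup: "lookup (s + ?v) (i, j) = lookup s (i, j) + (1 when i = r \<and> j = q r)" for i j
      by (auto simp: lookup_add lookup_single when_def)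
    have "layer_wt t p q (s + ?v) i = layer_wt t p q s i" for i
      using shape by (cases "i = r"; cases "i = r - 1")
        (auto simp: layer_wt_def pair_wt_def interlaced_def lookup Collect_conv_if)
    moreover have "lookup (s + ?v) w = lookup s w" if "w \<notin> cells a n p q" for w
      using r shape(2) that by (cases w) (auto simp: lookup mem_cells when_def)
    then have "admissible a n p q \<beta> (s + ?v) \<longleftrightarrow> admissible a n p q \<beta> s"
      using r by (simp add: admissible_def lookup)
    ultimately have "diagram_wt t a n p q \<beta> (s + ?v) = diagram_wt t a n p q \<beta> s" by (simp add: diagram_wt_def)
    moreover have "row_monomial x a n p q ?v = (\<Prod>i\<in>{a..n}. if i = r then x (r + 1) / x r else 1)"
      unfolding row_monomial_def
    proof (rule prod.cong[OF refl])
      fix i show "(x (i + 1) / x i) powi (\<Sum>j\<in>{p i..q i}. lookup ?v (i, j)) = (if i = r then x (r + 1) / x r else 1)"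
        using shape(2) by (cases "i = r") (simp_all add: lookup_single)
    qed
    ultimately show ?thesis using r by (simp add: diagram_series_add[OF x] prod.delta)
  qed
qed (rule generic_ratio[OF x])

lemma exchange_slice:
  assumes nonempty: "p (r + 1) \<le> q (r + 1)"
  shows "finite_support (slice r y (exchanged_series \<beta>))"
    and "has_reg_sum (slice r y (diagram_series t x a n p q \<beta>)) (exchange_factor * Sum_any (slice r y (exchanged_series \<beta>)))"
proof -
  define z where "z = x (r + 1) / x r"
  have z: "z \<noteq> 0" "z \<noteq> 1" "z \<noteq> t" unfolding z_def by (rule generic_ratio[OF x])+
  obtain L H where y_bounds: "L < H" "\<And>v. L < lookup y v \<and> lookup y v < H" using exists_strict_bounds by blast
  let ?A = "{p (r - 1)..q (r - 1)}" and ?B = "{p (r + 1)..q (r + 1)}" and ?l = "entries y (r - 1)" and ?n = "entries y (r + 1)"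
  define e where "e = (\<Sum>j\<in>?A. ?l j) + (\<Sum>j\<in>?B. ?n j)"
  define R where "R = rest_wt t x a n p q \<beta> r y"
  let ?W = "supported_row_term t z ?A {p (r - 1) - 1..q (r - 1)} ?B ?l ?n"
    and ?W' = "supported_row_term t (1 / z) ?A {p (r + 1) + 1..q (r + 1)} ?B ?l ?n"
  have fibre: "slice r y (diagram_series t x a n p q \<beta>) = (\<lambda>s. R * row_fibre r y ?W s)"
    unfolding slice_diagram_series[OF r] R_def z_def enlarging ..
  have "rest_wt t x' a n p' q' \<beta> r y = R * z powi e"
    unfolding R_def z_def e_def by (rule rest_wt_exchange[OF r generic_nonzero[OF x]]) auto
  then have fibre': "slice r y (exchanged_series \<beta>) = (\<lambda>s. R * z powi e * row_fibre r y ?W' s)"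
    unfolding slice_diagram_series[OF r] by (simp add: z_def)
  let ?sum' = "\<Sum>m\<in>bounded_rows (p (r + 1) + 1) (q (r + 1)) L H. row_term t (1 / z) ?A {p (r + 1) + 1..q (r + 1)} ?B ?l ?n m"
  have lower: "finite_support (row_fibre r y ?W')" "Sum_any (row_fibre r y ?W') = ?sum'"
    using Sum_any_lower_row[of "p (r + 1)" "q (r + 1)" L ?n H r y t "1 / z" ?A ?l] y_bounds(2) by auto
  then show "finite_support (slice r y (exchanged_series \<beta>))"
    unfolding fibre' by (intro finite_support_scale)
  have sum': "Sum_any (slice r y (exchanged_series \<beta>)) = R * (z powi e * ?sum')"
    unfolding fibre' Sum_any_scale[OF lower(1)] lower(2) by (rule mult.assoc)
  interpret row: upper_row t z "p (r - 1)" "q (r - 1)" "p (r + 1)" "q (r + 1)" L H ?l ?n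
    by unfold_locales (use z neighbour_bounds y_bounds in auto)
  define sum where "sum = (\<Sum>m\<in>bounded_rows (p (r - 1) - 1) (q (r - 1)) L H. tail_wt (1 / z) (L - m (q (r - 1))) *
    (tail_wt z (m (p (r - 1) - 1) - H) * row_term t z ?A {p (r - 1) - 1..q (r - 1)} ?B ?l ?n m))"
  have upper: "has_reg_sum (row_fibre r y ?W) sum" unfolding sum_def by (rule row.has_reg_sum_upper_row)
  have "bottom_factor t z (q (r - 1)) (q (r + 1)) * sum = top_factor t z (p (r - 1)) (p (r + 1)) * (z powi e * ?sum')"
    unfolding sum_def e_def
    by (rule row_exchange[OF z(1,2) y_bounds(1) neighbour_bounds(1) nonempty neighbour_bounds(3,4)]) (use y_bounds(2) in auto)
  moreover have "bottom_factor t z (q (r - 1)) (q (r + 1)) \<noteq> 0" using z by (simp add: bottom_factor_def)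
  ultimately have "sum = exchange_factor * (z powi e * ?sum')"
    by (simp add: exchange_factor_def divide_simps mult.commute flip: z_def)
  then show "has_reg_sum (slice r y (diagram_series t x a n p q \<beta>)) (exchange_factor * Sum_any (slice r y (exchanged_series \<beta>)))"
    using has_reg_sum_scale[OF upper, of R] unfolding fibre sum' by (simp add: mult.left_commute)
qed

lemma diagram_exchange:
  assumes nonempty: "p (r + 1) \<le> q (r + 1)"
  shows "diagram a n p' q'"
proof -
  have "steps (p' i) (q' i) (p' (i + 1)) (q' (i + 1))" if "a \<le> i" "i < n" for i
  proof -
    have "steps (p i) (q i) (p (i + 1)) (q (i + 1))" using diagram that by (simp add: diagram_def)
    then show ?thesis using neighbour_bounds by (cases "i = r"; cases "i = r - 1") (auto simp: steps_def)
  qed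
  then show ?thesis using diagram nonempty r by (auto simp: diagram_def)
qed

lemma has_reg_sum_exchange:
  assumes nonempty: "p (r + 1) \<le> q (r + 1)"
    and exchanged: "has_reg_sum (exchanged_series \<beta>) 0"
  shows "has_reg_sum (diagram_series t x a n p q \<beta>) 0"
proof -
  obtain s where s: "has_reg_sum (diagram_series t x a n p q \<beta>) s" using has_reg_sum_diagram_series_exists[OF x] by blast
  obtain Q where Q: "mass Q \<noteq> 0" "\<And>m. m \<in> keys Q \<Longrightarrow> off_row r m = 0"
    "\<And>y. finite_support (conv Q (slice r y (diagram_series t x a n p q \<beta>)))"
    using row_kernel[OF x r(1) less_imp_le[OF r(2)]] by blast
  have scaled: "slice r y (\<lambda>s. exchange_factor * exchanged_series \<beta> s) =
    (\<lambda>s. exchange_factor * slice r y (exchanged_series \<beta>) s)" for y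
    by (simp add: fibre_def fun_eq_iff mult_when)
  have "s = exchange_factor * 0"
  proof (rule has_reg_sum_eq_fibrewise[OF off_row_diff s has_reg_sum_scale[OF exchanged] Q])
    show "finite_support (slice r y (\<lambda>s. exchange_factor * exchanged_series \<beta> s))" for y
      unfolding scaled by (rule finite_support_scale[OF exchange_slice(1)[OF nonempty]])
    show "has_reg_sum (slice r y (diagram_series t x a n p q \<beta>))
        (Sum_any (slice r y (\<lambda>s. exchange_factor * exchanged_series \<beta> s)))" for y
      unfolding scaled Sum_any_scale[OF exchange_slice(1)[OF nonempty]] by (rule exchange_slice(2)[OF nonempty])
  qed
  then show ?thesis using s by simp
qed

end

theorem has_reg_sum_diagram_series_0:
  assumes "enlarging_row t x a n p q r"
  shows "has_reg_sum (diagram_series t x a n p q \<beta>) 0"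
  using assms
proof (induction "nat (n - r)" arbitrary: r x p q rule: less_induct)
  case less
  interpret enlarging_row t x a n p q r by (rule less.prems)
  show ?case
  proof (cases "p (r + 1) \<le> q (r + 1)")
    case False
    then show ?thesis by (rule has_reg_sum_between_empty_rows)
  next
    case True
    have r': "r + 1 < n" using True diagram r by (cases "r + 1 = n") (auto simp: diagram_def)
    have "enlarging_row t x' a n p' q' (r + 1)"
      using r r' by unfold_locales (simp_all add: diagram_exchange[OF True] generic_compose_bij[OF x])
    then show ?thesis using r' by (intro has_reg_sum_exchange[OF True] less.hyps) auto
  qed
qed

section \<open>The specialization of weighted integer point transforms\<close>

lemma lookup_eq_conv: "lookup p = conv p (lookup 1)"
  by (induction p rule: poly_mapping_additive_induct)
    (auto simp: fun_eq_iff conv_add lookup_add lookup_single lookup_one when_def)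

lemma lookup_mult_eq_conv: "lookup (Q * p) = conv Q (lookup p)"
  unfolding lookup_eq_conv[of "Q * p"] lookup_eq_conv[of p] by (rule conv_mult)

lemma laurent_times_series_eq_conv: "laurent_times_series Q S = conv Q S"
  by (simp add: laurent_times_series_def conv_def fun_eq_iff)

lemma weighted_ipt_eq:
  assumes "Q \<noteq> 0" "conv Q (weighted_series \<phi> P) = lookup p"
  shows "weighted_ipt \<phi> P = Fract p Q"
  unfolding weighted_ipt_def laurent_times_series_eq_conv
proof (rule the_equality)
  show "\<exists>Q' p'. Q' \<noteq> 0 \<and> conv Q' (weighted_series \<phi> P) = lookup p' \<and> Fract p Q = Fract p' Q'"
    by (intro exI[of _ Q] exI[of _ p]) (use assms in simp)
  fix y assume "\<exists>Q' p'. Q' \<noteq> 0 \<and> conv Q' (weighted_series \<phi> P) = lookup p' \<and> y = Fract p' Q'"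
  then obtain Q' p' where Q': "Q' \<noteq> 0" "conv Q' (weighted_series \<phi> P) = lookup p'" "y = Fract p' Q'" by blast
  have "lookup (Q * p') = lookup (Q' * p)"
    unfolding lookup_mult_eq_conv Q'(2)[symmetric] assms(2)[symmetric] by (rule conv_commute)
  then have "p' * Q = p * Q'" by (simp only: poly_mapping_eq_iff mult.commute)
  then show "y = Fract p Q" unfolding Q'(3) using Q'(1) assms(1) by (simp add: eq_fract)
qed

lemma F_exponent_0 [simp]: "F_exponent 0 = 0"
  by (simp add: F_exponent_def)

lemma F_exponent_add: "F_exponent (a + b) = F_exponent a + F_exponent b"
  unfolding F_exponent_def case_prod_unfold prod.collapse
  by (rule setsum_keys_plus_distrib) (simp_all add: single_add)

lemma F_exponent_superset:
  assumes "finite A" "keys a \<subseteq> A"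
  shows "F_exponent a = (\<Sum>(i, j)\<in>A. single (i + 1) (lookup a (i, j)) - single i (lookup a (i, j)))"
  unfolding F_exponent_def using assms by (intro sum.mono_neutral_left) (auto simp: in_keys_iff)

lemma F_laurent_0 [simp]: "F_laurent 0 = 0"
  by (simp add: F_laurent_def)

lemma F_laurent_single [simp]: "F_laurent (single a c) = single (F_exponent a) c"
  by (simp add: F_laurent_def)

lemma F_laurent_1 [simp]: "F_laurent 1 = 1"
  using F_laurent_single[of 0 1] by (simp del: F_laurent_single)

lemma F_laurent_add: "F_laurent (p + p') = F_laurent p + F_laurent p'"
  unfolding F_laurent_def by (rule setsum_keys_plus_distrib) (simp_all add: single_add)

lemma F_laurent_diff: "F_laurent (p - p') = F_laurent p - F_laurent p'"
  using F_laurent_add[of "p - p'" p'] by (simp add: algebra_simps)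

lemma F_laurent_mult: "F_laurent (p * p') = F_laurent p * F_laurent p'"
proof (induction p rule: poly_mapping_additive_induct)
  case (single m k)
  show ?case
    by (induction p' rule: poly_mapping_additive_induct)
      (simp_all add: mult_single F_exponent_add F_laurent_add distrib_left)
qed (simp_all add: F_laurent_add distrib_right)

lemma F_laurent_prod: "F_laurent (\<Prod>i\<in>A. f i) = (\<Prod>i\<in>A. F_laurent (f i))"
  by (induction A rule: infinite_finite_induct) (simp_all add: F_laurent_mult)

lemma single_1_inject: "single e (1::'b::zero_neq_one) = single e' 1 \<longleftrightarrow> e = e'"
  by (metis keys_single singleton_inject zero_neq_one)

lemma F_laurent_subset_kernel_neq_0:
  assumes "finite A" "\<And>U. U \<in> A \<Longrightarrow> F_exponent (char_vec U) \<noteq> 0"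
  shows "F_laurent (subset_kernel A (\<lambda>_. 1)) \<noteq> 0"
proof -
  have "F_laurent (1 - single (char_vec U) 1) \<noteq> 0" if "U \<in> A" for U
    using assms(2)[OF that] single_1_inject[of "F_exponent (char_vec U)" 0] by (simp add: F_laurent_diff)
  then show ?thesis using assms(1) by (simp add: subset_kernel_def F_laurent_prod)
qed

lemma F_spec_Fract:
  assumes "F_laurent q \<noteq> 0"
  shows "F_spec (Fract p q) = Fract (F_laurent p) (F_laurent q)"
  unfolding F_spec_def
proof (rule the_equality)
  show "\<exists>p' q'. F_laurent q' \<noteq> 0 \<and> Fract p q = Fract p' q' \<and>
      Fract (F_laurent p) (F_laurent q) = Fract (F_laurent p') (F_laurent q')"
    by (intro exI[of _ p] exI[of _ q]) (use assms in simp)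
  fix y assume "\<exists>p' q'. F_laurent q' \<noteq> 0 \<and> Fract p q = Fract p' q' \<and> y = Fract (F_laurent p') (F_laurent q')"
  then obtain p' q' where frac: "F_laurent q' \<noteq> 0" "Fract p q = Fract p' q'" "y = Fract (F_laurent p') (F_laurent q')" by blast
  have "q \<noteq> 0" "q' \<noteq> 0" using assms frac(1) by auto
  then have "p * q' = p' * q" using frac(2) by (simp add: eq_fract)
  then have "F_laurent p * F_laurent q' = F_laurent p' * F_laurent q" by (metis F_laurent_mult)
  then show "y = Fract (F_laurent p) (F_laurent q)" using frac assms by (simp add: eq_fract)
qed

type_synonym rat_fun = "int laurent fract"

definition specialize :: "vertex series \<Rightarrow> (vertex \<Rightarrow>\<^sub>0 int) \<Rightarrow> rat_fun" where
  "specialize S s = to_fract (single (F_exponent s) (S s))"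

lemma specialize_eq_0_iff: "specialize S s = 0 \<longleftrightarrow> S s = 0"
  by (metis specialize_def to_fract_eq_0_iff keys_single keys_zero empty_not_insert single_zero)

lemma single_sum: "single k (\<Sum>i\<in>A. f i) = (\<Sum>i\<in>A. single k (f i))"
  by (induction A rule: infinite_finite_induct) (simp_all add: single_add)

lemma to_fract_sum: "to_fract (\<Sum>i\<in>A. f i) = (\<Sum>i\<in>A. to_fract (f i))"
  by (induction A rule: infinite_finite_induct) simp_all

lemma Sum_any_specialize: "Sum_any (specialize (lookup p)) = to_fract (F_laurent p)"
proof -
  have "Sum_any (specialize (lookup p)) = (\<Sum>s\<in>keys p. specialize (lookup p) s)"
    by (rule Sum_any.expand_superset) (auto simp: specialize_eq_0_iff in_keys_iff)
  then show ?thesis by (simp add: specialize_def F_laurent_def to_fract_sum)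
qed

definition specialize_kernel :: "vertex laurent \<Rightarrow> (vertex \<Rightarrow>\<^sub>0 int) \<Rightarrow>\<^sub>0 rat_fun" where
  "specialize_kernel Q = Poly_Mapping.mapp (\<lambda>m c. to_fract (single (F_exponent m) c)) Q"

lemma lookup_specialize_kernel: "lookup (specialize_kernel Q) = specialize (lookup Q)"
  by (auto simp: fun_eq_iff specialize_kernel_def lookup_mapp specialize_def when_def in_keys_iff)

lemma keys_specialize_kernel: "keys (specialize_kernel Q) = keys Q"
  by (simp add: set_eq_iff in_keys_iff lookup_specialize_kernel specialize_eq_0_iff)

lemma mass_specialize_kernel: "mass (specialize_kernel Q) = to_fract (F_laurent Q)"
  by (simp add: mass_def keys_specialize_kernel lookup_specialize_kernel specialize_def F_laurent_def to_fract_sum)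

lemma conv_specialize_kernel: "conv (specialize_kernel Q) (specialize S) = specialize (conv Q S)"
proof
  fix y
  have "specialize (lookup Q) m * specialize S (y - m) = to_fract (single (F_exponent y) (lookup Q m * S (y - m)))" for m
    unfolding specialize_def by (simp add: mult_single flip: to_fract_mult F_exponent_add)
  then have "conv (specialize_kernel Q) (specialize S) y =
    (\<Sum>m\<in>keys Q. to_fract (single (F_exponent y) (lookup Q m * S (y - m))))"
    by (simp add: conv_def keys_specialize_kernel lookup_specialize_kernel)
  also have "\<dots> = specialize (conv Q S) y"
    by (simp add: conv_def specialize_def single_sum to_fract_sum)
  finally show "conv (specialize_kernel Q) (specialize S) y = specialize (conv Q S) y" .
qed

lemma F_spec_weighted_ipt_eq:
  assumes Q: "F_laurent Q \<noteq> 0" "finite_support (conv Q (weighted_series \<phi> P))"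
    and reg_sum: "has_reg_sum (specialize (weighted_series \<phi> P)) s"
  shows "F_spec (weighted_ipt \<phi> P) = s"
proof -
  obtain p where p: "lookup p = conv Q (weighted_series \<phi> P)"
    using lookup_Abs_poly_mapping Q(2) unfolding finite_support_def by metis
  have "conv (specialize_kernel Q) (specialize (weighted_series \<phi> P)) = specialize (lookup p)"
    by (simp add: conv_specialize_kernel p)
  moreover have "finite_support (specialize (lookup p))"
    by (simp add: finite_support_def specialize_eq_0_iff)
  ultimately have "to_fract (F_laurent p) = s * to_fract (F_laurent Q)"
    using has_reg_sum_kernel[OF reg_sum, of "specialize_kernel Q"] by (simp add: Sum_any_specialize mass_specialize_kernel)
  moreover have "Q \<noteq> 0" using Q(1) by auto
  then have "F_spec (weighted_ipt \<phi> P) = to_fract (F_laurent p) / to_fract (F_laurent Q)"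
    by (simp add: weighted_ipt_eq[OF _ p[symmetric]] F_spec_Fract[OF Q(1)] to_fract_def)
  ultimately show ?thesis using Q(1) by simp
qed

definition coef_fract :: "int poly \<Rightarrow> rat_fun" where
  "coef_fract c = to_fract (single 0 c)"

definition monom_fract :: "(int \<Rightarrow>\<^sub>0 int) \<Rightarrow> rat_fun" where
  "monom_fract e = to_fract (single e 1)"

definition xvar :: "int \<Rightarrow> rat_fun" where
  "xvar i = monom_fract (single i 1)"

definition tvar :: rat_fun where
  "tvar = coef_fract (monom 1 1)"

lemma specialize_eq: "specialize S s = coef_fract (S s) * monom_fract (F_exponent s)"
  by (simp add: specialize_def coef_fract_def monom_fract_def mult_single flip: to_fract_mult)

lemma coef_fract_0 [simp]: "coef_fract 0 = 0" and coef_fract_1 [simp]: "coef_fract 1 = 1"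
  by (simp_all add: coef_fract_def)

lemma coef_fract_mult: "coef_fract (c * d) = coef_fract c * coef_fract d"
  by (simp add: coef_fract_def mult_single flip: to_fract_mult)

lemma coef_fract_diff: "coef_fract (c - d) = coef_fract c - coef_fract d"
  by (simp add: coef_fract_def single_diff)

lemma coef_fract_inject: "coef_fract c = coef_fract d \<longleftrightarrow> c = d"
  by (simp add: coef_fract_def inj_eq[OF inj_single])

lemma coef_fract_prod: "coef_fract (\<Prod>i\<in>A. f i) = (\<Prod>i\<in>A. coef_fract (f i))"
  by (induction A rule: infinite_finite_induct) (simp_all add: coef_fract_mult)

lemma coef_fract_monom: "coef_fract (monom 1 l) = tvar ^ l"
proof (induction l)
  case (Suc l)
  have "monom (1::int) (Suc l) = monom 1 1 * monom 1 l" by (simp add: mult_monom)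
  then show ?case using Suc by (simp only: coef_fract_mult tvar_def power_Suc)
qed (simp add: monom_0 pCons_one)

lemma monom_fract_0 [simp]: "monom_fract 0 = 1"
  by (simp add: monom_fract_def)

lemma monom_fract_add: "monom_fract (e + e') = monom_fract e * monom_fract e'"
  by (simp add: monom_fract_def mult_single flip: to_fract_mult)

lemma monom_fract_eq_1_iff: "monom_fract e = 1 \<longleftrightarrow> e = 0"
  using single_1_inject[of e 0] by (simp add: monom_fract_def flip: to_fract_1)

lemma monom_fract_neq_0 [simp]: "monom_fract e \<noteq> 0"
  using monom_fract_add[of e "- e"] by auto

lemma monom_fract_diff: "monom_fract (e - e') = monom_fract e / monom_fract e'"
  using monom_fract_add[of "e - e'" e'] by (simp add: field_simps)

lemma monom_fract_sum: "monom_fract (\<Sum>i\<in>A. f i) = (\<Prod>i\<in>A. monom_fract (f i))"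
  by (induction A rule: infinite_finite_induct) (simp_all add: monom_fract_add)

lemma xvar_neq_0 [simp]: "xvar i \<noteq> 0"
  by (simp add: xvar_def)

lemma xvar_powi: "xvar i powi k = monom_fract (single i k)"
proof (induction k rule: int_induct[of _ 0])
  case (step1 k)
  then show ?case by (simp add: power_int_add_1 single_add monom_fract_add xvar_def)
next
  case (step2 k)
  then show ?case by (simp add: power_int_diff single_diff monom_fract_diff xvar_def)
qed simp

lemma generic_xvar: "generic tvar xvar"
  unfolding generic_def
proof (intro conjI allI impI)
  show "xvar i \<noteq> tvar * xvar j" if "i \<noteq> j" for i j
  proof
    assume "xvar i = tvar * xvar j"
    then have "single (single i 1) 1 = (single (single j 1) (monom 1 1) :: int laurent)"
      by (simp add: xvar_def tvar_def monom_fract_def coef_fract_def mult_single flip: to_fract_mult)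
    then have "(single i 1 :: int \<Rightarrow>\<^sub>0 int) = single j 1"
      by (metis keys_single singleton_inject zero_neq_one monom_eq_0_iff)
    then show False using that by (simp add: single_1_inject)
  qed
  show "(\<Prod>i\<in>A. xvar i powi e i) \<noteq> 1" if A: "finite A" "\<exists>i\<in>A. e i \<noteq> 0" for A :: "int set" and e
  proof -
    obtain k where k: "k \<in> A" "e k \<noteq> 0" using A by auto
    have "lookup (\<Sum>i\<in>A. single i (e i)) k = e k"
      using A(1) k(1) by (simp add: lookup_sum lookup_single when_def)
    then have "(\<Sum>i\<in>A. single i (e i)) \<noteq> 0" using k(2) by auto
    then show ?thesis by (simp add: xvar_powi monom_fract_eq_1_iff flip: monom_fract_sum)
  qed
qed simp

lemma monom_fract_F_exponent:
  assumes "\<And>v. v \<notin> cells a n p q \<Longrightarrow> lookup s v = 0"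
  shows "monom_fract (F_exponent s) = row_monomial xvar a n p q s"
proof -
  have "F_exponent s = (\<Sum>(i, j)\<in>cells a n p q. single (i + 1) (lookup s (i, j)) - single i (lookup s (i, j)))"
    by (rule F_exponent_superset) (use assms in \<open>auto simp: in_keys_iff\<close>)
  then have "monom_fract (F_exponent s) = (\<Prod>(i, j)\<in>cells a n p q. (xvar (i + 1) / xvar i) powi lookup s (i, j))"
    by (simp add: monom_fract_sum monom_fract_diff case_prod_unfold power_int_divide_distrib xvar_powi)
  also have "\<dots> = row_monomial xvar a n p q s"
    unfolding row_monomial_def cells_def by (simp add: prod_power_int flip: prod.Sigma)
  finally show ?thesis .
qed

lemma F_exponent_char_vec_neq_0:
  assumes "U \<subseteq> cells a n p q" "U \<noteq> {}"
  shows "F_exponent (char_vec U) \<noteq> 0"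
proof -
  have "finite U" using assms(1) finite_cells by (rule finite_subset)
  then have "monom_fract (F_exponent (char_vec U)) = row_monomial xvar a n p q (char_vec U)"
    using assms(1) by (intro monom_fract_F_exponent) (auto simp: lookup_char_vec)
  also have "\<dots> \<noteq> 1" by (rule row_monomial_char_vec_neq_1[OF generic_xvar assms])
  finally show ?thesis by (simp add: monom_fract_eq_1_iff)
qed

lemma F_spec_weighted_ipt_eq_diagram_reg_sum:
  assumes series: "\<And>s. coef_fract (weighted_series \<phi> P s) = diagram_wt tvar a n p q \<beta> s"
    and reg_sum: "has_reg_sum (diagram_series tvar xvar a n p q \<beta>) y"
  shows "F_spec (weighted_ipt \<phi> P) = y"
proof (rule F_spec_weighted_ipt_eq)
  let ?S = "weighted_series \<phi> P" and ?I = "cells a n p q - {a} \<times> UNIV"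
  let ?Q = "subset_kernel (Pow ?I - {{}}) (\<lambda>_. 1) :: vertex laurent"
  show "F_laurent ?Q \<noteq> 0"
  proof (rule F_laurent_subset_kernel_neq_0)
    show "F_exponent (char_vec U) \<noteq> 0" if "U \<in> Pow ?I - {{}}" for U
      by (rule F_exponent_char_vec_neq_0[of U a n p q]) (use that in auto)
  qed simp
  show "finite_support (conv ?Q ?S)"
  proof (rule finite_support_conv_of_diagram_wt)
    show "?S (s + char_vec U) = 1 * ?S s"
      if "diagram_wt tvar a n p q \<beta> (s + char_vec U) = diagram_wt tvar a n p q \<beta> s" for s U
      using that unfolding series[symmetric] coef_fract_inject by simp
    show "lookup s v = (\<beta> (snd v) when v \<in> cells a n p q)" if "?S s \<noteq> 0" "v \<notin> ?I" for s v
      by (rule lookup_frozen_of_diagram_wt[of tvar]) (use that series[of s] coef_fract_inject[of "?S s" 0] in auto)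
  qed auto
  have "specialize ?S s = diagram_series tvar xvar a n p q \<beta> s" for s
  proof (cases "diagram_wt tvar a n p q \<beta> s = 0")
    case False
    then have "lookup s v = 0" if "v \<notin> cells a n p q" for v
      using that lookup_frozen_of_diagram_wt[OF False, of v] by auto
    then have "monom_fract (F_exponent s) = row_monomial xvar a n p q s" by (rule monom_fract_F_exponent)
    then show ?thesis by (simp add: specialize_eq diagram_series_def series)
  qed (simp add: specialize_eq diagram_series_def series)
  then show "has_reg_sum (specialize ?S) y" using reg_sum by presburger
qed

section \<open>Ordinary subgraphs\<close>

text \<open>
  In an ordinary subgraph a step down, a move within a run of consecutive vertices, and a step up
  stay within a run, and so do the reversed steps. Hence paths can be made monotone, and two
  vertices of the same row lie in the same run.
\<close>

lemma zigzag_step: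
  assumes refl: "\<And>x y. (x, y) \<in> E \<Longrightarrow> (x, x) \<in> \<rho> \<and> (y, y) \<in> \<rho>" and "trans \<rho>" and zigzag: "E O \<rho> O E\<inverse> \<subseteq> \<rho>"
    and path: "(u, v) \<in> \<rho> O (E O \<rho>)\<^sup>*" and step: "(v, w) \<in> E \<union> E\<inverse>"
  shows "(u, w) \<in> \<rho> O (E O \<rho>)\<^sup>* \<union> \<rho> O (E\<inverse> O \<rho>)\<^sup>*"
proof (cases "(v, w) \<in> E")
  case True
  then have "(v, w) \<in> E O \<rho>" using refl by blast
  then show ?thesis using path by (blast intro: rtrancl_into_rtrancl)
next
  case False
  then have reverse: "(w, v) \<in> E" using step by blast
  obtain y where y: "(u, y) \<in> \<rho>" "(y, v) \<in> (E O \<rho>)\<^sup>*" using path by blast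
  from y(2) show ?thesis
  proof (cases rule: rtranclE)
    case base
    have "(v, w) \<in> E\<inverse> O \<rho>" using reverse refl by blast
    then show ?thesis using y(1) base by blast
  next
    case (step x)
    then have x: "(x, w) \<in> \<rho>" using zigzag reverse by blast
    from step(1) have "(u, w) \<in> \<rho> O (E O \<rho>)\<^sup>*"
    proof (cases rule: rtranclE)
      case base
      then show ?thesis using y(1) x \<open>trans \<rho>\<close> by (blast dest: transD)
    next
      case (step x')
      then have "(x', w) \<in> E O \<rho>" using x \<open>trans \<rho>\<close> by (blast dest: transD)
      then show ?thesis using y(1) step(1) by (blast intro: rtrancl_into_rtrancl)
    qed
    then show ?thesis by blast
  qed
qed

lemma zigzag_normal_form:
  assumes refl: "\<And>x y. (x, y) \<in> E \<Longrightarrow> (x, x) \<in> \<rho> \<and> (y, y) \<in> \<rho>" and trans: "trans \<rho>"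
    and zigzag: "E O \<rho> O E\<inverse> \<subseteq> \<rho>" "E\<inverse> O \<rho> O E \<subseteq> \<rho>"
    and path: "(u, v) \<in> (E \<union> E\<inverse>)\<^sup>*" and u: "(u, u) \<in> \<rho>"
  shows "(u, v) \<in> \<rho> O (E O \<rho>)\<^sup>* \<union> \<rho> O (E\<inverse> O \<rho>)\<^sup>*"
  using path
proof (induction rule: rtrancl_induct)
  case base
  show ?case using u by blast
next
  case (step v w)
  have refl': "(x, y) \<in> E\<inverse> \<Longrightarrow> (x, x) \<in> \<rho> \<and> (y, y) \<in> \<rho>" for x y using refl[of y x] by blast
  from step.IH show ?case
  proof
    assume "(u, v) \<in> \<rho> O (E O \<rho>)\<^sup>*"
    from zigzag_step[OF refl trans zigzag(1) this step.hyps(2)] show ?thesis .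
  next
    assume "(u, v) \<in> \<rho> O (E\<inverse> O \<rho>)\<^sup>*"
    from zigzag_step[OF refl' trans _ this, of w] show ?thesis using zigzag(2) step.hyps(2) by auto
  qed
qed

definition down_edges :: "vertex set \<Rightarrow> (vertex \<times> vertex) set" where
  "down_edges \<Gamma> = {(u, v). u \<in> \<Gamma> \<and> v \<in> \<Gamma> \<and> fst v = fst u + 1 \<and> (snd u = snd v \<or> snd u = snd v + 1)}"

lemma full_edges_eq: "full_edges \<Gamma> = down_edges \<Gamma> \<union> (down_edges \<Gamma>)\<inverse>"
  by (auto simp: full_edges_def R_edges_def down_edges_def Let_def)

definition same_run :: "vertex set \<Rightarrow> (vertex \<times> vertex) set" where
  "same_run \<Gamma> = {((i, j), (i', k)). i = i' \<and> (\<forall>c\<in>{min j k..max j k}. (i, c) \<in> \<Gamma>)}"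

lemma same_run_refl_iff: "(v, v) \<in> same_run \<Gamma> \<longleftrightarrow> v \<in> \<Gamma>"
  by (cases v) (simp add: same_run_def)

lemma trans_same_run: "trans (same_run \<Gamma>)"
proof (rule transI)
  fix u v w assume "(u, v) \<in> same_run \<Gamma>" "(v, w) \<in> same_run \<Gamma>"
  moreover have "c \<in> {min j l..max j l} \<Longrightarrow> c \<in> {min j k..max j k} \<or> c \<in> {min k l..max k l}" for c j k l :: int
    by auto
  ultimately show "(u, w) \<in> same_run \<Gamma>" unfolding same_run_def by fast
qed

lemma same_run_down:
  assumes down: "\<And>i j. (i, j) \<in> \<Gamma> \<Longrightarrow> (i, j + 1) \<in> \<Gamma> \<Longrightarrow> (i + 1, j) \<in> \<Gamma>"
  shows "(down_edges \<Gamma>)\<inverse> O same_run \<Gamma> O down_edges \<Gamma> \<subseteq> same_run \<Gamma>"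
proof clarify
  fix i' j' k' i j k i'' l
  assume edges: "((i, j), (i', j')) \<in> down_edges \<Gamma>" "((i'', k), (l, k')) \<in> down_edges \<Gamma>"
    and run: "((i, j), (i'', k)) \<in> same_run \<Gamma>"
  have rows: "i'' = i" "i' = i + 1" "l = i + 1" using edges run by (auto simp: down_edges_def same_run_def)
  have cols: "j = j' \<or> j = j' + 1" "k = k' \<or> k = k' + 1" and ends: "(i + 1, j') \<in> \<Gamma>" "(i + 1, k') \<in> \<Gamma>"
    using edges rows by (auto simp: down_edges_def)
  have "(i + 1, c) \<in> \<Gamma>" if "min j k \<le> c" "c < max j k" for c
    using that run down[of i c] by (auto simp: same_run_def)
  moreover have "c = j' \<or> c = k' \<or> min j k \<le> c \<and> c < max j k" if "c \<in> {min j' k'..max j' k'}" for c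
    using that cols by auto
  ultimately show "((i', j'), (l, k')) \<in> same_run \<Gamma>"
    using ends unfolding same_run_def rows by blast
qed

lemma same_run_up:
  assumes up: "\<And>i j. (i, j) \<in> \<Gamma> \<Longrightarrow> (i, j + 1) \<in> \<Gamma> \<Longrightarrow> a < i \<Longrightarrow> (i - 1, j + 1) \<in> \<Gamma>"
    and top: "\<And>v. v \<in> \<Gamma> \<Longrightarrow> a \<le> fst v"
  shows "down_edges \<Gamma> O same_run \<Gamma> O (down_edges \<Gamma>)\<inverse> \<subseteq> same_run \<Gamma>"
proof clarify
  fix i j i' j' i'' k' l k
  assume edges: "((i, j), (i', j')) \<in> down_edges \<Gamma>" "((l, k), (i'', k')) \<in> down_edges \<Gamma>"
    and run: "((i', j'), (i'', k')) \<in> same_run \<Gamma>"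
  have rows: "i'' = i + 1" "i' = i + 1" "l = i" using edges run by (auto simp: down_edges_def same_run_def)
  have cols: "j = j' \<or> j = j' + 1" "k = k' \<or> k = k' + 1" and ends: "(i, j) \<in> \<Gamma>" "(i, k) \<in> \<Gamma>"
    using edges rows by (auto simp: down_edges_def)
  have "(i, c) \<in> \<Gamma>" if "min j' k' < c" "c \<le> max j' k'" for c
    using that run up[of "i + 1" "c - 1"] top[OF ends(1)] by (auto simp: same_run_def rows)
  moreover have "c = j \<or> c = k \<or> min j' k' < c \<and> c \<le> max j' k'" if "c \<in> {min j k..max j k}" for c
    using that cols by auto
  ultimately show "((i, j), (l, k)) \<in> same_run \<Gamma>"
    using ends unfolding same_run_def rows by blast
qed

lemma exists_down_edge:
  assumes "(u, v) \<in> (full_edges \<Gamma>)\<^sup>*" "fst u \<le> i" "i < fst v"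
  obtains x y where "(x, y) \<in> down_edges \<Gamma>" "fst x = i"
proof -
  have "\<exists>x y. (x, y) \<in> down_edges \<Gamma> \<and> fst x = i"
    using assms
  proof (induction rule: rtrancl_induct)
    case (step v w)
    show ?case
    proof (cases "i < fst v")
      case False
      then have "(v, w) \<in> down_edges \<Gamma>" "fst v = i" using step by (auto simp: full_edges_eq down_edges_def)
      then show ?thesis by blast
    qed (use step in auto)
  qed simp
  then show thesis using that by blast
qed

lemma steps_of_adjacency:
  assumes "p < q \<longrightarrow> p' \<le> p \<and> p \<le> q'" "p < q \<longrightarrow> p' \<le> q - 1 \<and> q - 1 \<le> q'"
    "p' < q' \<longrightarrow> p \<le> p' + 1 \<and> p' + 1 \<le> q" "p' < q' \<longrightarrow> p \<le> q' \<and> q' \<le> q"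
    "p' \<le> j" "j \<le> q'" "p \<le> j \<and> j \<le> q \<or> p \<le> j + 1 \<and> j + 1 \<le> q"
  shows "steps p q p' q'"
  unfolding steps_def using assms by presburger

locale ordinary_subgraph =
  fixes \<Gamma> :: "vertex set"
  assumes ordinary: "ordinary \<Gamma>"
begin

definition bottom_row :: int where
  "bottom_row = Max (fst ` \<Gamma>)"

definition first_col :: "int \<Rightarrow> int" where
  "first_col i = Min {j. (i, j) \<in> \<Gamma>}"

definition last_col :: "int \<Rightarrow> int" where
  "last_col i = Max {j. (i, j) \<in> \<Gamma>}"

lemma finite_vertices: "finite \<Gamma>" and nonempty: "\<Gamma> \<noteq> {}"
  and connected: "u \<in> \<Gamma> \<Longrightarrow> v \<in> \<Gamma> \<Longrightarrow> (u, v) \<in> (full_edges \<Gamma>)\<^sup>*"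
  and down: "(i, j) \<in> \<Gamma> \<Longrightarrow> (i, j + 1) \<in> \<Gamma> \<Longrightarrow> (i + 1, j) \<in> \<Gamma>"
  and up: "(i, j) \<in> \<Gamma> \<Longrightarrow> (i, j + 1) \<in> \<Gamma> \<Longrightarrow> top_row \<Gamma> < i \<Longrightarrow> (i - 1, j + 1) \<in> \<Gamma>"
  using ordinary unfolding ordinary_def by auto

lemma row_bounds: "v \<in> \<Gamma> \<Longrightarrow> top_row \<Gamma> \<le> fst v" "v \<in> \<Gamma> \<Longrightarrow> fst v \<le> bottom_row"
  using finite_vertices by (auto simp: top_row_def bottom_row_def)

lemma row_convex:
  assumes "(i, j) \<in> \<Gamma>" "(i, k) \<in> \<Gamma>" "j \<le> c" "c \<le> k"
  shows "(i, c) \<in> \<Gamma>"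
proof -
  let ?E = "down_edges \<Gamma>" and ?\<rho> = "same_run \<Gamma>"
  have run_row: "(x, y) \<in> ?\<rho> \<Longrightarrow> fst y = fst x" and edge_row: "(x, y) \<in> ?E \<Longrightarrow> fst y = fst x + 1" for x y
    by (auto simp: same_run_def down_edges_def)
  have "fst x \<le> fst y \<and> (fst y = fst x \<longrightarrow> y = x)" if "(x, y) \<in> (?E O ?\<rho>)\<^sup>*" for x y
    using that by (induction rule: rtrancl_induct) (auto dest!: run_row edge_row)
  moreover have "fst y \<le> fst x \<and> (fst y = fst x \<longrightarrow> y = x)" if "(x, y) \<in> (?E\<inverse> O ?\<rho>)\<^sup>*" for x y
    using that by (induction rule: rtrancl_induct) (auto dest!: run_row edge_row)
  moreover have "((i, j), (i, k)) \<in> ?\<rho> O (?E O ?\<rho>)\<^sup>* \<union> ?\<rho> O (?E\<inverse> O ?\<rho>)\<^sup>*"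
  proof (rule zigzag_normal_form)
    show "((i, j), (i, k)) \<in> (?E \<union> ?E\<inverse>)\<^sup>*" using connected[OF assms(1,2)] by (simp add: full_edges_eq)
    show "?E O ?\<rho> O ?E\<inverse> \<subseteq> ?\<rho>" by (rule same_run_up[OF up row_bounds(1)])
    show "?E\<inverse> O ?\<rho> O ?E \<subseteq> ?\<rho>" by (rule same_run_down[OF down])
  qed (use assms(1) in \<open>auto simp: same_run_refl_iff down_edges_def trans_same_run\<close>)
  ultimately have "((i, j), (i, k)) \<in> ?\<rho>" using run_row by fastforce
  then show ?thesis using assms(3,4) by (auto simp: same_run_def)
qed

lemma exists_top: obtains j where "(top_row \<Gamma>, j) \<in> \<Gamma>"
proof -
  have "top_row \<Gamma> \<in> fst ` \<Gamma>" using finite_vertices nonempty by (simp add: top_row_def)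
  then show thesis using that by auto
qed

lemma exists_bottom: obtains j where "(bottom_row, j) \<in> \<Gamma>"
proof -
  have "bottom_row \<in> fst ` \<Gamma>" using finite_vertices nonempty by (simp add: bottom_row_def)
  then show thesis using that by auto
qed

lemma top_le_bottom: "top_row \<Gamma> \<le> bottom_row"
proof -
  obtain j where "(top_row \<Gamma>, j) \<in> \<Gamma>" by (rule exists_top)
  then show ?thesis using row_bounds(2) by fastforce
qed

lemma exists_down_edge_from_row:
  assumes "top_row \<Gamma> \<le> i" "i < bottom_row"
  obtains x y where "(x, y) \<in> down_edges \<Gamma>" "fst x = i"
proof -
  obtain j where j: "(top_row \<Gamma>, j) \<in> \<Gamma>" by (rule exists_top)
  obtain k where k: "(bottom_row, k) \<in> \<Gamma>" by (rule exists_bottom)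
  show thesis by (rule exists_down_edge[OF connected[OF j k], of i]) (use assms that in auto)
qed

lemma row_nonempty:
  assumes "top_row \<Gamma> \<le> i" "i \<le> bottom_row"
  shows "\<exists>j. (i, j) \<in> \<Gamma>"
proof (cases "i = bottom_row")
  case True
  then show ?thesis using exists_bottom by blast
next
  case False
  then have "i < bottom_row" using assms(2) by simp
  then obtain x y where "(x, y) \<in> down_edges \<Gamma>" "fst x = i" by (rule exists_down_edge_from_row[OF assms(1)])
  then show ?thesis by (cases x) (auto simp: down_edges_def)
qed

lemma mem_iff_between_cols:
  assumes "top_row \<Gamma> \<le> i" "i \<le> bottom_row"
  shows "(i, j) \<in> \<Gamma> \<longleftrightarrow> first_col i \<le> j \<and> j \<le> last_col i"
proof -
  let ?J = "{j. (i, j) \<in> \<Gamma>}"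
  have "?J \<subseteq> snd ` \<Gamma>" by force
  then have J: "finite ?J" "?J \<noteq> {}" using finite_vertices row_nonempty[OF assms] by (auto intro: finite_subset)
  have "(i, first_col i) \<in> \<Gamma>" "(i, last_col i) \<in> \<Gamma>"
    using Min_in[OF J] Max_in[OF J] by (auto simp: first_col_def last_col_def)
  moreover have "first_col i \<le> j \<and> j \<le> last_col i" if "(i, j) \<in> \<Gamma>"
    using that J(1) by (simp add: first_col_def last_col_def)
  ultimately show ?thesis using row_convex by blast
qed

lemma first_col_le_last_col:
  assumes "top_row \<Gamma> \<le> i" "i \<le> bottom_row"
  shows "first_col i \<le> last_col i"
  using row_nonempty[OF assms] mem_iff_between_cols[OF assms] by fastforce

lemma first_col_bottom: "first_col bottom_row = last_col bottom_row"
proof (rule ccontr)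
  assume "first_col bottom_row \<noteq> last_col bottom_row"
  then have "(bottom_row, first_col bottom_row) \<in> \<Gamma>" "(bottom_row, first_col bottom_row + 1) \<in> \<Gamma>"
    using first_col_le_last_col[of bottom_row] top_le_bottom by (auto simp: mem_iff_between_cols)
  then show False using down row_bounds(2) by fastforce
qed

lemma steps_cols:
  assumes i: "top_row \<Gamma> \<le> i" "i < bottom_row"
  shows "steps (first_col i) (last_col i) (first_col (i + 1)) (last_col (i + 1))"
proof -
  let ?p = "first_col i" and ?q = "last_col i" and ?p' = "first_col (i + 1)" and ?q' = "last_col (i + 1)"
  have upper: "(i, j) \<in> \<Gamma> \<longleftrightarrow> ?p \<le> j \<and> j \<le> ?q" and lower: "(i + 1, j) \<in> \<Gamma> \<longleftrightarrow> ?p' \<le> j \<and> j \<le> ?q'" for j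
    using i by (simp_all add: mem_iff_between_cols)
  have below: "?p' \<le> k \<and> k \<le> ?q'" if "?p \<le> k" "k + 1 \<le> ?q" for k
    using down[of i k] that by (simp add: upper lower)
  have above: "?p \<le> k + 1 \<and> k + 1 \<le> ?q" if "?p' \<le> k" "k + 1 \<le> ?q'" for k
    using up[of "i + 1" k] i that by (simp add: upper lower)
  obtain x y where edge: "(x, y) \<in> down_edges \<Gamma>" "fst x = i" using exists_down_edge_from_row[OF i] .
  define j where "j = snd y"
  have "(i + 1, j) \<in> \<Gamma>" "(i, j) \<in> \<Gamma> \<or> (i, j + 1) \<in> \<Gamma>"
    using edge by (cases x; cases y; auto simp: down_edges_def j_def)+
  then have "?p' \<le> j" "j \<le> ?q'" "?p \<le> j \<and> j \<le> ?q \<or> ?p \<le> j + 1 \<and> j + 1 \<le> ?q" by (simp_all add: upper lower)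
  then show ?thesis
    using below[of ?p] below[of "?q - 1"] above[of ?p'] above[of "?q' - 1"] by (intro steps_of_adjacency[of _ _ _ _ j]) auto
qed

theorem ordinary_diagram:
  obtains n p q where "diagram (top_row \<Gamma>) n p q" "cells (top_row \<Gamma>) n p q = \<Gamma>" "top_row \<Gamma> < n"
proof -
  define p where "p = first_col(bottom_row + 1 := first_col bottom_row)"
  define q where "q = last_col(bottom_row + 1 := first_col bottom_row - 1)"
  have "steps (p i) (q i) (p (i + 1)) (q (i + 1))" if "top_row \<Gamma> \<le> i" "i < bottom_row + 1" for i
  proof (cases "i = bottom_row")
    case True
    then show ?thesis using first_col_bottom by (simp add: p_def q_def steps_def)
  next
    case False
    then show ?thesis using steps_cols[of i] that by (simp add: p_def q_def)
  qed
  moreover have "p i \<le> q i + 1" if "top_row \<Gamma> \<le> i" "i \<le> bottom_row + 1" for i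
    using first_col_le_last_col[of i] that by (cases "i = bottom_row + 1") (auto simp: p_def q_def)
  ultimately have "diagram (top_row \<Gamma>) (bottom_row + 1) p q"
    using top_le_bottom by (simp add: diagram_def) (simp add: p_def q_def)
  moreover have "v \<in> cells (top_row \<Gamma>) (bottom_row + 1) p q \<longleftrightarrow> v \<in> \<Gamma>" for v
  proof (cases v)
    case (Pair i j)
    then show ?thesis using row_bounds[of v] mem_iff_between_cols[of i j] by (auto simp: mem_cells p_def q_def)
  qed
  then have "cells (top_row \<Gamma>) (bottom_row + 1) p q = \<Gamma>" by blast
  ultimately show thesis using top_le_bottom by (intro that) auto
qed

end

section \<open>Faces and components\<close>

lemma linear_lookup: "linear (\<lambda>s :: 'a \<Rightarrow>\<^sub>0 real. lookup s v)"
proof (rule linearI)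
  fix r and s :: "'a \<Rightarrow>\<^sub>0 real"
  have "finite {i. r *\<^sub>R lookup s i \<noteq> 0}"
    by (rule finite_subset[OF _ finite_lookup[of s]]) auto
  then show "lookup (r *\<^sub>R s) v = r *\<^sub>R lookup s v" by (simp add: scaleR_poly_mapping_def)
qed (rule lookup_add)

lemma lookup_scaleR: "lookup (r *\<^sub>R s) v = r * lookup s v" for s :: "'a \<Rightarrow>\<^sub>0 real"
  by (simp add: linear_scale[OF linear_lookup])

lemma zero_set_face_of:
  fixes h :: "'a::real_vector \<Rightarrow> real"
  assumes "convex D" "linear h" and nonneg: "\<And>x. x \<in> D \<Longrightarrow> 0 \<le> h x"
  shows "{x\<in>D. h x = 0} face_of D"
  unfolding face_of_def
proof (intro conjI ballI impI)
  note linear = linear_add[OF assms(2)] linear_scale[OF assms(2)]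
  show "convex {x\<in>D. h x = 0}"
    using assms(1) unfolding convex_def by (auto simp: linear)
  fix a b x assume a: "a \<in> D" and b: "b \<in> D" and x: "x \<in> {x\<in>D. h x = 0}" and "x \<in> open_segment a b"
  then obtain u where u: "0 < u" "u < 1" "x = (1 - u) *\<^sub>R a + u *\<^sub>R b" by (auto simp: in_segment)
  have "(1 - u) * h a + u * h b = 0" using x u(3) by (simp add: linear)
  moreover have "0 \<le> (1 - u) * h a" "0 \<le> u * h b" using nonneg[OF a] nonneg[OF b] u by auto
  ultimately have "(1 - u) * h a = 0" "u * h b = 0" by linarith+
  then show "a \<in> {x\<in>D. h x = 0}" "b \<in> {x\<in>D. h x = 0}" using a b u by auto
qed auto

lemma mem_face_of_minimal_face_eq:
  assumes "f face_of P" "y \<in> f" "minimal_face P x = minimal_face P y"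
  shows "x \<in> f"
proof -
  have "x \<in> minimal_face P x" by (simp add: minimal_face_def)
  then show ?thesis using assms by (auto simp: minimal_face_def)
qed

lemma convex_D_poly: "convex (D_poly \<Gamma> bs)"
  unfolding convex_def
proof (intro ballI allI impI)
  fix x y :: array and u v :: real
  assume x: "x \<in> D_poly \<Gamma> bs" and y: "y \<in> D_poly \<Gamma> bs" and uv: "0 \<le> u" "0 \<le> v" "u + v = 1"
  let ?L = "sorted_list_of_set {j. (top_row \<Gamma>, j) \<in> \<Gamma>}"
  have lookup: "lookup (u *\<^sub>R x + v *\<^sub>R y) w = u * lookup x w + v * lookup y w" for w
    by (simp add: lookup_add lookup_scaleR)
  have "map (\<lambda>j. lookup x (top_row \<Gamma>, j)) ?L = map (\<lambda>j. lookup y (top_row \<Gamma>, j)) ?L"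
    using x y by (simp add: D_poly_def)
  then have "map (\<lambda>j. lookup (u *\<^sub>R x + v *\<^sub>R y) (top_row \<Gamma>, j)) ?L = map (\<lambda>j. lookup x (top_row \<Gamma>, j)) ?L"
    unfolding lookup using uv(3) by (auto simp flip: distrib_right)
  also have "\<dots> = bs" using x by (simp add: D_poly_def)
  finally have top: "map (\<lambda>j. lookup (u *\<^sub>R x + v *\<^sub>R y) (top_row \<Gamma>, j)) ?L = bs" .
  have "u * a + v * b \<le> u * c + v * d" if "a \<le> c" "b \<le> d" for a b c d
    using that uv by (intro add_mono mult_left_mono)
  then show "u *\<^sub>R x + v *\<^sub>R y \<in> D_poly \<Gamma> bs" using x y top unfolding D_poly_def mem_Collect_eq lookup by simp
qed

lemma D_poly_edge_le:
  assumes "s \<in> D_poly \<Gamma> bs" "(u, v) \<in> down_edges \<Gamma>"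
  shows "if snd u = snd v then lookup s v \<le> lookup s u else lookup s u \<le> lookup s v"
proof -
  obtain i j where v: "v = (i, j)" by fastforce
  then have u: "u = (i - 1, j) \<or> u = (i - 1, j + 1)" and "u \<in> \<Gamma>" "v \<in> \<Gamma>"
    using assms(2) by (cases u, auto simp: down_edges_def)+
  then show ?thesis using assms(1) v by (auto simp: D_poly_def)
qed

lemma edge_equality_face_of_D_poly:
  assumes "(u, v) \<in> full_edges \<Gamma>"
  shows "{s\<in>D_poly \<Gamma> bs. lookup s u = lookup s v} face_of D_poly \<Gamma> bs"
proof -
  have face: "{s\<in>D_poly \<Gamma> bs. lookup s x = lookup s y} face_of D_poly \<Gamma> bs"
    if "\<And>s. s \<in> D_poly \<Gamma> bs \<Longrightarrow> lookup s y \<le> lookup s x" for x y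
    using zero_set_face_of[OF convex_D_poly linear_compose_sub[OF linear_lookup[of x] linear_lookup[of y]], of \<Gamma> bs] that
    by simp
  have commute: "{s\<in>D_poly \<Gamma> bs. lookup s x = lookup s y} = {s\<in>D_poly \<Gamma> bs. lookup s y = lookup s x}" for x y
    by auto
  have face_down: "{s\<in>D_poly \<Gamma> bs. lookup s x = lookup s y} face_of D_poly \<Gamma> bs" if "(x, y) \<in> down_edges \<Gamma>" for x y
  proof (cases "snd x = snd y")
    case True
    then show ?thesis using D_poly_edge_le[OF _ that] by (intro face) simp
  next
    case False
    then show ?thesis unfolding commute[of x y] using D_poly_edge_le[OF _ that] by (intro face) simp
  qed
  from assms consider (down) "(u, v) \<in> down_edges \<Gamma>" | (up) "(v, u) \<in> down_edges \<Gamma>" by (auto simp: full_edges_eq)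
  then show ?thesis
  proof cases
    case down
    then show ?thesis by (rule face_down)
  next
    case up
    then show ?thesis unfolding commute[of u v] by (rule face_down)
  qed
qed

lemma Delta_edges_minimal_face:
  assumes x: "x \<in> D_poly \<Gamma> bs"
  shows "Delta_edges \<Gamma> bs (minimal_face (D_poly \<Gamma> bs) x) = {(u, v) \<in> full_edges \<Gamma>. lookup x u = lookup x v}"
proof -
  have "lookup x u = lookup x v"
    if "(u, v) \<in> full_edges \<Gamma>" "y \<in> D_poly \<Gamma> bs" "lookup y u = lookup y v"
      "minimal_face (D_poly \<Gamma> bs) y = minimal_face (D_poly \<Gamma> bs) x" for u v y
    using mem_face_of_minimal_face_eq[OF edge_equality_face_of_D_poly[OF that(1)], of y bs x] that by simp
  then show ?thesis unfolding Delta_edges_def using x by blast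
qed

lemma face_weight_eq_prod:
  assumes "finite \<Gamma>"
  shows "face_weight \<Gamma> b f = (\<Prod>(X, i) \<in> {(X, i). X \<in> components \<Gamma> (Delta_edges \<Gamma> b f) \<and> top_row \<Gamma> < i \<and>
    card (row X i) = card (row X (i - 1)) + 1}. 1 - monom 1 (card (row X i)))"
proof -
  let ?E = "Delta_edges \<Gamma> b f" and ?g = "\<lambda>(X, i). card (row X i)"
  define S where "S = {(X, i). X \<in> components \<Gamma> ?E \<and> top_row \<Gamma> < i \<and> card (row X i) = card (row X (i - 1)) + 1}"
  have S: "X \<subseteq> \<Gamma>" "row X i \<noteq> {}" "0 < card (row X i)" if "(X, i) \<in> S" for X i
    using that by (auto simp: S_def components_def quotient_def)
  have "S \<subseteq> Pow \<Gamma> \<times> fst ` \<Gamma>"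
  proof clarify
    fix X i assume X: "(X, i) \<in> S"
    then obtain v where "v \<in> X" "fst v = i" using S(2) by (fastforce simp: row_def)
    then show "X \<in> Pow \<Gamma> \<and> i \<in> fst ` \<Gamma>" using S(1)[OF X] by auto
  qed
  then have finite: "finite S" by (rule finite_subset) (simp add: assms)
  have image: "?g ` S \<subseteq> {1..card \<Gamma>}"
  proof clarify
    fix X i assume X: "(X, i) \<in> S"
    then have "card (row X i) \<le> card \<Gamma>" using S(1) by (intro card_mono assms) (auto simp: row_def)
    then show "card (row X i) \<in> {1..card \<Gamma>}" using S(3)[OF X] by simp
  qed
  have "d_count \<Gamma> b f l = card {z\<in>S. ?g z = l}" if "l \<in> {1..card \<Gamma>}" for l
    unfolding d_count_def by (rule arg_cong[where f = card]) (use that in \<open>auto simp: S_def\<close>)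
  then have "face_weight \<Gamma> b f = (\<Prod>l = 1..card \<Gamma>. \<Prod>z\<in>{z\<in>S. ?g z = l}. 1 - monom 1 (?g z))"
    unfolding face_weight_def by (intro prod.cong) auto
  also have "\<dots> = (\<Prod>z\<in>S. 1 - monom 1 (?g z))" by (rule prod.group[OF finite _ image]) simp
  finally show ?thesis unfolding S_def by (simp add: case_prod_unfold)
qed

lemma component_eq:
  assumes "sym E" "X \<in> components V E" "u \<in> X"
  shows "X = {v\<in>V. (u, v) \<in> E\<^sup>*}"
proof -
  have "sym (E\<^sup>*)" using assms(1) by (rule sym_rtrancl)
  then have "equiv V (E\<^sup>* \<inter> V \<times> V)"
    by (auto simp: equiv_def refl_on_def sym_def trans_def intro: rtrancl_trans)
  moreover obtain w where "w \<in> V" "X = (E\<^sup>* \<inter> V \<times> V) `` {w}"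
    using assms(2) unfolding components_def by (rule quotientE)
  ultimately have "X = (E\<^sup>* \<inter> V \<times> V) `` {u}" "u \<in> V" using assms(3) by (auto dest: equiv_class_eq)
  then show ?thesis by auto
qed

lemma component_of_mem_components: "u \<in> V \<Longrightarrow> {v\<in>V. (u, v) \<in> E\<^sup>*} \<in> components V E"
  unfolding components_def by (rule quotientI[THEN back_subst[of "\<lambda>X. X \<in> _"]]) auto

subsection \<open>The polyhedron of a diagram\<close>

lemma lookup_map_real: "lookup (Poly_Mapping.map real_of_int s) v = real_of_int (lookup s v)"
  by (simp add: map.rep_eq when_def)

lemma map_upto_eq_iff:
  assumes "length xs = nat (q - p + 1)"
  shows "map f [p..q] = xs \<longleftrightarrow> (\<forall>j\<in>{p..q}. f j = xs ! nat (j - p))"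
proof -
  have "map f [p..q] = xs \<longleftrightarrow> (\<forall>k<nat (q - p + 1). f (p + int k) = xs ! k)"
    using assms by (auto simp: list_eq_iff_nth_eq nth_upto)
  also have "\<dots> \<longleftrightarrow> (\<forall>j\<in>{p..q}. f j = xs ! nat (j - p))"
  proof safe
    fix j assume "\<forall>k<nat (q - p + 1). f (p + int k) = xs ! k" "j \<in> {p..q}"
    then show "f j = xs ! nat (j - p)" by (auto dest!: spec[of _ "nat (j - p)"])
  next
    fix k assume "\<forall>j\<in>{p..q}. f j = xs ! nat (j - p)" "k < nat (q - p + 1)"
    then show "f (p + int k) = xs ! k" by (auto dest!: bspec[of _ _ "p + int k"])
  qed
  finally show ?thesis .
qed

locale diagram_graph =
  fixes a n :: int and p q :: "int \<Rightarrow> int"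
  assumes diagram: "diagram a n p q" and top_row: "top_row (cells a n p q) = a" and less: "a < n"
begin

abbreviation "\<Gamma> \<equiv> cells a n p q"

definition layers_interlaced :: "(vertex \<Rightarrow>\<^sub>0 int) \<Rightarrow> bool" where
  "layers_interlaced s \<longleftrightarrow> (\<forall>i\<in>{a..<n}. interlaced {p i..q i} {p (i + 1)..q (i + 1)} (entries s i) (entries s (i + 1)))"

lemma layers_interlaced_iff:
  "layers_interlaced s \<longleftrightarrow>
    (\<forall>i j. (i - 1, j) \<in> \<Gamma> \<and> (i, j) \<in> \<Gamma> \<longrightarrow> lookup s (i, j) \<le> lookup s (i - 1, j)) \<and>
    (\<forall>i j. (i, j) \<in> \<Gamma> \<and> (i - 1, j + 1) \<in> \<Gamma> \<longrightarrow> lookup s (i - 1, j + 1) \<le> lookup s (i, j))"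
proof -
  have shift: "(\<forall>i::int. P i) \<longleftrightarrow> (\<forall>i. P (i + 1))" for P by (metis diff_add_cancel)
  have "(\<forall>i j. (i - 1, j) \<in> \<Gamma> \<and> (i, j) \<in> \<Gamma> \<longrightarrow> lookup s (i, j) \<le> lookup s (i - 1, j)) \<longleftrightarrow>
      (\<forall>i j. (i, j) \<in> \<Gamma> \<and> (i + 1, j) \<in> \<Gamma> \<longrightarrow> lookup s (i + 1, j) \<le> lookup s (i, j))"
    by (subst shift) simp
  moreover have "(\<forall>i j. (i, j) \<in> \<Gamma> \<and> (i - 1, j + 1) \<in> \<Gamma> \<longrightarrow> lookup s (i - 1, j + 1) \<le> lookup s (i, j)) \<longleftrightarrow>
      (\<forall>i j. (i + 1, j) \<in> \<Gamma> \<and> (i, j + 1) \<in> \<Gamma> \<longrightarrow> lookup s (i, j + 1) \<le> lookup s (i + 1, j))"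
    by (subst shift) simp
  ultimately show ?thesis by (auto simp: layers_interlaced_def interlaced_def mem_cells)
qed

lemma mem_D_poly_iff:
  assumes "length bs = nat (q a - p a + 1)"
  shows "Poly_Mapping.map real_of_int s \<in> D_poly \<Gamma> (map real_of_int bs) \<longleftrightarrow>
    admissible a n p q (\<lambda>j. bs ! nat (j - p a)) s \<and> layers_interlaced s"
proof -
  have "{j. (a, j) \<in> \<Gamma>} = {p a..q a}" using less by (auto simp: mem_cells)
  moreover have "sorted_list_of_set {p a..q a} = [p a..q a]"
    by (rule sorted_distinct_set_unique) auto
  ultimately have columns: "sorted_list_of_set {j. (a, j) \<in> \<Gamma>} = [p a..q a]" by simp
  have "map (\<lambda>j. real_of_int (lookup s (a, j))) [p a..q a] = map real_of_int bs \<longleftrightarrow>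
    map (\<lambda>j. lookup s (a, j)) [p a..q a] = bs"
    using inj_map_eq_map[of real_of_int "map (\<lambda>j. lookup s (a, j)) [p a..q a]" bs] by (simp add: inj_def comp_def)
  then show ?thesis
    unfolding D_poly_def mem_Collect_eq lookup_map_real top_row columns layers_interlaced_iff
      admissible_def map_upto_eq_iff[OF assms, symmetric]
    by simp
qed

end

subsection \<open>Components of level sets\<close>

locale interlacing_array = diagram_graph +
  fixes s :: "vertex \<Rightarrow>\<^sub>0 int"
  assumes interlacing: "layers_interlaced s"
begin

abbreviation "level_edges \<equiv> {(u, v) \<in> full_edges \<Gamma>. lookup s u = lookup s v}"

lemma sym_level_edges: "sym level_edges"
  by (auto simp: sym_def full_edges_eq)

lemma level_edgesI: "(u, v) \<in> down_edges \<Gamma> \<Longrightarrow> lookup s u = lookup s v \<Longrightarrow> (u, v) \<in> level_edges \<and> (v, u) \<in> level_edges"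
  by (auto simp: full_edges_eq)

lemma less_bottom: "(i, j) \<in> \<Gamma> \<Longrightarrow> i < n"
  using diagram by (cases "i = n") (auto simp: mem_cells diagram_def)

lemma steps_row: "a \<le> i \<Longrightarrow> i < n \<Longrightarrow> steps (p i) (q i) (p (i + 1)) (q (i + 1))"
  using diagram by (simp add: diagram_def)

lemma le_above: "(i, j) \<in> \<Gamma> \<Longrightarrow> (i + 1, j) \<in> \<Gamma> \<Longrightarrow> lookup s (i + 1, j) \<le> lookup s (i, j)"
  and ge_above_right: "(i, j + 1) \<in> \<Gamma> \<Longrightarrow> (i + 1, j) \<in> \<Gamma> \<Longrightarrow> lookup s (i, j + 1) \<le> lookup s (i + 1, j)"
  using interlacing by (auto simp: layers_interlaced_def interlaced_def mem_cells)

lemma row_antimono: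
  assumes "(i, j) \<in> \<Gamma>" "(i, k) \<in> \<Gamma>" "j \<le> k"
  shows "lookup s (i, k) \<le> lookup s (i, j)"
proof -
  have i: "a \<le> i" "i < n" using assms(1) less_bottom by (auto simp: mem_cells)
  have "antimono_on {p i..q i} (entries s i)"
    using interlaced_antimono_on(1)[OF steps_row[OF i], of "entries s i" "entries s (i + 1)"] interlacing i
    by (simp add: layers_interlaced_def)
  from monotone_onD[OF this, of j k] show ?thesis using assms by (simp add: mem_cells)
qed

lemma level_path_row_right:
  assumes "j \<le> k" "(i, j) \<in> \<Gamma>" "(i, k) \<in> \<Gamma>" "lookup s (i, j) = lookup s (i, k)"
  shows "((i, j), (i, k)) \<in> level_edges\<^sup>*"
  using assms
proof (induction k rule: int_ge_induct)
  case (step k)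
  have i: "a \<le> i" "i < n" using step.prems less_bottom by (auto simp: mem_cells)
  have k: "(i, k) \<in> \<Gamma>" using step.prems step.hyps by (auto simp: mem_cells)
  have below: "(i + 1, k) \<in> \<Gamma>" using steps_row[OF i] step.prems k i by (auto simp: mem_cells steps_def)
  have "lookup s (i, k) = lookup s (i, k + 1)"
    using row_antimono[OF step.prems(1) k step.hyps] row_antimono[OF k step.prems(2)] step.prems(3) by simp
  then have eq: "lookup s (i, k) = lookup s (i + 1, k)" "lookup s (i, k + 1) = lookup s (i + 1, k)"
    using le_above[OF k below] ge_above_right[OF step.prems(2) below] by auto
  have "((i, k), (i + 1, k)) \<in> down_edges \<Gamma>" "((i, k + 1), (i + 1, k)) \<in> down_edges \<Gamma>"
    using k below step.prems(2) by (simp_all add: down_edges_def)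
  then have "((i, k), (i + 1, k)) \<in> level_edges" "((i + 1, k), (i, k + 1)) \<in> level_edges"
    using level_edgesI eq by blast+
  moreover have "((i, j), (i, k)) \<in> level_edges\<^sup>*" using step.IH step.prems k eq by simp
  ultimately show ?case by (meson rtrancl.rtrancl_into_rtrancl)
qed simp

lemma level_path_row:
  assumes "(i, j) \<in> \<Gamma>" "(i, k) \<in> \<Gamma>" "lookup s (i, j) = lookup s (i, k)"
  shows "((i, j), (i, k)) \<in> level_edges\<^sup>*"
proof (cases "j \<le> k")
  case False
  then have "((i, k), (i, j)) \<in> level_edges\<^sup>*" using assms by (intro level_path_row_right) auto
  then show ?thesis using sym_rtrancl[OF sym_level_edges] by (meson symD)
qed (use level_path_row_right assms in blast)

lemma level_path_row_above:
  assumes j: "(i + 1, j) \<in> \<Gamma>" and k: "(i, k) \<in> \<Gamma>" and eq: "lookup s (i + 1, j) = lookup s (i, k)"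
  shows "((i + 1, j), (i, k)) \<in> level_edges\<^sup>*"
proof -
  have i: "a \<le> i" "i < n" using k less_bottom by (auto simp: mem_cells)
  define j' where "j' = (if k \<le> j then j else j + 1)"
  have j': "(i, j') \<in> \<Gamma>" using steps_row[OF i] j k i by (auto simp: mem_cells steps_def j'_def)
  have "lookup s (i, j') = lookup s (i, k)"
  proof (cases "k \<le> j")
    case True
    then show ?thesis using row_antimono[OF k j'] le_above[of i j] j j' eq by (simp add: j'_def)
  next
    case False
    then show ?thesis using row_antimono[OF j' k] ge_above_right[of i j] j j' eq by (simp add: j'_def)
  qed
  moreover from this have "((i + 1, j), (i, j')) \<in> level_edges"
    using level_edgesI[of "(i, j')" "(i + 1, j)"] j j' eq by (auto simp: down_edges_def j'_def)
  ultimately show ?thesis using level_path_row[OF j' k] by (meson converse_rtrancl_into_rtrancl)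
qed

lemma lookup_level_path: "(u, v) \<in> level_edges\<^sup>* \<Longrightarrow> lookup s u = lookup s v"
  by (induction rule: rtrancl_induct) auto

definition mult :: "int \<Rightarrow> int \<Rightarrow> nat" where
  "mult i c = card {j\<in>{p i..q i}. lookup s (i, j) = c}"

definition level_component :: "int \<Rightarrow> int \<Rightarrow> vertex set" where
  "level_component i c = {v\<in>\<Gamma>. \<exists>j. (i, j) \<in> \<Gamma> \<and> lookup s (i, j) = c \<and> ((i, j), v) \<in> level_edges\<^sup>*}"

lemma level_component_eq:
  assumes "(i, j) \<in> \<Gamma>"
  shows "level_component i (lookup s (i, j)) = {v\<in>\<Gamma>. ((i, j), v) \<in> level_edges\<^sup>*}"
  unfolding level_component_def using assms by (auto intro: rtrancl_trans[OF level_path_row])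

lemma card_row_level_component:
  assumes j: "(i, j) \<in> \<Gamma>" and i': "i' = i \<or> i' = i - 1" "a \<le> i'"
  shows "card (row (level_component i (lookup s (i, j))) i') = mult i' (lookup s (i, j))"
proof -
  have "((i, j), (i', k)) \<in> level_edges\<^sup>* \<longleftrightarrow> lookup s (i', k) = lookup s (i, j)" if "(i', k) \<in> \<Gamma>" for k
  proof
    assume "lookup s (i', k) = lookup s (i, j)"
    then show "((i, j), (i', k)) \<in> level_edges\<^sup>*"
      using i'(1) level_path_row[OF j, of k] level_path_row_above[of "i - 1" j k] j that by (elim disjE) simp_all
  qed (use lookup_level_path in force)
  moreover have "i' \<le> n" using i'(1) j by (auto simp: mem_cells)
  ultimately have "row (level_component i (lookup s (i, j))) i' = {i'} \<times> {k\<in>{p i'..q i'}. lookup s (i', k) = lookup s (i, j)}"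
    using i'(2) unfolding level_component_eq[OF j] by (auto simp: row_def mem_cells)
  then show ?thesis by (simp add: mult_def card_cartesian_product_singleton)
qed

definition growing_levels :: "int \<Rightarrow> int set" where
  "growing_levels i = {c \<in> entries s i ` {p i..q i}. mult i c = mult (i - 1) c + 1}"

lemma bij_betw_level_component:
  "bij_betw (\<lambda>(i, c). (level_component i c, i)) (SIGMA i:{a + 1..n}. growing_levels i)
    {(X, i). X \<in> components \<Gamma> level_edges \<and> a < i \<and> card (row X i) = card (row X (i - 1)) + 1}"
    (is "bij_betw ?h ?Y ?S")
proof (rule bij_betw_imageI)
  have "c = c'" if c: "c \<in> growing_levels i" and c': "c' \<in> growing_levels i" and i: "i \<in> {a + 1..n}"
    and eq: "level_component i c = level_component i c'" for i c c'
  proof -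
    obtain j where j: "(i, j) \<in> \<Gamma>" "c = lookup s (i, j)" using c i by (auto simp: growing_levels_def mem_cells)
    then have "(i, j) \<in> level_component i c" by (auto simp: level_component_eq)
    then show "c = c'" unfolding eq by (auto simp: level_component_def j(2) dest: lookup_level_path)
  qed
  then show "inj_on ?h ?Y" by (auto simp: inj_on_def)
  show "?h ` ?Y = ?S"
  proof (intro equalityI subsetI)
    fix z assume "z \<in> ?h ` ?Y"
    then obtain i j where z: "z = (level_component i (lookup s (i, j)), i)" and i: "i \<in> {a + 1..n}" and j: "(i, j) \<in> \<Gamma>"
      and mult: "mult i (lookup s (i, j)) = mult (i - 1) (lookup s (i, j)) + 1"
      by (fastforce simp: growing_levels_def mem_cells)
    have "level_component i (lookup s (i, j)) \<in> components \<Gamma> level_edges"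
      unfolding level_component_eq[OF j] using j by (rule component_of_mem_components)
    then show "z \<in> ?S" using i by (auto simp: z card_row_level_component[OF j] mult)
  next
    fix z assume "z \<in> ?S"
    then obtain X i where z: "z = (X, i)" and X: "X \<in> components \<Gamma> level_edges" and i: "a < i"
      and card: "card (row X i) = card (row X (i - 1)) + 1" by auto
    then have "row X i \<noteq> {}" by auto
    then obtain j where j: "(i, j) \<in> X" by (auto simp: row_def)
    have X_eq: "X = {v\<in>\<Gamma>. ((i, j), v) \<in> level_edges\<^sup>*}" by (rule component_eq[OF sym_level_edges X j])
    then have \<Gamma>: "(i, j) \<in> \<Gamma>" using j by auto
    have X_level: "X = level_component i (lookup s (i, j))" unfolding level_component_eq[OF \<Gamma>] by (rule X_eq)
    then have "lookup s (i, j) \<in> growing_levels i"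
      using card i \<Gamma> by (auto simp: card_row_level_component[OF \<Gamma>] growing_levels_def mem_cells)
    then show "z \<in> ?h ` ?Y" using z X_level i \<Gamma> by (force simp: mem_cells)
  qed
qed

lemma layer_wt_eq_prod_growing_levels:
  assumes "i \<in> {a..<n}"
  shows "layer_wt t p q s i = (\<Prod>c\<in>growing_levels (i + 1). 1 - t ^ mult (i + 1) c)"
proof -
  have "layer_wt t p q s i = (\<Prod>c\<in>entries s (i + 1) ` {p (i + 1)..q (i + 1)}. row_wt t (mult i c) (mult (i + 1) c))"
    using interlacing assms by (simp add: layer_wt_def pair_wt_def mult_def layers_interlaced_def)
  also have "\<dots> = (\<Prod>c\<in>growing_levels (i + 1). row_wt t (mult i c) (mult (i + 1) c))"
    by (rule prod.mono_neutral_right) (auto simp: growing_levels_def row_wt_def)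
  also have "\<dots> = (\<Prod>c\<in>growing_levels (i + 1). 1 - t ^ mult (i + 1) c)"
    by (rule prod.cong) (auto simp: growing_levels_def row_wt_def)
  finally show ?thesis .
qed

lemma coef_fract_face_weight:
  assumes "Delta_edges \<Gamma> b f = level_edges"
  shows "coef_fract (face_weight \<Gamma> b f) = (\<Prod>i\<in>{a..<n}. layer_wt tvar p q s i)"
proof -
  let ?S = "{(X, i). X \<in> components \<Gamma> level_edges \<and> a < i \<and> card (row X i) = card (row X (i - 1)) + 1}"
  have "coef_fract (face_weight \<Gamma> b f) = (\<Prod>(X, i)\<in>?S. 1 - tvar ^ card (row X i))"
    by (simp add: face_weight_eq_prod assms top_row coef_fract_prod coef_fract_diff coef_fract_monom case_prod_unfold)
  also have "\<dots> = (\<Prod>(i, c)\<in>(SIGMA i:{a + 1..n}. growing_levels i). 1 - tvar ^ card (row (level_component i c) i))"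
    using prod.reindex_bij_betw[OF bij_betw_level_component, of "\<lambda>(X, i). 1 - tvar ^ card (row X i)"]
    by (simp add: case_prod_unfold)
  also have "\<dots> = (\<Prod>(i, c)\<in>(SIGMA i:{a + 1..n}. growing_levels i). 1 - tvar ^ mult i c)"
  proof (rule prod.cong[OF refl], clarify)
    fix i c assume "i \<in> {a + 1..n}" "c \<in> growing_levels i"
    then obtain j where "(i, j) \<in> \<Gamma>" "c = lookup s (i, j)" "a \<le> i" by (auto simp: growing_levels_def mem_cells)
    then show "1 - tvar ^ card (row (level_component i c) i) = 1 - tvar ^ mult i c" by (simp add: card_row_level_component)
  qed
  also have "\<dots> = (\<Prod>i\<in>{a + 1..n}. \<Prod>c\<in>growing_levels i. 1 - tvar ^ mult i c)"
    by (rule prod.Sigma[symmetric]) (auto simp: growing_levels_def)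
  also have "\<dots> = (\<Prod>i\<in>{a..<n}. \<Prod>c\<in>growing_levels (i + 1). 1 - tvar ^ mult (i + 1) c)"
    by (rule prod.reindex_bij_witness[where i = "\<lambda>i. i + 1" and j = "\<lambda>i. i - 1"]) auto
  also have "\<dots> = (\<Prod>i\<in>{a..<n}. layer_wt tvar p q s i)"
    by (rule prod.cong) (simp_all add: layer_wt_eq_prod_growing_levels)
  finally show ?thesis .
qed

end

lemma (in diagram_graph) coef_fract_weighted_series:
  assumes bs: "length bs = nat (q a - p a + 1)"
  shows "coef_fract (weighted_series (face_weight \<Gamma> (map real_of_int bs)) (D_poly \<Gamma> (map real_of_int bs)) s) =
    diagram_wt tvar a n p q (\<lambda>j. bs ! nat (j - p a)) s"
proof (cases "Poly_Mapping.map real_of_int s \<in> D_poly \<Gamma> (map real_of_int bs)")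
  case True
  then have admissible: "admissible a n p q (\<lambda>j. bs ! nat (j - p a)) s" and "layers_interlaced s"
    by (simp_all add: mem_D_poly_iff[OF bs])
  then interpret interlacing_array a n p q s by unfold_locales
  show ?thesis
    using True admissible
    by (simp add: weighted_series_def Let_def diagram_wt_def coef_fract_face_weight Delta_edges_minimal_face lookup_map_real)
next
  case outside: False
  have "diagram_wt tvar a n p q (\<lambda>j. bs ! nat (j - p a)) s = 0"
  proof (cases "layers_interlaced s")
    case True
    then show ?thesis using outside by (simp add: mem_D_poly_iff[OF bs] diagram_wt_def)
  next
    case False
    then have "\<exists>i\<in>{a..<n}. layer_wt tvar p q s i = 0"
      using interlaced_of_pair_wt unfolding layers_interlaced_def layer_wt_def by blast
    then have "(\<Prod>i\<in>{a..<n}. layer_wt tvar p q s i) = 0" by (intro prod_zero) simp_all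
    then show ?thesis unfolding diagram_wt_def by (simp only: zero_when)
  qed
  then show ?thesis using outside by (simp add: weighted_series_def Let_def)
qed

lemma card_row_cells:
  "card (row (cells a n p q) i) = (if a \<le> i \<and> i \<le> n then nat (q i - p i + 1) else 0)"
proof -
  have "row (cells a n p q) i = (if a \<le> i \<and> i \<le> n then {i} \<times> {p i..q i} else {})" by (auto simp: row_def mem_cells)
  then show ?thesis by (simp add: card_cartesian_product_singleton)
qed

lemma enlarging_rowI:
  assumes diagram: "diagram a n p q" and x: "generic t x"
    and grow: "a \<le> i" "card (row (cells a n p q) i) < card (row (cells a n p q) (i + 1))"
  shows "enlarging_row t x a n p q (i + 1)"
proof -
  have i: "i + 1 < n" using grow diagram by (cases "i + 1 = n") (auto simp: card_row_cells diagram_def split: if_splits)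
  then have "steps (p i) (q i) (p (i + 1)) (q (i + 1))" "p i \<le> q i + 1" using diagram grow(1) by (auto simp: diagram_def)
  then have "p (i + 1) = p i - 1" "q (i + 1) = q i" using grow i by (auto simp: steps_def card_row_cells)
  then show ?thesis using diagram x grow(1) i by unfold_locales auto
qed

theorem theorem8:
  fixes \<Gamma> :: "vertex set" and bs :: "int list"
  assumes "ordinary \<Gamma>"
    and "\<exists>i\<ge>top_row \<Gamma>. card (row \<Gamma> (i + 1)) > card (row \<Gamma> i)"
    and "length bs = top_length \<Gamma>"
    and "sorted_wrt (\<ge>) bs"
  shows "psi \<Gamma> bs = 0"
proof -
  interpret ordinary_subgraph \<Gamma> using assms(1) by unfold_locales
  obtain n p q where diagram: "diagram (top_row \<Gamma>) n p q" and cells: "cells (top_row \<Gamma>) n p q = \<Gamma>" and "top_row \<Gamma> < n"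
    using ordinary_diagram by blast
  interpret diagram_graph "top_row \<Gamma>" n p q
    using diagram \<open>top_row \<Gamma> < n\<close> by unfold_locales (simp_all add: cells)
  have length: "length bs = nat (q (top_row \<Gamma>) - p (top_row \<Gamma>) + 1)"
    using assms(3) \<open>top_row \<Gamma> < n\<close> card_row_cells[of "top_row \<Gamma>" n p q "top_row \<Gamma>"] by (simp add: top_length_def cells)
  obtain i where "top_row \<Gamma> \<le> i" "card (row \<Gamma> i) < card (row \<Gamma> (i + 1))" using assms(2) by blast
  then have "enlarging_row tvar xvar (top_row \<Gamma>) n p q (i + 1)"
    by (intro enlarging_rowI diagram generic_xvar) (simp_all add: cells)
  then have "has_reg_sum (diagram_series tvar xvar (top_row \<Gamma>) n p q (\<lambda>j. bs ! nat (j - p (top_row \<Gamma>)))) 0"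
    by (rule has_reg_sum_diagram_series_0)
  then show ?thesis
    unfolding psi_def Let_def
    by (rule F_spec_weighted_ipt_eq_diagram_reg_sum[OF coef_fract_weighted_series[OF length, unfolded cells]])
qed

end
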